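(* For each $b\in\mathcal{B}$ the limit $$\lim_{\lambda\uparrow q+q^{-1}}\frac{\omega_\lambda(b)-\epsilon(b)}{q+q^{-1}-\lambda}$$ converges, and the resulting map $\mathcal{B}\to\mathbb{C}$ is a generating functional on $\mathcal{B}=\mathcal{O}_q(S_t^2)$. Furthermore, the limit is expressed as a constant multiple of the derivative of a normalization of an Askey--Wilson polynomial: there is a constant $c$ depending only on $q$ and $a$ such that for every $n\in\mathbb{Z}_{\ge 0}$ the limit for $b=u^n_{[a],[a]}$ equals $c\,P_n'(1)$, where $P_n$ is the polynomial with $u^n_{[a],[a]}=P_n(u^1_{[a],[a]})$.
   Context: Fix $0<q<1$, $a\in\mathbb{R}$, $t=q^a-q^{-a}$. Put $[x]=\frac{q^x-q^{-x}}{q-q^{-1}}$ and $i=\sqrt{-1}$ in formulas for operators. Inner products are linear in the second variable. $U=U_q(\mathfrak{su}(2))$ is the Hopf $*$-algebra generated by $k^{\pm1},e,f$ with $ke=q^2ek$, $kf=q^{-2}fk$, $[e,f]=\frac{k-k^{-1}}{q-q^{-1}}$, $\Delta(k)=k\otimes k$, $\Delta(e)=e\otimes1+k\otimes e$, $\Delta(f)=1\otimes f+f\otimes k^{-1}$, $\epsilon(k)=1$, $\epsilon(e)=\epsilon(f)=0$, $S(k)=k^{-1}$, $S(e)=-k^{-1}e$, $S(f)=-fk$, $k^*=k$, $e^*=fk$, $f^*=k^{-1}e$. For $s\in\frac12\mathbb{Z}_{\ge0}$, $(\pi_s,H_s)$ is the $*$-representation with orthonormal basis $\xi^s_j$ ($j=-s,\dots,s$),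 $\pi_s(k)\xi^s_j=q^{2j}\xi^s_j$, $\pi_s(e)\xi^s_j=q^{j+1}([s-j][s+j+1])^{1/2}\xi^s_{j+1}$, $\pi_s(f)\xi^s_j=q^{-j}([s+j][s-j+1])^{1/2}\xi^s_{j-1}$. $\mathcal{A}=\mathcal{O}_q(SU(2))$ is the dual Hopf $*$-algebra spanned by the matrix coefficients $u^s_{\xi,\eta}$, $(u^s_{\xi,\eta},h)=\langle\xi,\pi_s(h)\eta\rangle$, with product dual to $\Delta$, coproduct dual to the product of $U$, counit $\epsilon(u)=(u,1)$, and $(x^*,h)=\overline{(x,S(h)^* )}$. For $h\in U$, $x\in\mathcal{A}$ put $h\rhd x=x_{(1)}(x_{(2)},h)$ and $x\lhd h=(x_{(1)},h)x_{(2)}$. Let $B_t=q^{-1/2}(e-fk)-i(q-q^{-1})^{-1}tk$, and let $R$ be the unitary antipode of $U$ (the $*$-preserving anti-automorphism with $R(k)=k^{-1}$, $R(e)=-qk^{-1}e$, $R(f)=-q^{-1}fk$). Let $I=\mathbb{C}[R(B_t)]$, a right coideal of $U$. The Podleś sphere is the unital left coideal $*$-subalgebra $\mathcal{B}=\mathcal{O}_q(S_t^2)=\{x\in\mathcal{A}: R(B_t)\rhd x=\epsilon(B_t)x\}$. For $n\in\mathbb{Z}_{\ge0}$ the operator $\pi_n(iR(B_t))$ is self-adjoint with simple eigenvalues $[a+2j]$, $j=-n,\dots,n$; let $\eta^n_{[a+2j]}\in H_n$ be unit eigenvectors and $u^n_{[a+2j],[a]}=u^n_{\eta^n_{[a+2j]},\eta^n_{[a]}}$.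 These elements ($n\ge0$, $|j|\le n$) form a basis of $\mathcal{B}$. An admissible $*$-representation (of the quantized enveloping algebra $\mathcal{B}\bowtie I$) is a pre-Hilbert space with $*$-representations of $\mathcal{B}$ and $I$ by adjointable operators such that $bh=h_{(1)}(b\lhd h_{(2)})$ for $b\in\mathcal{B},h\in I$, and on which $iR(B_t)$ is diagonalizable with eigenvalues (weights) in $\{[a+n]:n\in\mathbb{Z}\}$, each of finite multiplicity. For $0<\lambda<q+q^{-1}$, $\mathcal{L}_\lambda^+=(\pi_\lambda,\mathcal{L}^+_\lambda)$ is the irreducible admissible $*$-representation (unique up to unitary equivalence) with weights $[a+2n]$, $n\in\mathbb{Z}$, each of multiplicity one, whose unit vector $e_a^\lambda$ of weight $[a]$ satisfies $$\pi_\lambda(u^1_{[a],[a]})e_a^\lambda=\frac{\lambda+(q+q^{-1})^{-1}t^2}{q+q^{-1}+(q+q^{-1})^{-1}t^2}\,e_a^\lambda .$$ Put $\omega_\lambda(b)=\langle e^\lambda_a,\pi_\lambda(b)e^\lambda_a\rangle$ for $b\in\mathcal{B}$. A linear map $L:\mathcal{B}\to\mathbb{C}$ is a generating functional if $L(x^*x)\ge0$ whenever $\epsilon(x)=0$, $L(x^* )=\overline{L(x)}$ for all $x\in\mathcal{B}$, and $L(1)=0$. For each $n$ there is a unique polynomial $P_n$ (of degree $n$) with $u^n_{[a],[a]}=P_n(u^1_{[a],[a]})$. It is a normalization of an Askey--Wilson polynomial in the sense that $X\mapsto P_n\big(\frac{2X+(q+q^{-1})^{-1}t^2}{q+q^{-1}+(q+q^{-1})^{-1}t^2}\big)$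 is a scalar multiple of $p_n(X;-q^{-2a+1},-q^{2a+1},q,q\,|\,q^2)$. *)

theory Defs
  imports
    "HOL-Analysis.Analysis"
    "HOL-Library.Poly_Mapping"
    "HOL-Library.Function_Algebras"
    "HOL-Computational_Algebra.Polynomial"
begin

text \<open>
  The parameter \<open>q\<close> cannot enter a type, so \<open>U\<^sub>q(su(2))\<close> is given by its presentation: its elements are
  represented by elements of the free complex algebra on four letters, and equality in
  \<open>U\<^sub>q(su(2))\<close> is congruence modulo the two-sided ideal of the relations.  A linear functional
  on \<open>U\<^sub>q(su(2))\<close> is represented by a functional on the free algebra.  All functionals that occur
  are combinations of matrix coefficients and so vanish on the ideal.
\<close>

section \<open>The free algebra and its tensor square\<close>

datatype gen = GK | GKi | GE | GF

instantiation list :: (type) monoid_add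
begin
definition zero_list :: "'a list" where "zero_list = []"
definition plus_list :: "'a list \<Rightarrow> 'a list \<Rightarrow> 'a list" where "plus_list = append"
instance by standard (simp_all add: zero_list_def plus_list_def)
end

text \<open>
  With concatenation as addition of words, multiplication of finitely supported functions
  (convolution) is the product of the free algebra; on pairs of words it is the product
  \<open>(g \<otimes> h) (g' \<otimes> h') = g g' \<otimes> h h'\<close> of the tensor square.
\<close>

type_synonym falg = "gen list \<Rightarrow>\<^sub>0 complex"
type_synonym falg2 = "(gen list \<times> gen list) \<Rightarrow>\<^sub>0 complex"
type_synonym func = "falg \<Rightarrow> complex"

definition scal :: "complex \<Rightarrow> falg" where
  "scal c = Poly_Mapping.single [] c"

definition scal2 :: "complex \<Rightarrow> falg2" where
  "scal2 c = Poly_Mapping.single ([], []) c"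

definition gk :: falg where "gk = Poly_Mapping.single [GK] 1"
definition gki :: falg where "gki = Poly_Mapping.single [GKi] 1"
definition ge :: falg where "ge = Poly_Mapping.single [GE] 1"
definition gf :: falg where "gf = Poly_Mapping.single [GF] 1"

definition tens :: "falg \<Rightarrow> falg \<Rightarrow> falg2" where
  "tens g h = (\<Sum>v\<in>Poly_Mapping.keys g. \<Sum>w\<in>Poly_Mapping.keys h.
     Poly_Mapping.single (v, w) (Poly_Mapping.lookup g v * Poly_Mapping.lookup h w))"

text \<open>
  Extensions of a map on letters to a homomorphism, resp. an antihomomorphism; \<open>\<iota>\<close> gives the
  action on scalars (with \<open>\<iota> = scal \<circ> cnj\<close> the extension is antilinear).
\<close>

definition hom_ext :: "(complex \<Rightarrow> 'b::ring_1) \<Rightarrow> (gen \<Rightarrow> 'b) \<Rightarrow> falg \<Rightarrow> 'b" where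
  "hom_ext \<iota> g h = (\<Sum>w\<in>Poly_Mapping.keys h. \<iota> (Poly_Mapping.lookup h w) * prod_list (map g w))"

definition anti_ext :: "(complex \<Rightarrow> 'b::ring_1) \<Rightarrow> (gen \<Rightarrow> 'b) \<Rightarrow> falg \<Rightarrow> 'b" where
  "anti_ext \<iota> g h = (\<Sum>w\<in>Poly_Mapping.keys h. \<iota> (Poly_Mapping.lookup h w) * prod_list (map g (rev w)))"

inductive_set two_sided_ideal :: "'b::ring_1 set \<Rightarrow> 'b set" for X where
  zero: "0 \<in> two_sided_ideal X"
| mult: "x \<in> X \<Longrightarrow> g * x * h \<in> two_sided_ideal X"
| add: "x \<in> two_sided_ideal X \<Longrightarrow> y \<in> two_sided_ideal X \<Longrightarrow> x + y \<in> two_sided_ideal X"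


section \<open>The Hopf *-algebra \<open>U\<^sub>q(su(2))\<close>\<close>

definition qnum :: "real \<Rightarrow> real \<Rightarrow> real" where
  "qnum q x = (q powr x - q powr (- x)) / (q - inverse q)"

definition uq_ideal :: "real \<Rightarrow> falg set" where
  "uq_ideal q = two_sided_ideal
     {gk * gki - 1, gki * gk - 1,
      gk * ge - scal (of_real (q^2)) * ge * gk,
      gk * gf - scal (of_real (inverse (q^2))) * gf * gk,
      ge * gf - gf * ge - scal (of_real (inverse (q - inverse q))) * (gk - gki)}"

definition uq_eq :: "real \<Rightarrow> falg \<Rightarrow> falg \<Rightarrow> bool" where
  "uq_eq q g h \<longleftrightarrow> g - h \<in> uq_ideal q"

text \<open>Equality in \<open>U \<otimes> U\<close>, i.e. modulo \<open>J \<otimes> F + F \<otimes> J\<close>, \<open>F\<close> the free algebra, \<open>J\<close> the ideal above.\<close>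

definition uq_eq2 :: "real \<Rightarrow> falg2 \<Rightarrow> falg2 \<Rightarrow> bool" where
  "uq_eq2 q x y \<longleftrightarrow>
     x - y \<in> two_sided_ideal ((\<lambda>h. tens h 1) ` uq_ideal q \<union> (\<lambda>h. tens 1 h) ` uq_ideal q)"

primrec comult_gen :: "gen \<Rightarrow> falg2" where
  "comult_gen GK = tens gk gk"
| "comult_gen GKi = tens gki gki"
| "comult_gen GE = tens ge 1 + tens gk ge"
| "comult_gen GF = tens 1 gf + tens gf gki"

definition comult :: "falg \<Rightarrow> falg2" where
  "comult = hom_ext scal2 comult_gen"

primrec counit_gen :: "gen \<Rightarrow> complex" where
  "counit_gen GK = 1"
| "counit_gen GKi = 1"
| "counit_gen GE = 0"
| "counit_gen GF = 0"

definition counit :: "falg \<Rightarrow> complex" where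
  "counit = hom_ext (\<lambda>c. c) counit_gen"

primrec antipode_gen :: "gen \<Rightarrow> falg" where
  "antipode_gen GK = gki"
| "antipode_gen GKi = gk"
| "antipode_gen GE = - (gki * ge)"
| "antipode_gen GF = - (gf * gk)"

definition antipode :: "falg \<Rightarrow> falg" where
  "antipode = anti_ext scal antipode_gen"

primrec star_gen :: "gen \<Rightarrow> falg" where
  "star_gen GK = gk"
| "star_gen GKi = gki"
| "star_gen GE = gf * gk"
| "star_gen GF = gki * ge"

definition ustar :: "falg \<Rightarrow> falg" where
  "ustar = anti_ext (\<lambda>c. scal (cnj c)) star_gen"

primrec unitary_antipode_gen :: "real \<Rightarrow> gen \<Rightarrow> falg" where
  "unitary_antipode_gen q GK = gki"
| "unitary_antipode_gen q GKi = gk"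
| "unitary_antipode_gen q GE = - (scal (of_real q) * gki * ge)"
| "unitary_antipode_gen q GF = - (scal (of_real (inverse q)) * gf * gk)"

definition unitary_antipode :: "real \<Rightarrow> falg \<Rightarrow> falg" where
  "unitary_antipode q = anti_ext scal (unitary_antipode_gen q)"


section \<open>The representations \<open>\<pi>\<^sub>s\<close>\<close>

definition half_nats :: "real set" where
  "half_nats = range (\<lambda>N::nat. real N / 2)"

definition spins :: "real \<Rightarrow> real set" where
  "spins s = {j. j \<le> s \<and> (\<exists>i::nat. j = real i - s)}"

text \<open>Vectors of \<open>H\<^sub>s\<close> are coordinate families with respect to the basis \<open>\<xi>\<^sup>s\<^sub>j\<close>, \<open>j = -s, \<dots>, s\<close>.\<close>

type_synonym hvec = "real \<Rightarrow> complex"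

definition hspace :: "real \<Rightarrow> hvec set" where
  "hspace s = {v. \<forall>j. j \<notin> spins s \<longrightarrow> v j = 0}"

definition hinner :: "real \<Rightarrow> hvec \<Rightarrow> hvec \<Rightarrow> complex" where
  "hinner s v w = (\<Sum>j\<in>spins s. cnj (v j) * w j)"

definition hbasis :: "real \<Rightarrow> hvec" where
  "hbasis j = (\<lambda>i. if i = j then 1 else 0)"

primrec rep_gen :: "real \<Rightarrow> real \<Rightarrow> gen \<Rightarrow> hvec \<Rightarrow> hvec" where
  "rep_gen q s GK v = (\<lambda>i. \<Sum>j\<in>spins s. v j * of_real (q powr (2 * j)) * hbasis j i)"
| "rep_gen q s GKi v = (\<lambda>i. \<Sum>j\<in>spins s. v j * of_real (q powr (- 2 * j)) * hbasis j i)"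
| "rep_gen q s GE v = (\<lambda>i. \<Sum>j\<in>spins s.
     v j * of_real (q powr (j + 1) * sqrt (qnum q (s - j) * qnum q (s + j + 1))) * hbasis (j + 1) i)"
| "rep_gen q s GF v = (\<lambda>i. \<Sum>j\<in>spins s.
     v j * of_real (q powr (- j) * sqrt (qnum q (s + j) * qnum q (s - j + 1))) * hbasis (j - 1) i)"

definition rep :: "real \<Rightarrow> real \<Rightarrow> falg \<Rightarrow> hvec \<Rightarrow> hvec" where
  "rep q s h v = (\<lambda>i. \<Sum>w\<in>Poly_Mapping.keys h. Poly_Mapping.lookup h w * foldr (rep_gen q s) w v i)"


section \<open>The dual Hopf *-algebra \<open>O\<^sub>q(SU(2))\<close>\<close>

definition mcoef :: "real \<Rightarrow> real \<Rightarrow> hvec \<Rightarrow> hvec \<Rightarrow> func" where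
  "mcoef q s \<xi> \<eta> = (\<lambda>h. hinner s \<xi> (rep q s h \<eta>))"

definition ascale :: "complex \<Rightarrow> func \<Rightarrow> func" where
  "ascale c x = (\<lambda>h. c * x h)"

definition Oq :: "real \<Rightarrow> func set" where
  "Oq q = module.span ascale
     {mcoef q s \<xi> \<eta> | s \<xi> \<eta>. s \<in> half_nats \<and> \<xi> \<in> hspace s \<and> \<eta> \<in> hspace s}"

text \<open>\<open>(x y, h) = (x, h\<^sub>(\<^sub>1\<^sub>)) (y, h\<^sub>(\<^sub>2\<^sub>))\<close>\<close>

definition amult :: "func \<Rightarrow> func \<Rightarrow> func" where
  "amult x y = (\<lambda>h. \<Sum>(v, w)\<in>Poly_Mapping.keys (comult h).
     Poly_Mapping.lookup (comult h) (v, w) * x (Poly_Mapping.single v 1) * y (Poly_Mapping.single w 1))"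

text \<open>The unit of \<open>O\<^sub>q(SU(2))\<close> is the functional \<open>counit\<close>; its counit is evaluation at \<open>1\<close>.\<close>

definition acounit :: "func \<Rightarrow> complex" where
  "acounit x = x 1"

definition astar :: "func \<Rightarrow> func" where
  "astar x = (\<lambda>h. cnj (x (ustar (antipode h))))"

text \<open>
  The coproduct is determined by \<open>x (g h) = (x\<^sub>(\<^sub>1\<^sub>), g) (x\<^sub>(\<^sub>2\<^sub>), h)\<close>, so \<open>h \<rhd> x = x\<^sub>(\<^sub>1\<^sub>) (x\<^sub>(\<^sub>2\<^sub>), h)\<close> is
  \<open>g \<mapsto> x (g h)\<close> and \<open>x \<lhd> h = (x\<^sub>(\<^sub>1\<^sub>), h) x\<^sub>(\<^sub>2\<^sub>)\<close> is \<open>g \<mapsto> x (h g)\<close>.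
\<close>

definition lact :: "falg \<Rightarrow> func \<Rightarrow> func" where
  "lact h x = (\<lambda>g. x (g * h))"

definition ract :: "func \<Rightarrow> falg \<Rightarrow> func" where
  "ract x h = (\<lambda>g. x (h * g))"

primrec apow :: "func \<Rightarrow> nat \<Rightarrow> func" where
  "apow x 0 = counit"
| "apow x (Suc n) = amult x (apow x n)"

definition apoly :: "complex poly \<Rightarrow> func \<Rightarrow> func" where
  "apoly P x = (\<Sum>i\<le>degree P. ascale (coeff P i) (apow x i))"


section \<open>The Podles sphere and the coideal subalgebra\<close>

definition tpar :: "real \<Rightarrow> real \<Rightarrow> real" where
  "tpar q a = q powr a - q powr (- a)"

definition Bt :: "real \<Rightarrow> real \<Rightarrow> falg" where
  "Bt q a = scal (of_real (q powr (- 1 / 2))) * (ge - gf * gk)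
     - scal (\<i> * of_real (inverse (q - inverse q) * tpar q a)) * gk"

definition RBt :: "real \<Rightarrow> real \<Rightarrow> falg" where
  "RBt q a = unitary_antipode q (Bt q a)"

definition podles :: "real \<Rightarrow> real \<Rightarrow> func set" where
  "podles q a = {x \<in> Oq q. lact (RBt q a) x = ascale (counit (Bt q a)) x}"

text \<open>All representatives of the elements of \<open>\<complex>[R(B\<^sub>t)]\<close>.\<close>

definition coideal :: "real \<Rightarrow> real \<Rightarrow> falg set" where
  "coideal q a = {h. \<exists>p :: complex poly. uq_eq q h (\<Sum>i\<le>degree p. scal (coeff p i) * RBt q a ^ i)}"

text \<open>\<open>\<eta> n j\<close> is \<open>\<eta>\<^sup>n\<close> with index \<open>[a + 2j]\<close>; values for \<open>\<bar>j\<bar> > n\<close> are irrelevant.\<close>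

definition eigenvector_family :: "real \<Rightarrow> real \<Rightarrow> (nat \<Rightarrow> int \<Rightarrow> hvec) \<Rightarrow> bool" where
  "eigenvector_family q a \<eta> \<longleftrightarrow>
     (\<forall>n j. \<bar>j\<bar> \<le> int n \<longrightarrow>
        \<eta> n j \<in> hspace (real n) \<and> hinner (real n) (\<eta> n j) (\<eta> n j) = 1 \<and>
        rep q (real n) (scal \<i> * RBt q a) (\<eta> n j)
          = (\<lambda>i. of_real (qnum q (a + 2 * of_int j)) * \<eta> n j i))"

text \<open>\<open>sph q \<eta> n j\<close> is \<open>u\<^sup>n\<close> with indices \<open>[a + 2j], [a]\<close>.\<close>

definition sph :: "real \<Rightarrow> (nat \<Rightarrow> int \<Rightarrow> hvec) \<Rightarrow> nat \<Rightarrow> int \<Rightarrow> func" where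
  "sph q \<eta> n j = mcoef q (real n) (\<eta> n j) (\<eta> n 0)"

definition generating_functional :: "real \<Rightarrow> real \<Rightarrow> (func \<Rightarrow> complex) \<Rightarrow> bool" where
  "generating_functional q a L \<longleftrightarrow>
     (\<forall>x\<in>podles q a. \<forall>y\<in>podles q a. L (x + y) = L x + L y) \<and>
     (\<forall>c. \<forall>x\<in>podles q a. L (ascale c x) = c * L x) \<and>
     (\<forall>x\<in>podles q a. acounit x = 0 \<longrightarrow>
        L (amult (astar x) x) \<in> \<real> \<and> 0 \<le> Re (L (amult (astar x) x))) \<and>
     (\<forall>x\<in>podles q a. L (astar x) = cnj (L x)) \<and>
     L counit = 0"


section \<open>Admissible *-representations\<close>

locale pre_hilbert = vector_space smul
  for smul :: "complex \<Rightarrow> 'v::ab_group_add \<Rightarrow> 'v" +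
  fixes ip :: "'v \<Rightarrow> 'v \<Rightarrow> complex"
  assumes ip_add: "ip u (v + w) = ip u v + ip u w"
    and ip_smul: "ip u (smul c v) = c * ip u v"
    and ip_cnj: "ip v u = cnj (ip u v)"
    and ip_pos: "v \<noteq> 0 \<Longrightarrow> ip v v \<in> \<real> \<and> 0 < Re (ip v v)"

record 'v qrep =
  smul :: "complex \<Rightarrow> 'v \<Rightarrow> 'v"
  ip :: "'v \<Rightarrow> 'v \<Rightarrow> complex"
  actB :: "func \<Rightarrow> 'v \<Rightarrow> 'v"
  actI :: "falg \<Rightarrow> 'v \<Rightarrow> 'v"

definition star_rep_B :: "real \<Rightarrow> real \<Rightarrow> 'v::ab_group_add qrep \<Rightarrow> bool" where
  "star_rep_B q a V \<longleftrightarrow>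
     (\<forall>b\<in>podles q a. Vector_Spaces.linear (smul V) (smul V) (actB V b)) \<and>
     (\<forall>b\<in>podles q a. \<forall>b'\<in>podles q a. \<forall>v. actB V (b + b') v = actB V b v + actB V b' v) \<and>
     (\<forall>c. \<forall>b\<in>podles q a. \<forall>v. actB V (ascale c b) v = smul V c (actB V b v)) \<and>
     (\<forall>b\<in>podles q a. \<forall>b'\<in>podles q a. \<forall>v. actB V (amult b b') v = actB V b (actB V b' v)) \<and>
     (\<forall>v. actB V counit v = v) \<and>
     (\<forall>b\<in>podles q a. \<forall>v w. ip V (actB V b v) w = ip V v (actB V (astar b) w))"

definition star_rep_I :: "real \<Rightarrow> real \<Rightarrow> 'v::ab_group_add qrep \<Rightarrow> bool" where
  "star_rep_I q a V \<longleftrightarrow>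
     (\<forall>h\<in>coideal q a. \<forall>h'\<in>coideal q a. uq_eq q h h' \<longrightarrow> actI V h = actI V h') \<and>
     (\<forall>h\<in>coideal q a. Vector_Spaces.linear (smul V) (smul V) (actI V h)) \<and>
     (\<forall>h\<in>coideal q a. \<forall>h'\<in>coideal q a. \<forall>v. actI V (h + h') v = actI V h v + actI V h' v) \<and>
     (\<forall>c. \<forall>h\<in>coideal q a. \<forall>v. actI V (scal c * h) v = smul V c (actI V h v)) \<and>
     (\<forall>h\<in>coideal q a. \<forall>h'\<in>coideal q a. \<forall>v. actI V (h * h') v = actI V h (actI V h' v)) \<and>
     (\<forall>v. actI V 1 v = v) \<and>
     (\<forall>h\<in>coideal q a. \<forall>v w. ip V (actI V h v) w = ip V v (actI V (ustar h) w))"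

text \<open>
  \<open>b h = h\<^sub>(\<^sub>1\<^sub>) (b \<lhd> h\<^sub>(\<^sub>2\<^sub>))\<close>, for every way of writing the coproduct of \<open>h\<close> as a sum of elementary
  tensors with first legs in the right coideal.
\<close>

definition exchange_relation :: "real \<Rightarrow> real \<Rightarrow> 'v::ab_group_add qrep \<Rightarrow> bool" where
  "exchange_relation q a V \<longleftrightarrow>
     (\<forall>b\<in>podles q a. \<forall>h\<in>coideal q a. \<forall>hs :: (falg \<times> falg) list.
        (\<forall>(h1, h2)\<in>set hs. h1 \<in> coideal q a) \<and>
        uq_eq2 q (comult h) (\<Sum>(h1, h2)\<leftarrow>hs. tens h1 h2) \<longrightarrow>
        (\<forall>v. actB V b (actI V h v) = (\<Sum>(h1, h2)\<leftarrow>hs. actI V h1 (actB V (ract b h2) v))))"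

definition weight_space :: "real \<Rightarrow> real \<Rightarrow> 'v::ab_group_add qrep \<Rightarrow> real \<Rightarrow> 'v set" where
  "weight_space q a V \<mu> = {v. actI V (scal \<i> * RBt q a) v = smul V (of_real \<mu>) v}"

definition admissible :: "real \<Rightarrow> real \<Rightarrow> 'v::ab_group_add qrep \<Rightarrow> bool" where
  "admissible q a V \<longleftrightarrow>
     pre_hilbert (smul V) (ip V) \<and> star_rep_B q a V \<and> star_rep_I q a V \<and> exchange_relation q a V \<and>
     module.span (smul V) (\<Union>n::int. weight_space q a V (qnum q (a + of_int n))) = UNIV \<and>
     (\<forall>n::int. \<exists>S. finite S \<and> weight_space q a V (qnum q (a + of_int n)) \<subseteq> module.span (smul V) S)"

definition irreducible_rep :: "real \<Rightarrow> real \<Rightarrow> 'v::ab_group_add qrep \<Rightarrow> bool" where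
  "irreducible_rep q a V \<longleftrightarrow>
     (\<exists>v::'v. v \<noteq> 0) \<and>
     (\<forall>W. module.subspace (smul V) W \<and>
          (\<forall>b\<in>podles q a. actB V b ` W \<subseteq> W) \<and> (\<forall>h\<in>coideal q a. actI V h ` W \<subseteq> W) \<longrightarrow>
          W = {0} \<or> W = UNIV)"

text \<open>
  \<open>V\<close> is a realization of the representation \<open>L\<^sub>\<lambda>\<^sup>+\<close> for \<open>\<lambda> = lam\<close>, and \<open>e\<close> a unit vector of weight \<open>[a]\<close> in it.
\<close>

definition is_Lplus ::
  "real \<Rightarrow> real \<Rightarrow> (nat \<Rightarrow> int \<Rightarrow> hvec) \<Rightarrow> real \<Rightarrow> 'v::ab_group_add qrep \<Rightarrow> 'v \<Rightarrow> bool" where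
  "is_Lplus q a \<eta> lam V e \<longleftrightarrow>
     admissible q a V \<and> irreducible_rep q a V \<and>
     (\<forall>n::int. vector_space.dim (smul V) (weight_space q a V (qnum q (a + 2 * of_int n))) = 1) \<and>
     (\<forall>\<mu>. (\<forall>n::int. \<mu> \<noteq> qnum q (a + 2 * of_int n)) \<longrightarrow> weight_space q a V \<mu> = {0}) \<and>
     e \<in> weight_space q a V (qnum q a) \<and> ip V e e = 1 \<and>
     actB V (sph q \<eta> 1 0) e =
       smul V (of_real ((lam + inverse (q + inverse q) * (tpar q a)^2)
                        / (q + inverse q + inverse (q + inverse q) * (tpar q a)^2))) e"

definition omega :: "'v qrep \<Rightarrow> 'v \<Rightarrow> func \<Rightarrow> complex" where
  "omega V e b = ip V e (actB V b e)"


section \<open>Askey--Wilson polynomials\<close>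

definition qpoch :: "'b::field \<Rightarrow> 'b \<Rightarrow> nat \<Rightarrow> 'b" where
  "qpoch x p n = (\<Prod>i<n. 1 - x * p ^ i)"

text \<open>
  \<open>p\<^sub>n(X; A, B, C, D | p)\<close> in the standard normalization as a terminating \<open>\<^sub>4\<phi>\<^sub>3\<close> series; with
  \<open>X = cos \<theta>\<close> the last product is \<open>(A e\<^bsup>i\<theta>\<^esup>, A e\<^bsup>-i\<theta>\<^esup>; p)\<^sub>k\<close>.
\<close>

definition askey_wilson ::
  "nat \<Rightarrow> 'b::field \<Rightarrow> 'b \<Rightarrow> 'b \<Rightarrow> 'b \<Rightarrow> 'b \<Rightarrow> 'b \<Rightarrow> 'b" where
  "askey_wilson n X A B C D p =
     qpoch (A * B) p n * qpoch (A * C) p n * qpoch (A * D) p n / A ^ n *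
     (\<Sum>k\<le>n. qpoch (inverse (p ^ n)) p k * qpoch (A * B * C * D * p ^ n / p) p k
         / (qpoch (A * B) p k * qpoch (A * C) p k * qpoch (A * D) p k * qpoch p p k) * p ^ k
         * (\<Prod>i<k. 1 - 2 * A * X * p ^ i + A^2 * p ^ (2 * i)))"

definition normalized_askey_wilson :: "real \<Rightarrow> real \<Rightarrow> nat \<Rightarrow> complex poly \<Rightarrow> bool" where
  "normalized_askey_wilson q a n P \<longleftrightarrow>
     (\<exists>C. C \<noteq> 0 \<and> (\<forall>X::complex.
        poly P ((2 * X + of_real (inverse (q + inverse q) * (tpar q a)^2))
                / of_real (q + inverse q + inverse (q + inverse q) * (tpar q a)^2))
        = C * askey_wilson n X (of_real (- (q powr (- 2 * a + 1)))) (of_real (- (q powr (2 * a + 1))))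
                (of_real q) (of_real q) (of_real (q^2))))"

end

theory Submission
  imports Defs
begin

text \<open>
  Write \<open>X = i R(B\<^sub>t)\<close>; then \<open>\<Delta>(X) = 1 \<otimes> X + (X - [a]) \<otimes> k\<^sup>-\<^sup>1\<close>.  Applied to a unit vector of weight \<open>[a]\<close>, the
  exchange relation for \<open>X\<close> shows that \<open>\<omega>\<^sub>\<lambda>\<close> vanishes on the weight vectors \<open>u\<^sup>n\<close> with indices \<open>[a + 2j], [a]\<close>,
  \<open>j \<noteq> 0\<close>, while on a polynomial in \<open>u = u\<^sup>1\<close> (indices \<open>[a], [a]\<close>) it is evaluation at a point which is affine in
  \<open>\<lambda>\<close> and equals \<open>1\<close> at \<open>\<lambda> = q + q\<^sup>-\<^sup>1\<close>.  Hence the limit is a multiple of \<open>P\<^sub>n'(1)\<close>, and positivity of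
  \<open>\<omega>\<^sub>\<lambda>\<close> passes to the limit on the kernel of the counit.

  That the \<open>u\<^sup>n\<close> with indices \<open>[a], [a]\<close> are Askey--Wilson polynomials in \<open>u\<close> follows from a radial part computation.  A
  functional on \<open>U\<close> which is invariant under \<open>X\<close> on both sides is determined by its values on the powers \<open>k\<^sup>m\<close>,
  \<open>m \<ge> 0\<close>, which multiply pointwise.  For an eigenfunctional of the Casimir element these values satisfy the
  Askey--Wilson difference equation at \<open>y = q\<^sup>2\<^sup>m\<^sup>+\<^sup>1\<close>, whose backward coefficient vanishes at \<open>m = 0\<close>, so that
  the value at \<open>m = 0\<close> determines the solution.  The terminating \<open>\<^sub>4\<phi>\<^sub>3\<close> series solves the same equation.

  The \<open>u\<^sup>n\<close> span the sphere because \<open>X\<close> acts diagonalizably on every \<open>H\<^sub>s\<close>, with eigenvalues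
  \<open>[a + 2j]\<close>, \<open>j = -s, \<dots>, s\<close>; for half-integral \<open>s\<close> the weight \<open>[a]\<close> does not occur.
\<close>

section \<open>The free algebra\<close>

text \<open>Two obstacles shape the proof. The first is the use of representatives:
  comultiplication, involution and antipode are defined on the free algebra, where even the short
  form of X is reached only modulo the relations. Functionals are therefore required to vanish on
  the ideal (\<open>uq_functional\<close>), and the product dual to the comultiplication has to be
  shown to preserve this. The second is products of elements of the sphere. Powers of u are placed
  in the sphere by inverting the triangular expansion of the spherical elements in powers of u,
  which uses that the polynomials have exact degree n. For x^* x the limit functional is set to 0
  wherever no limit exists, and positivity is inherited by every limit that does exist. The
  identification with Askey--Wilson polynomials rests on uniqueness: two solutions of the difference
  equation with the same value at m = 0 agree on all powers of k, and biinvariant functionals that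
  agree there are equal. Since u takes infinitely many values on the powers of k, the polynomial is
  unique too.\<close>

lemma falg_induct [case_names add single]:
  fixes h :: "'k \<Rightarrow>\<^sub>0 'c::comm_monoid_add"
  assumes "\<And>g h. P g \<Longrightarrow> P h \<Longrightarrow> P (g + h)" and "\<And>w c. P (Poly_Mapping.single w c)"
  shows "P h"
proof (induction h rule: Poly_Mapping.update_induct)
  case const
  show ?case using assms(2)[of _ 0] by simp
next
  case (update f a b)
  have "Poly_Mapping.update a b f = f + Poly_Mapping.single a b"
    using update(1)
    by (intro poly_mapping_eqI)
       (auto simp: lookup_update lookup_add lookup_single when_def not_in_keys_iff_lookup_eq_zero)
  then show ?case using assms update by simp
qed

text \<open>Cancellation can make the support of \<open>g + h\<close> smaller than the union of the
  two supports; \<open>F k 0 = 0\<close> lets all three sums run over that union.\<close>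

lemma linear_ext_add:
  fixes F :: "'k \<Rightarrow> 'c::comm_monoid_add \<Rightarrow> 'b::comm_monoid_add"
  assumes "\<And>k. F k 0 = 0" and "\<And>k a b. F k (a + b) = F k a + F k b"
  shows "(\<Sum>k\<in>Poly_Mapping.keys (g + h). F k (Poly_Mapping.lookup (g + h) k))
    = (\<Sum>k\<in>Poly_Mapping.keys g. F k (Poly_Mapping.lookup g k))
      + (\<Sum>k\<in>Poly_Mapping.keys h. F k (Poly_Mapping.lookup h k))"
  using setsum_keys_plus_distrib[of F g h] assms by blast

abbreviation word :: "gen list \<Rightarrow> falg" where
  "word w \<equiv> Poly_Mapping.single w 1"

lemma scal_times_single: "scal c * Poly_Mapping.single w d = Poly_Mapping.single w (c * d)"
  by (simp add: scal_def mult_single plus_list_def)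

lemma single_eq_scal_word: "Poly_Mapping.single w c = scal c * word w"
  by (simp add: scal_times_single)

lemma scal_1 [simp]: "scal 1 = 1"
  by (simp add: scal_def flip: zero_list_def)

lemma scal_0 [simp]: "scal 0 = 0"
  by (simp add: scal_def)

lemma scal_add: "scal (c + d) = scal c + scal d"
  by (simp add: scal_def single_add)

lemma scal_uminus: "scal (- c) = - scal c"
  by (simp add: scal_def single_uminus)

lemma scal_mult: "scal (c * d) = scal c * scal d"
  by (simp add: scal_def mult_single plus_list_def)

lemma scal_commute: "h * scal c = scal c * h"
  by (induction h rule: falg_induct)
     (simp_all add: algebra_simps scal_def mult_single plus_list_def)

lemma word_Nil [simp]: "word [] = 1"
  by (simp flip: zero_list_def)

lemma word_append: "word (v @ w) = word v * word w"
  by (simp add: mult_single plus_list_def)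

lemma word_Cons: "word (l # w) = word [l] * word w"
  using word_append[of "[l]" w] by simp

lemma scal2_add: "scal2 (c + d) = scal2 c + scal2 d"
  by (simp add: scal2_def single_add)

lemma scal2_mult: "scal2 (c * d) = scal2 c * scal2 d"
  by (simp add: scal2_def mult_single plus_list_def zero_list_def)

lemma scal2_0 [simp]: "scal2 0 = 0"
  by (simp add: scal2_def)

lemma scal2_1 [simp]: "scal2 1 = 1"
  by (simp add: scal2_def zero_prod_def zero_list_def flip: single_one)

lemma scal2_commute: "h * scal2 c = scal2 c * h"
  by (induction h rule: falg_induct)
     (auto simp add: algebra_simps scal2_def mult_single plus_list_def)

lemma hom_ext_add:
  assumes "\<iota> 0 = 0" and "\<And>c d. \<iota> (c + d) = \<iota> c + \<iota> d"
  shows "hom_ext \<iota> G (g + h) = hom_ext \<iota> G g + hom_ext \<iota> G h"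
  unfolding hom_ext_def by (rule linear_ext_add) (simp_all add: assms algebra_simps)

lemma hom_ext_single:
  assumes "\<iota> 0 = 0"
  shows "hom_ext \<iota> G (Poly_Mapping.single w c) = \<iota> c * prod_list (map G w)"
  unfolding hom_ext_def by (simp add: assms)

lemma hom_ext_mult:
  assumes "\<iota> 0 = 0" and "\<And>c d. \<iota> (c + d) = \<iota> c + \<iota> d"
    and "\<And>c d. \<iota> (c * d) = \<iota> c * \<iota> d" and "\<And>c x. x * \<iota> c = \<iota> c * x"
  shows "hom_ext \<iota> G (g * h) = hom_ext \<iota> G g * hom_ext \<iota> G h"
proof (induction g rule: falg_induct)
  case (add g g')
  then show ?case by (simp add: hom_ext_add[OF assms(1,2)] distrib_right)
next
  case (single v c)
  show ?case
  proof (induction h rule: falg_induct)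
    case (add g g')
    then show ?case by (simp add: hom_ext_add[OF assms(1,2)] distrib_left)
  next
    case (single w d)
    have "\<iota> c * \<iota> d * (prod_list (map G v) * prod_list (map G w))
        = \<iota> c * prod_list (map G v) * (\<iota> d * prod_list (map G w))"
      using assms(4)[of "prod_list (map G v)" d] by (metis mult.assoc)
    then show ?case
      by (simp add: mult_single hom_ext_single assms(1,3) plus_list_def)
  qed
qed

lemma anti_ext_add:
  assumes "\<iota> 0 = 0" and "\<And>c d. \<iota> (c + d) = \<iota> c + \<iota> d"
  shows "anti_ext \<iota> G (g + h) = anti_ext \<iota> G g + anti_ext \<iota> G h"
  unfolding anti_ext_def by (rule linear_ext_add) (simp_all add: assms algebra_simps)

lemma anti_ext_single:
  assumes "\<iota> 0 = 0"
  shows "anti_ext \<iota> G (Poly_Mapping.single w c) = \<iota> c * prod_list (map G (rev w))"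
  unfolding anti_ext_def by (simp add: assms)

section \<open>The tensor square\<close>

lemma tens_add_left: "tens (g + g') h = tens g h + tens g' h"
  unfolding tens_def
  by (rule linear_ext_add[where F = "\<lambda>v c. \<Sum>w\<in>Poly_Mapping.keys h. Poly_Mapping.single (v, w) (c * Poly_Mapping.lookup h w)"])
     (simp_all add: distrib_right single_add sum.distrib)

lemma tens_single_left:
  "tens (Poly_Mapping.single v c) h = (\<Sum>w\<in>Poly_Mapping.keys h. Poly_Mapping.single (v, w) (c * Poly_Mapping.lookup h w))"
  by (cases "c = 0") (simp_all add: tens_def)

lemma tens_add_right: "tens g (h + h') = tens g h + tens g h'"
proof (induction g rule: falg_induct)
  case (add g g')
  then show ?case by (simp add: tens_add_left)
next
  case (single v c)
  show ?case unfolding tens_single_left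
    by (rule linear_ext_add[where F = "\<lambda>w d. Poly_Mapping.single (v, w) (c * d)"])
       (simp_all add: distrib_left single_add)
qed

lemma tens_single: "tens (Poly_Mapping.single v c) (Poly_Mapping.single w d) = Poly_Mapping.single (v, w) (c * d)"
  by (cases "d = 0") (simp_all add: tens_single_left)

lemma tens_0 [simp]: "tens 0 h = 0" "tens h 0 = 0"
  by (simp_all add: tens_def)

lemma tens_uminus: "tens (- g) h = - tens g h" "tens g (- h) = - tens g h"
proof -
  have "tens (- g) h + tens g h = 0" using tens_add_left[of "- g" g h] by simp
  then show "tens (- g) h = - tens g h" by (simp add: eq_neg_iff_add_eq_0)
  have "tens g (- h) + tens g h = 0" using tens_add_right[of g "- h" h] by simp
  then show "tens g (- h) = - tens g h" by (simp add: eq_neg_iff_add_eq_0)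
qed

lemma tens_diff: "tens (g - g') h = tens g h - tens g' h" "tens g (h - h') = tens g h - tens g h'"
  using tens_add_left[of g "- g'" h] tens_add_right[of g h "- h'"] by (simp_all add: tens_uminus)

lemma tens_mult: "tens g h * tens g' h' = tens (g * g') (h * h')"
proof (induction g rule: falg_induct)
  case (add g1 g2)
  then show ?case by (simp add: tens_add_left distrib_right)
next
  case (single v c)
  show ?case
  proof (induction h rule: falg_induct)
    case (add g1 g2)
    then show ?case by (simp add: tens_add_right distrib_right)
  next
    case (single w d)
    show ?case
    proof (induction g' rule: falg_induct)
      case (add g1 g2)
      then show ?case by (simp add: tens_add_left distrib_left)
    next
      case (single v' c')
      show ?case
      proof (induction h' rule: falg_induct)
        case (add g1 g2)
        then show ?case by (simp add: tens_add_right distrib_left)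
      next
        case (single w' d')
        show ?case by (simp add: tens_single mult_single ac_simps)
      qed
    qed
  qed
qed

lemma tens_1_1 [simp]: "tens 1 1 = 1"
  using tens_single[of "[]" 1 "[]" 1] scal2_1 by (simp add: scal2_def)

lemma scal2_eq_tens: "scal2 c = tens (scal c) 1" "scal2 c = tens 1 (scal c)"
  using tens_single[of "[]" c "[]" 1] tens_single[of "[]" 1 "[]" c] by (simp_all add: scal_def scal2_def)

lemma tens_induct [case_names add tens]:
  fixes h :: falg2
  assumes "\<And>g h. P g \<Longrightarrow> P h \<Longrightarrow> P (g + h)" and "\<And>g h. P (tens g h)"
  shows "P h"
proof (induction h rule: falg_induct)
  case (single w c)
  show ?case using assms(2)[of "Poly_Mapping.single (fst w) c" "word (snd w)"] by (simp add: tens_single)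
qed (use assms in auto)

section \<open>The comultiplication and the pairing of functionals with the tensor square\<close>

lemma comult_add: "comult (g + h) = comult g + comult h"
  unfolding comult_def by (rule hom_ext_add) (simp_all add: scal2_add)

lemma comult_mult: "comult (g * h) = comult g * comult h"
  unfolding comult_def by (rule hom_ext_mult) (simp, rule scal2_add, rule scal2_mult, rule scal2_commute)

lemma comult_single: "comult (Poly_Mapping.single w c) = scal2 c * prod_list (map comult_gen w)"
  unfolding comult_def by (rule hom_ext_single) simp

lemma comult_gens [simp]:
  "comult gk = tens gk gk" "comult gki = tens gki gki"
  "comult ge = tens ge 1 + tens gk ge" "comult gf = tens 1 gf + tens gf gki"
  "comult (scal c) = scal2 c" "comult 1 = 1"
  by (simp_all add: gk_def gki_def ge_def gf_def scal_def comult_single flip: word_Nil)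

lemma comult_uminus: "comult (- g) = - comult g"
proof -
  have "comult (- g) + comult g = comult 0" using comult_add[of "- g" g] by simp
  also have "comult 0 = 0" using comult_add[of 0 0] by simp
  finally show ?thesis by (simp add: eq_neg_iff_add_eq_0)
qed

lemma comult_diff: "comult (g - h) = comult g - comult h"
  using comult_add[of g "- h"] by (simp add: comult_uminus)

text \<open>The functional x \<otimes> y. It tests x and y on words only, to match the sum in
  \<open>amult\<close>; for linear x and y it has the expected value on every elementary tensor
  (\<open>tensor_eval_tens\<close>).\<close>

definition tensor_eval :: "func \<Rightarrow> func \<Rightarrow> falg2 \<Rightarrow> complex" where
  "tensor_eval x y z = (\<Sum>p\<in>Poly_Mapping.keys z. Poly_Mapping.lookup z p * (x (word (fst p)) * y (word (snd p))))"

lemma amult_eq: "amult x y h = tensor_eval x y (comult h)"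
  by (simp add: amult_def tensor_eval_def case_prod_unfold mult.assoc)

lemma tensor_eval_add: "tensor_eval x y (z + z') = tensor_eval x y z + tensor_eval x y z'"
  unfolding tensor_eval_def by (rule linear_ext_add) (simp_all add: algebra_simps)

lemma tensor_eval_uminus: "tensor_eval x y (- z) = - tensor_eval x y z"
proof -
  have "tensor_eval x y (- z) + tensor_eval x y z = tensor_eval x y 0"
    using tensor_eval_add[of x y "- z" z] by simp
  also have "\<dots> = 0" using tensor_eval_add[of x y 0 0] by simp
  finally show ?thesis by (simp add: eq_neg_iff_add_eq_0)
qed

lemma tensor_eval_diff: "tensor_eval x y (z - z') = tensor_eval x y z - tensor_eval x y z'"
  using tensor_eval_add[of x y z "- z'"] by (simp add: tensor_eval_uminus)

definition func_linear :: "func \<Rightarrow> bool" where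
  "func_linear x \<longleftrightarrow> (\<forall>g h. x (g + h) = x g + x h) \<and> (\<forall>c h. x (scal c * h) = c * x h)"

lemma func_linearD:
  assumes "func_linear x"
  shows "x (g + h) = x g + x h" "x (scal c * h) = c * x h" "x 0 = 0" "x (- g) = - x g" "x (g - h) = x g - x h"
    "x (scal c * h * h') = c * x (h * h')" "x (scal c * h * h' * h'') = c * x (h * h' * h'')"
    "x (h * scal c) = c * x h"
    "x (scal c) = c * x 1"
proof -
  show *: "x (g + h) = x g + x h" "x (scal c * h) = c * x h" for g h c
    using assms by (auto simp: func_linear_def)
  show 0: "x 0 = 0" using *(1)[of 0 0] by simp
  show **: "x (- g) = - x g" for g
    using *(1)[of "- g" g] by (simp add: 0 eq_neg_iff_add_eq_0)
  show "x (g - h) = x g - x h" using *(1)[of g "- h"] ** by simp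
  show "x (scal c * h * h') = c * x (h * h')" "x (scal c * h * h' * h'') = c * x (h * h' * h'')"
    using *(2)[of c "h * h'"] *(2)[of c "h * h' * h''"] by (simp_all add: mult.assoc)
  show "x (h * scal c) = c * x h" by (simp add: scal_commute *)
  show "x (scal c) = c * x 1" using *(2)[of c 1] by simp
qed

lemma func_linear_single:
  "func_linear x \<Longrightarrow> x (Poly_Mapping.single w c) = c * x (word w)"
  by (subst single_eq_scal_word) (simp add: func_linearD)

lemma tensor_eval_tens:
  assumes x: "func_linear x" and y: "func_linear y"
  shows "tensor_eval x y (tens g h) = x g * y h"
proof (induction g rule: falg_induct)
  case (add g g')
  then show ?case by (simp add: tens_add_left tensor_eval_add func_linearD(1)[OF x] distrib_right)
next
  case (single v c)
  show ?case
  proof (induction h rule: falg_induct)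
    case (add g g')
    then show ?case by (simp add: tens_add_right tensor_eval_add func_linearD(1)[OF y] distrib_left)
  next
    case (single w d)
    show ?case
      by (cases "c = 0"; cases "d = 0")
         (simp_all add: tens_single tensor_eval_def func_linear_single[OF x, of v c] func_linear_single[OF y, of w d]
           func_linearD(3)[OF x] func_linearD(3)[OF y])
  qed
qed

lemma tensor_eval_scal2:
  assumes x: "func_linear x" and y: "func_linear y"
  shows "tensor_eval x y (scal2 c * z) = c * tensor_eval x y z"
proof (induction z rule: tens_induct)
  case (add g h)
  then show ?case by (simp add: distrib_left tensor_eval_add)
next
  case (tens g h)
  show ?case by (simp add: scal2_eq_tens(1) tens_mult tensor_eval_tens[OF x y] func_linearD[OF x])
qed

lemma amult_linear:
  assumes x: "func_linear x" and y: "func_linear y"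
  shows "func_linear (amult x y)"
  unfolding func_linear_def
  by (simp add: amult_eq comult_add comult_mult tensor_eval_add tensor_eval_scal2[OF x y])

lemma amult_1: "func_linear x \<Longrightarrow> func_linear y \<Longrightarrow> amult x y 1 = x 1 * y 1"
  using tensor_eval_tens[of x y 1 1] by (simp add: amult_eq)

section \<open>Congruence modulo the defining relations\<close>

lemma two_sided_ideal_mult_left:
  "x \<in> two_sided_ideal X \<Longrightarrow> g * x \<in> two_sided_ideal X"
proof (induction rule: two_sided_ideal.induct)
  case (mult x g' h)
  then show ?case using two_sided_ideal.mult[of x X "g * g'" h] by (simp add: mult.assoc)
qed (auto simp: distrib_left intro: two_sided_ideal.intros)

lemma two_sided_ideal_mult_right:
  "x \<in> two_sided_ideal X \<Longrightarrow> x * h \<in> two_sided_ideal X"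
proof (induction rule: two_sided_ideal.induct)
  case (mult x g' h')
  then show ?case using two_sided_ideal.mult[of x X "g'" "h' * h"] by (simp add: mult.assoc)
qed (auto simp: distrib_right intro: two_sided_ideal.intros)

lemma two_sided_ideal_base: "x \<in> X \<Longrightarrow> x \<in> two_sided_ideal X"
  using two_sided_ideal.mult[of x X 1 1] by simp

lemma two_sided_ideal_uminus: "x \<in> two_sided_ideal X \<Longrightarrow> - x \<in> two_sided_ideal X"
  using two_sided_ideal_mult_left[of x X "- 1"] by simp

lemma uq_eq_refl [simp]: "uq_eq q g g"
  by (simp add: uq_eq_def uq_ideal_def two_sided_ideal.zero)

lemma uq_eq_sym: "uq_eq q g h \<Longrightarrow> uq_eq q h g"
  using two_sided_ideal_uminus[of "g - h"] by (simp add: uq_eq_def uq_ideal_def)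

lemma uq_eq_trans [trans]: "uq_eq q g h \<Longrightarrow> uq_eq q h k \<Longrightarrow> uq_eq q g k"
  using two_sided_ideal.add[of "g - h" _ "h - k"] by (simp add: uq_eq_def uq_ideal_def)

lemma uq_eq_add: "uq_eq q g g' \<Longrightarrow> uq_eq q h h' \<Longrightarrow> uq_eq q (g + h) (g' + h')"
  using two_sided_ideal.add[of "g - g'" _ "h - h'"] by (simp add: uq_eq_def uq_ideal_def add_diff_add)

lemma uq_eq_uminus: "uq_eq q g g' \<Longrightarrow> uq_eq q (- g) (- g')"
  using two_sided_ideal_uminus[of "g - g'"] by (simp add: uq_eq_def uq_ideal_def)

lemma uq_eq_diff: "uq_eq q g g' \<Longrightarrow> uq_eq q h h' \<Longrightarrow> uq_eq q (g - h) (g' - h')"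
  using uq_eq_add[of q g g' "- h" "- h'"] uq_eq_uminus[of q h h'] by simp

lemma uq_eq_mult:
  assumes "uq_eq q g g'" and "uq_eq q h h'"
  shows "uq_eq q (g * h) (g' * h')"
proof -
  have "(g - g') * h + g' * (h - h') \<in> uq_ideal q"
    using assms two_sided_ideal_mult_left two_sided_ideal_mult_right two_sided_ideal.add
    unfolding uq_eq_def uq_ideal_def by blast
  then show ?thesis by (simp add: uq_eq_def algebra_simps)
qed

lemma uq_eq_mult_left: "uq_eq q h h' \<Longrightarrow> uq_eq q (g * h) (g * h')"
  by (rule uq_eq_mult) simp_all

lemma uq_eq_mult_right: "uq_eq q g g' \<Longrightarrow> uq_eq q (g * h) (g' * h)"
  by (rule uq_eq_mult) simp_all

lemma uq_eq_K_Ki: "uq_eq q (gk * gki) 1"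
  and uq_eq_Ki_K: "uq_eq q (gki * gk) 1"
  and uq_eq_K_E: "uq_eq q (gk * ge) (scal (of_real (q^2)) * ge * gk)"
  and uq_eq_K_F: "uq_eq q (gk * gf) (scal (of_real (inverse (q^2))) * gf * gk)"
  and uq_eq_E_F_diff: "uq_eq q (ge * gf - gf * ge) (scal (of_real (inverse (q - inverse q))) * (gk - gki))"
  unfolding uq_eq_def uq_ideal_def by (auto intro!: two_sided_ideal_base)

lemma uq_eq_E_F: "uq_eq q (ge * gf) (gf * ge + scal (of_real (inverse (q - inverse q))) * (gk - gki))"
  using uq_eq_add[OF uq_eq_E_F_diff[of q], of "gf * ge" "gf * ge"] by (simp add: add.commute)

text \<open>k and its inverse are separate letters, so the exponent law \<open>uq_eq_kp_add\<close>
  holds only modulo the relations.\<close>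

definition kp :: "int \<Rightarrow> falg" where
  "kp m = (if m \<ge> 0 then gk ^ nat m else gki ^ nat (- m))"

lemma kp_0 [simp]: "kp 0 = 1" and kp_1: "kp 1 = gk" and kp_m1: "kp (-1) = gki"
  by (simp_all add: kp_def)

lemma kp_of_nat [simp]: "kp (int m) = gk ^ m"
  by (simp add: kp_def)

lemma uq_eq_kp_K: "uq_eq q (kp m * gk) (kp (m + 1))"
proof (cases "m \<ge> 0")
  case True
  then show ?thesis by (simp add: kp_def nat_add_distrib power_commutes)
next
  case False
  then obtain n where n: "m = - int (Suc n)" by (metis negD not_le)
  have "uq_eq q (gki ^ n * (gki * gk)) (gki ^ n * 1)"
    by (rule uq_eq_mult_left[OF uq_eq_Ki_K])
  moreover have "kp m * gk = gki ^ n * (gki * gk)"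
    by (simp add: n kp_def mult.assoc power_Suc2 nat_add_distrib del: power_Suc)
  moreover have "kp (m + 1) = gki ^ n" by (simp add: n kp_def)
  ultimately show ?thesis by simp
qed

lemma uq_eq_kp_Ki: "uq_eq q (kp m * gki) (kp (m - 1))"
proof (cases "m \<le> 0")
  case True
  have "kp m = gki ^ nat (- m)" "kp (m - 1) = gki ^ nat (1 - m)" using True by (auto simp: kp_def)
  moreover have "nat (1 - m) = Suc (nat (- m))" using True by simp
  ultimately show ?thesis by (simp add: power_commutes)
next
  case False
  then obtain n where n: "m = int (Suc n)" by (metis not_le zero_less_imp_eq_int gr0_implies_Suc)
  have "uq_eq q (gk ^ n * (gk * gki)) (gk ^ n * 1)"
    by (rule uq_eq_mult_left[OF uq_eq_K_Ki])
  moreover have "kp m * gki = gk ^ n * (gk * gki)"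
    by (simp add: n kp_def nat_add_distrib mult.assoc power_Suc2 del: power_Suc)
  moreover have "kp (m - 1) = gk ^ n" by (simp add: n kp_def)
  ultimately show ?thesis by simp
qed

lemma uq_eq_kp_add: "uq_eq q (kp m * kp n) (kp (m + n))"
proof (induction n rule: int_induct[where k = 0])
  case (step1 i)
  have "uq_eq q (kp m * kp (i + 1)) (kp m * (kp i * gk))"
    by (intro uq_eq_mult_left uq_eq_sym[OF uq_eq_kp_K])
  also have "kp m * (kp i * gk) = (kp m * kp i) * gk" by (simp add: mult.assoc)
  also have "uq_eq q \<dots> (kp (m + i) * gk)" by (intro uq_eq_mult_right step1)
  also have "uq_eq q \<dots> (kp (m + i + 1))" by (rule uq_eq_kp_K)
  finally show ?case by (simp add: add.assoc)
next
  case (step2 i)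
  have "uq_eq q (kp m * kp (i - 1)) (kp m * (kp i * gki))"
    by (intro uq_eq_mult_left uq_eq_sym[OF uq_eq_kp_Ki])
  also have "kp m * (kp i * gki) = (kp m * kp i) * gki" by (simp add: mult.assoc)
  also have "uq_eq q \<dots> (kp (m + i) * gki)" by (intro uq_eq_mult_right step2)
  also have "uq_eq q \<dots> (kp (m + i - 1))" by (rule uq_eq_kp_Ki)
  finally show ?case by (simp add: diff_conv_add_uminus add.assoc del: add_uminus_conv_diff)
qed simp

text \<open>Insert k k^-1 on the right, use the commutation with k, and cancel k^-1 k on the
  left.\<close>

lemma uq_eq_Ki_swap:
  assumes "uq_eq q (gk * h) (scal c * h * gk)" and "c \<noteq> 0"
  shows "uq_eq q (gki * h) (scal (inverse c) * h * gki)"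
proof -
  have "uq_eq q (gki * h) (gki * h * (gk * gki))"
    using uq_eq_mult_left[OF uq_eq_sym[OF uq_eq_K_Ki], of q "gki * h"] by simp
  also have "gki * h * (gk * gki) = scal (inverse c) * gki * (scal c * h * gk) * gki"
    using assms(2) scal_mult[of "inverse c" c]
    by (metis (no_types, opaque_lifting) left_inverse mult.assoc mult_1 scal_1 scal_commute)
  also have "uq_eq q \<dots> (scal (inverse c) * gki * (gk * h) * gki)"
    by (intro uq_eq_mult_left uq_eq_mult_right uq_eq_sym[OF assms(1)])
  also have "\<dots> = scal (inverse c) * (gki * gk) * (h * gki)" by (simp add: mult.assoc)
  also have "uq_eq q \<dots> (scal (inverse c) * 1 * (h * gki))"
    by (intro uq_eq_mult_left uq_eq_mult_right uq_eq_Ki_K)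
  finally show ?thesis by (simp add: mult.assoc)
qed

lemma uq_eq_kp_swap:
  assumes "uq_eq q (gk * h) (scal c * h * gk)" and "c \<noteq> 0"
  shows "uq_eq q (kp m * h) (scal (c powi m) * h * kp m)"
proof (induction m rule: int_induct[where k = 0])
  case (step1 i)
  have c_powi: "scal c * scal (c powi i) = scal (c powi (i + 1))"
    using assms(2) by (simp add: power_int_add mult.commute flip: scal_mult)
  have "uq_eq q (kp (i + 1) * h) (kp i * gk * h)"
    by (intro uq_eq_mult_right uq_eq_sym[OF uq_eq_kp_K])
  also have "kp i * gk * h = kp i * (gk * h)" by (simp add: mult.assoc)
  also have "uq_eq q \<dots> (kp i * (scal c * h * gk))" by (intro uq_eq_mult_left assms)
  also have "\<dots> = scal c * (kp i * h) * gk"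
    by (simp add: scal_commute[of "kp i"] flip: mult.assoc)
  also have "uq_eq q \<dots> (scal c * (scal (c powi i) * h * kp i) * gk)"
    by (intro uq_eq_mult_left uq_eq_mult_right step1)
  also have "\<dots> = scal (c powi (i + 1)) * h * (kp i * gk)"
    by (simp add: c_powi flip: mult.assoc)
  also have "uq_eq q \<dots> (scal (c powi (i + 1)) * h * kp (i + 1))"
    by (intro uq_eq_mult_left uq_eq_kp_K)
  finally show ?case .
next
  case (step2 i)
  have "uq_eq q (kp (i - 1) * h) (kp i * gki * h)"
    by (intro uq_eq_mult_right uq_eq_sym[OF uq_eq_kp_Ki])
  also have "kp i * gki * h = kp i * (gki * h)" by (simp add: mult.assoc)
  also have "uq_eq q \<dots> (kp i * (scal (inverse c) * h * gki))"
    by (intro uq_eq_mult_left uq_eq_Ki_swap assms)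
  also have "\<dots> = scal (inverse c) * (kp i * h) * gki"
    by (simp add: scal_commute[of "kp i"] flip: mult.assoc)
  also have "uq_eq q \<dots> (scal (inverse c) * (scal (c powi i) * h * kp i) * gki)"
    by (intro uq_eq_mult_left uq_eq_mult_right step2)
  also have "\<dots> = scal (inverse c * c powi i) * h * (kp i * gki)"
    by (simp add: scal_mult mult.assoc)
  also have "inverse c * c powi i = c powi (i - 1)"
    using assms(2) by (simp add: power_int_diff field_simps)
  also have "uq_eq q (scal (c powi (i - 1)) * h * (kp i * gki)) (scal (c powi (i - 1)) * h * kp (i - 1))"
    by (intro uq_eq_mult_left uq_eq_kp_Ki)
  finally show ?case .
qed simp

lemma uq_eq_kp_E:
  assumes "q \<noteq> 0"
  shows "uq_eq q (kp m * ge) (scal (of_real q powi (2 * m)) * ge * kp m)"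
  using uq_eq_kp_swap[OF uq_eq_K_E[of q], of m] assms by (simp add: power_int_mult)

lemma uq_eq_kp_F:
  assumes "q \<noteq> 0"
  shows "uq_eq q (kp m * gf) (scal (of_real q powi (- 2 * m)) * gf * kp m)"
  using uq_eq_kp_swap[OF uq_eq_K_F[of q], of m] assms
  by (simp add: power_int_mult power_int_minus power_int_inverse)

section \<open>Functionals on the quantized enveloping algebra\<close>

definition uq_functional :: "real \<Rightarrow> func \<Rightarrow> bool" where
  "uq_functional q x \<longleftrightarrow> func_linear x \<and> (\<forall>h\<in>uq_ideal q. x h = 0)"

lemma uq_functional_cong:
  assumes "uq_functional q x" and "uq_eq q g h"
  shows "x g = x h"
proof -
  have "x (g - h) = 0" using assms by (simp add: uq_functional_def uq_eq_def)
  then show ?thesis using assms by (simp add: uq_functional_def func_linearD)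
qed

lemma uq_functional_cong2:
  assumes "uq_functional q x" and "uq_eq q g h"
  shows "x (u * g * v) = x (u * h * v)"
  by (rule uq_functional_cong[OF assms(1)]) (intro uq_eq_mult_left uq_eq_mult_right assms)

text \<open>The ideal consists of sums of \<open>g * r * h\<close> with r one of the five relations,
  so it suffices to kill these multiples. \<open>uq_functional_rules\<close> is the
  converse.\<close>

lemma uq_functionalI:
  assumes x: "func_linear x"
    and "\<And>g h. x (g * (gk * gki) * h) = x (g * h)"
    and "\<And>g h. x (g * (gki * gk) * h) = x (g * h)"
    and "\<And>g h. x (g * (gk * ge) * h) = of_real (q^2) * x (g * (ge * gk) * h)"
    and "\<And>g h. x (g * (gk * gf) * h) = of_real (inverse (q^2)) * x (g * (gf * gk) * h)"
    and "\<And>g h. x (g * (ge * gf) * h) = x (g * (gf * ge) * h)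
          + of_real (inverse (q - inverse q)) * (x (g * gk * h) - x (g * gki * h))"
  shows "uq_functional q x"
  unfolding uq_functional_def
proof (intro conjI ballI x)
  have scal: "x (g * scal c * h) = c * x (g * h)" for g c h
    by (simp add: scal_commute[of g] mult.assoc func_linearD[OF x])
  have scal': "x (g * scal c * a * h) = c * x (g * a * h)" "x (g * scal c * a * b * h) = c * x (g * a * b * h)" for g c a b h
    using scal[of g c "a * h"] scal[of g c "a * b * h"] by (simp_all add: mult.assoc)
  fix h assume "h \<in> uq_ideal q"
  then show "x h = 0" unfolding uq_ideal_def
  proof (induction rule: two_sided_ideal.induct)
    case (mult r g h)
    then show ?case
      using assms(2-6)[of g h]
      by (auto simp: left_diff_distrib right_diff_distrib func_linearD[OF x] mult.assoc[symmetric] scal scal')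
  qed (simp_all add: func_linearD[OF x])
qed

lemma uq_functional_rules:
  assumes x: "uq_functional q x"
  shows "x (g * (gk * gki) * h) = x (g * h)"
    and "x (g * (gki * gk) * h) = x (g * h)"
    and "x (g * (gk * ge) * h) = of_real (q^2) * x (g * (ge * gk) * h)"
    and "x (g * (gk * gf) * h) = of_real (inverse (q^2)) * x (g * (gf * gk) * h)"
    and "x (g * (ge * gf) * h) = x (g * (gf * ge) * h)
          + of_real (inverse (q - inverse q)) * (x (g * gk * h) - x (g * gki * h))"
proof -
  have lin: "func_linear x" using x by (simp add: uq_functional_def)
  have scal: "x (g * scal c * h) = c * x (g * h)" for g c h
    by (simp add: scal_commute[of g] mult.assoc func_linearD[OF lin])
  note c = uq_functional_cong2[OF x, where u = g and v = h]
  show "x (g * (gk * gki) * h) = x (g * h)" using c[OF uq_eq_K_Ki] by simp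
  show "x (g * (gki * gk) * h) = x (g * h)" using c[OF uq_eq_Ki_K] by simp
  show "x (g * (gk * ge) * h) = of_real (q^2) * x (g * (ge * gk) * h)"
    using c[OF uq_eq_K_E] scal by (simp add: mult.assoc)
  show "x (g * (gk * gf) * h) = of_real (inverse (q^2)) * x (g * (gf * gk) * h)"
    using c[OF uq_eq_K_F] scal by (simp add: mult.assoc)
  show "x (g * (ge * gf) * h) = x (g * (gf * ge) * h)
          + of_real (inverse (q - inverse q)) * (x (g * gk * h) - x (g * gki * h))"
    using c[OF uq_eq_E_F] scal[of g _ "(gk - gki) * h"]
    by (simp add: mult.assoc distrib_left distrib_right left_diff_distrib right_diff_distrib func_linearD[OF lin])
qed

text \<open>Both sides are additive in G and H, so a relation in the tensor square has to be checked
  only between elementary tensors.\<close>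

lemma tensor_eval_commute:
  assumes x: "func_linear x" and y: "func_linear y"
    and "\<And>g1 g2 h1 h2. tensor_eval x y (tens g1 g2 * r * tens h1 h2) = c * tensor_eval x y (tens g1 g2 * s * tens h1 h2)"
  shows "tensor_eval x y (G * r * H) = c * tensor_eval x y (G * s * H)"
proof (induction G rule: tens_induct)
  case (add g h)
  then show ?case by (simp add: distrib_right tensor_eval_add distrib_left)
next
  case (tens g1 g2)
  show ?case
  proof (induction H rule: tens_induct)
    case (add g h)
    then show ?case by (simp add: distrib_left tensor_eval_add)
  next
    case (tens h1 h2)
    show ?case by (rule assms(3))
  qed
qed

text \<open>The comultiplication respects the defining relations; each relation is verified after
  applying \<open>comult\<close> to its two sides.\<close>

lemma uq_functional_amult:
  assumes x: "uq_functional q x" and y: "uq_functional q y" and q: "0 < q" "q < 1"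
  shows "uq_functional q (amult x y)"
proof -
  have xl: "func_linear x" and yl: "func_linear y" using x y by (auto simp: uq_functional_def)
  note te = tensor_eval_tens[OF xl yl] tens_mult tensor_eval_add tensor_eval_diff tens_add_left tens_add_right
    distrib_left distrib_right comult_mult comult_add comult_diff
  note tc = tensor_eval_commute[OF xl yl]
  note rx = uq_functional_rules[OF x] and ry = uq_functional_rules[OF y]
  have KiE: "z (g * (gki * ge) * h) = of_real (inverse (q^2)) * z (g * (ge * gki) * h)"
    if "uq_functional q z" for z g h
  proof -
    have zl: "func_linear z" using that by (simp add: uq_functional_def)
    have "z (g * (gki * ge) * h) = z (g * (scal (inverse (of_real (q^2))) * ge * gki) * h)"
      by (rule uq_functional_cong2[OF that]) (rule uq_eq_Ki_swap[OF uq_eq_K_E], use q in simp)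
    also have "\<dots> = of_real (inverse (q^2)) * z (g * (ge * gki) * h)"
      using func_linearD(2)[OF zl, of "inverse (of_real (q^2))" "g * (ge * gki) * h"]
      by (metis (no_types, lifting) mult.assoc of_real_inverse scal_commute)
    finally show ?thesis .
  qed
  have assoc: "g * a * b * h = g * (a * b) * h" for g a b h :: falg by (simp add: mult.assoc)
  have scal2_out: "G * (scal2 c * z) * H = scal2 c * (G * z * H)" for G H z c
    by (simp add: scal2_commute[of G] flip: mult.assoc)
  have 1: "tensor_eval x y (G * comult (gk * gki) * H) = 1 * tensor_eval x y (G * 1 * H)" for G H
    by (rule tc) (simp add: te rx ry)
  have 2: "tensor_eval x y (G * comult (gki * gk) * H) = 1 * tensor_eval x y (G * 1 * H)" for G H
    by (rule tc) (simp add: te rx ry)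
  have 3: "tensor_eval x y (G * comult (gk * ge) * H)
      = of_real (q^2) * tensor_eval x y (G * comult (ge * gk) * H)" for G H
    by (rule tc) (simp add: te rx ry; simp add: algebra_simps)
  have 4: "tensor_eval x y (G * comult (gk * gf) * H)
      = of_real (inverse (q^2)) * tensor_eval x y (G * comult (gf * gk) * H)" for G H
    by (rule tc) (simp add: te rx ry; simp add: algebra_simps)
  define \<kappa> :: complex where "\<kappa> = of_real (inverse (q - inverse q))"
  \<comment> \<open>The mixed terms \<open>kf \<otimes> ek^-1\<close> and
    \<open>fk \<otimes> k^-1e\<close> cancel, since both equal q^-2 times
    \<open>fk \<otimes> ek^-1\<close>. The two remaining commutators add up to a multiple of k
    \<otimes> k - k^-1 \<otimes> k^-1.\<close>
  have 5: "tensor_eval x y (G * comult (ge * gf) * H)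
      = 1 * tensor_eval x y (G * (comult (gf * ge) + scal2 \<kappa> * (comult gk - comult gki)) * H)" for G H
  proof (rule tc)
    fix g1 g2 h1 h2
    have s: "tensor_eval x y (tens g1 g2 * (scal2 \<kappa> * z) * tens h1 h2) = \<kappa> * tensor_eval x y (tens g1 g2 * z * tens h1 h2)" for z
      by (simp add: scal2_out tensor_eval_scal2[OF xl yl])
    show "tensor_eval x y (tens g1 g2 * comult (ge * gf) * tens h1 h2) =
          1 * tensor_eval x y (tens g1 g2 * (comult (gf * ge) + scal2 \<kappa> * (comult gk - comult gki)) * tens h1 h2)"
      using q by (simp add: te s left_diff_distrib right_diff_distrib rx(4) ry(4) rx(5) ry(5) KiE[OF x] KiE[OF y])
        (simp add: algebra_simps \<kappa>_def)
  qed
  show ?thesis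
  proof (rule uq_functionalI)
    show "func_linear (amult x y)" using xl yl by (rule amult_linear)
    fix g h
    show "amult x y (g * (gk * gki) * h) = amult x y (g * h)"
      using 1[of "comult g" "comult h"] by (simp add: amult_eq comult_mult)
    show "amult x y (g * (gki * gk) * h) = amult x y (g * h)"
      using 2[of "comult g" "comult h"] by (simp add: amult_eq comult_mult)
    show "amult x y (g * (gk * ge) * h) = of_real (q^2) * amult x y (g * (ge * gk) * h)"
      using 3[of "comult g" "comult h"] unfolding amult_eq comult_mult .
    show "amult x y (g * (gk * gf) * h) = of_real (inverse (q^2)) * amult x y (g * (gf * gk) * h)"
      using 4[of "comult g" "comult h"] unfolding amult_eq comult_mult .
    show "amult x y (g * (ge * gf) * h) = amult x y (g * (gf * ge) * h)
        + of_real (inverse (q - inverse q)) * (amult x y (g * gk * h) - amult x y (g * gki * h))"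
      using 5[of "comult g" "comult h"] unfolding amult_eq comult_mult \<kappa>_def[symmetric]
      by (simp add: distrib_left distrib_right left_diff_distrib right_diff_distrib scal2_out
          tensor_eval_add tensor_eval_diff tensor_eval_scal2[OF xl yl])
  qed
qed

section \<open>The generator of the coideal subalgebra\<close>

text \<open>The phase in i q^(-1/2) R(e) = - i q^(1/2) k^-1 e. It is purely imaginary with square
  -q; the first fact gives self-adjointness, the second enters the radial part.\<close>

definition rho :: "real \<Rightarrow> complex" where
  "rho q = \<i> * of_real (q powr (1 / 2))"

definition wt :: "real \<Rightarrow> real \<Rightarrow> complex" where
  "wt q a = of_real (qnum q a)"

text \<open>The short form of i R(B_t) modulo the relations (\<open>uq_eq_xel\<close>), with the
  powers of k around f cancelled.\<close>

definition xel :: "real \<Rightarrow> real \<Rightarrow> falg" where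
  "xel q a = scal (rho q) * (gf - gki * ge) + scal (wt q a) * gki"

lemma rho_nonzero: "0 < q \<Longrightarrow> rho q \<noteq> 0"
  by (simp add: rho_def)

lemma rho_sq: "0 < q \<Longrightarrow> rho q * rho q = - of_real q"
  by (simp add: rho_def algebra_simps flip: of_real_mult powr_add)

text \<open>The literal element of the free algebra, before any relation is applied, because
  comultiplication and involution act on representatives. The constant c is \<open>rho q\<close>
  times q^-2; the factor q^2 is released when k^-1 moves past f.\<close>

lemma RBt_expansion:
  assumes "0 < q"
  obtains c where "c * of_real (q^2) = rho q" "cnj c = - c"
    "scal \<i> * RBt q a = - (scal (rho q) * (gki * ge)) + scal c * (gki * gf * gk) + scal (wt q a) * gki"
proof -
  define r :: complex where "r = of_real (q powr (- 1 / 2))"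
  have r: "\<i> * r * of_real q = rho q" "\<i> * r * of_real (inverse q) * of_real (q^2) = rho q"
  proof -
    have "q powr (- 1 / 2) * q = q powr (1 / 2)"
      using assms powr_add[of q "- 1 / 2" 1] by simp
    then show "\<i> * r * of_real q = rho q" by (simp add: r_def rho_def flip: of_real_mult)
    moreover have "of_real (inverse q) * of_real (q^2) = (of_real q :: complex)"
      using assms by (simp add: power2_eq_square)
    ultimately show "\<i> * r * of_real (inverse q) * of_real (q^2) = rho q" by (simp only: mult.assoc)
  qed
  have wt: "\<i> * - (\<i> * of_real (inverse (q - inverse q) * tpar q a)) = wt q a"
    by (simp add: wt_def qnum_def tpar_def divide_inverse mult.commute)
  have Bt: "Bt q a = Poly_Mapping.single [GE] r + Poly_Mapping.single [GF, GK] (- r)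
      + Poly_Mapping.single [GK] (- (\<i> * of_real (inverse (q - inverse q) * tpar q a)))"
    by (simp add: Bt_def r_def gk_def ge_def gf_def scal_def mult_single plus_list_def right_diff_distrib
      single_uminus)
  have RBt: "RBt q a = scal r * - (scal (of_real q) * gki * ge)
      + scal (- r) * (gki * - (scal (of_real (inverse q)) * gf * gk))
      + scal (- (\<i> * of_real (inverse (q - inverse q) * tpar q a))) * gki"
    unfolding RBt_def unitary_antipode_def Bt
    by (simp add: anti_ext_add[of scal] anti_ext_single[of scal] scal_add)
  show ?thesis
  proof (rule that)
    show "\<i> * r * of_real (inverse q) * of_real (q^2) = rho q" by (rule r(2))
    show "cnj (\<i> * r * of_real (inverse q)) = - (\<i> * r * of_real (inverse q))" by (simp add: r_def)
    show "scal \<i> * RBt q a = - (scal (rho q) * (gki * ge))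
        + scal (\<i> * r * of_real (inverse q)) * (gki * gf * gk) + scal (wt q a) * gki"
    proof -
      have "scal \<i> * (scal r * - (scal (of_real q) * gki * ge)) = - (scal (rho q) * (gki * ge))"
        by (simp add: scal_mult mult.assoc flip: r(1))
      moreover have "scal \<i> * (scal (- r) * (gki * - (scal (of_real (inverse q)) * gf * gk)))
          = scal (\<i> * r * of_real (inverse q)) * (gki * gf * gk)"
        by (simp add: scal_mult scal_uminus scal_commute[of gki] flip: mult.assoc)
      moreover have "scal \<i> * (scal (- (\<i> * of_real (inverse (q - inverse q) * tpar q a))) * gki) = scal (wt q a) * gki"
        by (simp only: wt mult.assoc[symmetric] scal_mult[symmetric])
      ultimately show ?thesis unfolding RBt distrib_left by simp
    qed
  qed
qed

lemma uq_eq_xel: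
  assumes "0 < q"
  shows "uq_eq q (scal \<i> * RBt q a) (xel q a)"
proof -
  obtain c where c: "c * of_real (q^2) = rho q"
    and X: "scal \<i> * RBt q a = - (scal (rho q) * (gki * ge)) + scal c * (gki * gf * gk) + scal (wt q a) * gki"
    using RBt_expansion[OF assms] .
  note X
  also have "uq_eq q \<dots> (- (scal (rho q) * (gki * ge)) + scal (rho q) * gf + scal (wt q a) * gki)"
  proof (intro uq_eq_add uq_eq_refl)
    have "uq_eq q (gki * gf * gk) (scal (of_real (q^2)) * gf * gki * gk)"
      using uq_eq_Ki_swap[OF uq_eq_K_F[of q]] assms by (intro uq_eq_mult_right) simp
    also have "\<dots> = scal (of_real (q^2)) * gf * (gki * gk)" by (simp add: mult.assoc)
    also have "uq_eq q \<dots> (scal (of_real (q^2)) * gf * 1)" by (intro uq_eq_mult_left uq_eq_Ki_K)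
    finally have "uq_eq q (scal c * (gki * gf * gk))
      (scal c * (scal (of_real (q^2)) * gf))"
      by (intro uq_eq_mult_left) simp
    also have "\<dots> = scal (rho q) * gf"
      by (simp only: c scal_mult[symmetric] mult.assoc[symmetric])
    finally show "uq_eq q (scal c * (gki * gf * gk)) (scal (rho q) * gf)" .
  qed
  also have "\<dots> = xel q a" by (simp add: xel_def algebra_simps)
  finally show ?thesis .
qed

section \<open>Biinvariant functionals\<close>

text \<open>
  Invariance under \<open>X\<close> on both sides leaves the values next to finitely many powers of \<open>k\<close> undetermined (for
  instance at \<open>e\<close>); regularity recovers them from the other powers.
\<close>

definition kregular :: "real \<Rightarrow> func \<Rightarrow> bool" where
  "kregular q x \<longleftrightarrow> (\<forall>g h. \<exists>N p. \<forall>m. x (g * gk ^ m * h) * (of_real q ^ m) ^ N = poly p (of_real q ^ m))"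

definition biinvariant :: "real \<Rightarrow> real \<Rightarrow> func \<Rightarrow> bool" where
  "biinvariant q a x \<longleftrightarrow> uq_functional q x \<and> kregular q x \<and>
     (\<forall>g. x (g * xel q a) = wt q a * x g) \<and> (\<forall>g. x (xel q a * g) = wt q a * x g)"

lemma laurent_sum:
  fixes z :: "nat \<Rightarrow> complex"
  assumes "\<exists>N p. \<forall>m. f m * z m ^ N = poly p (z m)" and "\<exists>N p. \<forall>m. g m * z m ^ N = poly p (z m)"
  shows "\<exists>N p. \<forall>m. (f m + g m) * z m ^ N = poly p (z m)"
proof -
  from assms obtain N p N' p' where
    "\<And>m. f m * z m ^ N = poly p (z m)" "\<And>m. g m * z m ^ N' = poly p' (z m)" by metis
  then have "\<forall>m. (f m + g m) * z m ^ (N + N') = poly (p * monom 1 N' + p' * monom 1 N) (z m)"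
    by (simp add: poly_monom power_add algebra_simps)
  then show ?thesis by blast
qed

lemma laurent_prod:
  fixes z :: "nat \<Rightarrow> complex"
  assumes "\<exists>N p. \<forall>m. f m * z m ^ N = poly p (z m)" and "\<exists>N p. \<forall>m. g m * z m ^ N = poly p (z m)"
  shows "\<exists>N p. \<forall>m. (f m * g m) * z m ^ N = poly p (z m)"
proof -
  from assms obtain N p N' p' where
    *: "\<And>m. f m * z m ^ N = poly p (z m)" "\<And>m. g m * z m ^ N' = poly p' (z m)" by metis
  have "(f m * g m) * z m ^ (N + N') = (f m * z m ^ N) * (g m * z m ^ N')" for m
    by (simp add: power_add mult_ac)
  then have "\<forall>m. (f m * g m) * z m ^ (N + N') = poly (p * p') (z m)"
    unfolding * by simp
  then show ?thesis by blast
qed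

lemma kregular_add: "kregular q x \<Longrightarrow> kregular q y \<Longrightarrow> kregular q (x + y)"
  unfolding kregular_def plus_fun_def by (intro allI laurent_sum) simp_all

lemma kregular_ascale: "kregular q x \<Longrightarrow> kregular q (ascale c x)"
  unfolding kregular_def ascale_def
  by (intro allI laurent_prod, rule exI[of _ 0], rule exI[of _ "[:c:]"]) simp_all

lemma tens_power: "tens g h ^ m = tens (g ^ m) (h ^ m)"
  by (induction m) (simp_all add: tens_mult)

lemma comult_power: "comult (g ^ m) = comult g ^ m"
  by (induction m) (simp_all add: comult_mult)

text \<open>k is group-like, so k^m reaches both tensor legs and the value is a sum of products of
  two Laurent polynomials in q^m.\<close>

lemma kregular_amult:
  assumes x: "func_linear x" "kregular q x" and y: "func_linear y" "kregular q y"
  shows "kregular q (amult x y)"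
proof -
  have "\<exists>N p. \<forall>m. tensor_eval x y (G * tens (gk ^ m) (gk ^ m) * H) * (of_real q ^ m) ^ N = poly p (of_real q ^ m)" for G H
  proof (induction G rule: tens_induct)
    case (add g h)
    then show ?case unfolding distrib_right[of _ _ "_ :: falg2"] tensor_eval_add by (rule laurent_sum)
  next
    case (tens g1 g2)
    show ?case
    proof (induction H rule: tens_induct)
      case (add g h)
      then show ?case unfolding distrib_left[of "_ :: falg2"] tensor_eval_add by (rule laurent_sum)
    next
      case (tens h1 h2)
      show ?case
        unfolding tens_mult tensor_eval_tens[OF x(1) y(1)]
        by (rule laurent_prod) (use x(2) y(2) in \<open>auto simp: kregular_def\<close>)
    qed
  qed
  then show ?thesis by (simp add: kregular_def amult_eq comult_mult comult_power tens_power)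
qed

lemma uq_functional_add: "uq_functional q x \<Longrightarrow> uq_functional q y \<Longrightarrow> uq_functional q (x + y)"
  by (auto simp: uq_functional_def func_linear_def algebra_simps)

lemma uq_functional_ascale: "uq_functional q x \<Longrightarrow> uq_functional q (ascale c x)"
  by (auto simp: uq_functional_def func_linear_def ascale_def algebra_simps)

lemma biinvariant_add: "biinvariant q a x \<Longrightarrow> biinvariant q a y \<Longrightarrow> biinvariant q a (x + y)"
  by (auto simp: biinvariant_def intro: uq_functional_add kregular_add simp: algebra_simps)

lemma biinvariant_ascale: "biinvariant q a x \<Longrightarrow> biinvariant q a (ascale c x)"
  by (auto simp: biinvariant_def intro: uq_functional_ascale kregular_ascale) (simp_all add: ascale_def)

lemma comult_xel:
  "comult (xel q a) = scal2 (rho q) * (tens 1 gf + tens gf gki - (tens gki gki) * (tens ge 1 + tens gk ge))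
     + scal2 (wt q a) * tens gki gki"
  by (simp add: xel_def comult_add comult_mult comult_diff)

text \<open>Only 1 \<otimes> X contributes: the rest of the comultiplication is (X - [a]) \<otimes>
  k^-1, and x annihilates right multiples of X - [a].\<close>

lemma amult_xel_right:
  assumes x: "uq_functional q x" and y: "uq_functional q y"
    and X: "\<And>g. x (g * xel q a) = wt q a * x g" and Y: "\<And>g. y (g * xel q a) = wt q a * y g"
  shows "amult x y (g * xel q a) = wt q a * amult x y g"
proof -
  have xl: "func_linear x" and yl: "func_linear y" using x y by (auto simp: uq_functional_def)
  have lin: "z (g * xel q a) = rho q * (z (g * gf) - z (g * (gki * ge))) + wt q a * z (g * gki)"
    if "func_linear z" for z g
    by (simp add: xel_def distrib_left right_diff_distrib func_linearD[OF that] scal_commute[of g]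
        flip: mult.assoc)
  have "tensor_eval x y (G * comult (xel q a)) = wt q a * tensor_eval x y G" for G
  proof (induction G rule: tens_induct)
    case (add g h)
    then show ?case by (simp add: distrib_right tensor_eval_add distrib_left)
  next
    case (tens g h)
    have s: "tensor_eval x y (tens g h * (scal2 c * z)) = c * tensor_eval x y (tens g h * z)" for c z
      using tensor_eval_scal2[OF xl yl, of c "tens g h * z"]
      by (simp add: scal2_commute[of "tens g h"] flip: mult.assoc)
    have r: "x (g * (gki * gk)) = x g"
      using uq_functional_rules(2)[OF x, of g 1] by simp
    have "tensor_eval x y (tens g h * comult (xel q a))
      = x g * (rho q * (y (h * gf) - y (h * (gki * ge))) + wt q a * y (h * gki))
        + (rho q * (x (g * gf) - x (g * (gki * ge))) + wt q a * x (g * gki)) * y (h * gki)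
        - wt q a * x g * y (h * gki)"
      by (simp add: comult_xel distrib_left right_diff_distrib tensor_eval_add tensor_eval_diff s tens_mult
          tensor_eval_tens[OF xl yl] r; simp add: algebra_simps)
    also have "\<dots> = wt q a * tensor_eval x y (tens g h)"
      using X[of g] Y[of h] unfolding lin[OF xl] lin[OF yl]
      by (simp add: tensor_eval_tens[OF xl yl])
    finally show ?case .
  qed
  then show ?thesis by (simp add: amult_eq comult_mult)
qed

lemma amult_xel_left:
  assumes x: "uq_functional q x" and y: "uq_functional q y"
    and X: "\<And>g. x (xel q a * g) = wt q a * x g" and Y: "\<And>g. y (xel q a * g) = wt q a * y g"
  shows "amult x y (xel q a * g) = wt q a * amult x y g"
proof -
  have xl: "func_linear x" and yl: "func_linear y" using x y by (auto simp: uq_functional_def)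
  have lin: "z (xel q a * g) = rho q * (z (gf * g) - z (gki * ge * g)) + wt q a * z (gki * g)"
    if "func_linear z" for z g
    by (simp add: xel_def distrib_right left_diff_distrib distrib_left right_diff_distrib mult.assoc func_linearD[OF that])
  have "tensor_eval x y (comult (xel q a) * G) = wt q a * tensor_eval x y G" for G
  proof (induction G rule: tens_induct)
    case (add g h)
    then show ?case by (simp add: distrib_left tensor_eval_add)
  next
    case (tens g h)
    have r: "x (gki * gk * g) = x g"
      using uq_functional_rules(2)[OF x, of 1 g] by simp
    have "tensor_eval x y (comult (xel q a) * tens g h)
      = x g * (rho q * (y (gf * h) - y (gki * ge * h)) + wt q a * y (gki * h))
        + (rho q * (x (gf * g) - x (gki * ge * g)) + wt q a * x (gki * g)) * y (gki * h)
        - wt q a * x g * y (gki * h)"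
      by (simp add: comult_xel distrib_left distrib_right left_diff_distrib right_diff_distrib tensor_eval_add
          tensor_eval_diff tens_mult mult.assoc tensor_eval_scal2[OF xl yl]
          tensor_eval_tens[OF xl yl] r[unfolded mult.assoc]; simp add: algebra_simps)
    also have "\<dots> = wt q a * tensor_eval x y (tens g h)"
      using X[of g] Y[of h] unfolding lin[OF xl] lin[OF yl]
      by (simp add: tensor_eval_tens[OF xl yl])
    finally show ?case .
  qed
  then show ?thesis by (simp add: amult_eq comult_mult)
qed

lemma biinvariant_amult:
  assumes "biinvariant q a x" and "biinvariant q a y" and "0 < q" and "q < 1"
  shows "biinvariant q a (amult x y)"
  using assms amult_xel_left[of q x y a] amult_xel_right[of q x y a]
    uq_functional_amult[of q x y] kregular_amult[of x q y]
  by (auto simp: biinvariant_def uq_functional_def)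

lemma counit_mult: "counit (g * h) = counit g * counit h"
  unfolding counit_def by (rule hom_ext_mult) simp_all

lemma counit_add: "counit (g + h) = counit g + counit h"
  unfolding counit_def by (rule hom_ext_add) simp_all

lemma counit_gens [simp]: "counit gk = 1" "counit gki = 1" "counit ge = 0" "counit gf = 0"
  "counit (scal c) = c" "counit 1 = 1"
  by (simp_all add: counit_def gk_def gki_def ge_def gf_def scal_def hom_ext_single flip: word_Nil)

lemma counit_linear: "func_linear counit"
  by (simp add: func_linear_def counit_add counit_mult)

lemma counit_power: "counit (g ^ m) = counit g ^ m"
  by (induction m) (simp_all add: counit_mult)

lemma biinvariant_counit:
  shows "biinvariant q a counit"
  unfolding biinvariant_def
proof (intro conjI allI)
  show "uq_functional q counit"
    by (rule uq_functionalI[OF counit_linear]) (simp_all add: counit_mult)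
  show "kregular q counit" unfolding kregular_def counit_mult
    by (intro allI exI[of _ 0] exI[of _ "[:counit g * counit h:]" for g h]) (simp add: counit_power)
  have "counit (xel q a) = wt q a"
    by (simp add: xel_def counit_add counit_mult func_linearD(5)[OF counit_linear])
  then show "counit (g * xel q a) = wt q a * counit g" "counit (xel q a * g) = wt q a * counit g" for g
    by (simp_all add: counit_mult)
qed

section \<open>Biinvariant functionals are determined on powers of \<open>k\<close>\<close>

lemma poly_eq_0_if_infinite:
  fixes p :: "complex poly"
  assumes "0 < q" and "q < 1" and "\<And>m. m \<ge> m0 \<Longrightarrow> poly p (of_real q ^ m) = 0"
  shows "p = 0"
proof (rule ccontr)
  assume "p \<noteq> 0"
  then have "finite {z. poly p z = 0}" by (rule poly_roots_finite)
  moreover have "(\<lambda>m. of_real q ^ m) ` {m0..} \<subseteq> {z. poly p z = 0}" using assms(3) by auto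
  ultimately have "finite ((\<lambda>m. complex_of_real q ^ m) ` {m0..})" by (rule rev_finite_subset)
  moreover have "inj_on (\<lambda>m. complex_of_real q ^ m) {m0..}"
  proof (rule inj_onI)
    fix m n :: nat assume "complex_of_real q ^ m = of_real q ^ n"
    then have "q ^ m = q ^ n" by (metis of_real_eq_iff of_real_power)
    then show "m = n" using assms(1,2) by (metis linorder_neqE_nat order_less_irrefl power_strict_decreasing)
  qed
  ultimately have "finite {m0..}" by (rule finite_imageD)
  then show False using infinite_Ici by blast
qed

text \<open>The values form a Laurent polynomial in q^m, and one that vanishes at infinitely many
  points q^m is zero.\<close>

lemma kregular_vanish:
  assumes "0 < q" and "q < 1" and "kregular q x" and "\<And>m. m \<ge> m0 \<Longrightarrow> x (g * gk ^ m * h) = 0"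
  shows "x (g * gk ^ m * h) = 0"
proof -
  obtain N p where p: "\<And>m. x (g * gk ^ m * h) * (of_real q ^ m) ^ N = poly p (of_real q ^ m)"
    using assms(3) unfolding kregular_def by blast
  have "p = 0"
    by (rule poly_eq_0_if_infinite[OF assms(1,2), of m0]) (simp add: assms(4) flip: p)
  then show ?thesis using p[of m] assms(1) by simp
qed

text \<open>Negative exponents are reached by absorbing \<open>kp m\<close> into the left factor and
  multiplying by further positive powers.\<close>

lemma kregular_vanish_int:
  assumes q: "0 < q" "q < 1" and x: "kregular q x" "uq_functional q x"
    and 0: "\<And>m::int. m \<ge> m0 \<Longrightarrow> x (g * kp m) = 0"
  shows "x (g * kp m) = 0"
proof -
  have shift: "x (g * kp m * gk ^ n) = x (g * kp (m + int n))" for n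
    using uq_functional_cong2[OF x(2) uq_eq_kp_add[of q m "int n"], of g 1] by (simp add: mult.assoc)
  have "x (g * kp m * gk ^ n * 1) = 0" for n
  proof (rule kregular_vanish[OF q x(1)])
    fix n assume "n \<ge> nat (m0 - m)"
    then show "x (g * kp m * gk ^ n * 1) = 0" using 0[of "m + int n"] by (simp add: shift)
  qed
  from this[of 0] show ?thesis by simp
qed

text \<open>The number of letters \<open>e\<close>, \<open>f\<close>: all relations of \<open>U\<close> are homogeneous for it up to terms of lower degree.\<close>

definition ef_degree :: "gen list \<Rightarrow> nat" where
  "ef_degree w = length (filter (\<lambda>l. l = GE \<or> l = GF) w)"

lemma ef_degree_simps [simp]:
  "ef_degree [] = 0" "ef_degree (v @ w) = ef_degree v + ef_degree w" "ef_degree (GE # w) = Suc (ef_degree w)"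
  "ef_degree (GF # w) = Suc (ef_degree w)" "ef_degree (GK # w) = ef_degree w" "ef_degree (GKi # w) = ef_degree w"
  "ef_degree (replicate n GK) = 0" "ef_degree (replicate n GKi) = 0" "ef_degree (replicate n GE) = n"
  by (induction n) (auto simp: ef_degree_def)

lemma ef_degree_eq_length: "set w \<subseteq> {GE, GF} \<Longrightarrow> ef_degree w = length w"
  by (induction w) (auto simp: ef_degree_def)

lemma word_simps: "word [GK] = gk" "word [GKi] = gki" "word [GE] = ge" "word [GF] = gf"
  by (simp_all add: gk_def gki_def ge_def gf_def)

lemma word_replicate: "word (replicate n l) = word [l] ^ n"
  by (induction n) (simp_all add: word_Cons[of l "replicate _ l"])

lemma kp_eq_word: "\<exists>w. kp m = word w \<and> ef_degree w = 0"
proof (cases "m \<ge> 0")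
  case True
  then show ?thesis
    by (intro exI[of _ "replicate (nat m) GK"]) (simp add: kp_def word_replicate word_simps)
next
  case False
  then show ?thesis
    by (intro exI[of _ "replicate (nat (- m)) GKi"]) (simp add: kp_def word_replicate word_simps)
qed

text \<open>Only k and its inverse are moved, to the right end. The letters e and f keep their
  order, so a single term of unchanged degree results.\<close>

lemma word_normal_form:
  assumes "q \<noteq> 0"
  shows "\<exists>u c m. set u \<subseteq> {GE, GF} \<and> length u = ef_degree w \<and> uq_eq q (word w) (scal c * word u * kp m)"
proof (induction w rule: rev_induct)
  case Nil
  show ?case by (intro exI[of _ "[]"] exI[of _ 1] exI[of _ 0]) simp
next
  case (snoc l w)
  then obtain u c m where u: "set u \<subseteq> {GE, GF}" "length u = ef_degree w" "uq_eq q (word w) (scal c * word u * kp m)"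
    by blast
  have *: "uq_eq q (word (w @ [l])) (scal c * word u * (kp m * word [l]))"
    using uq_eq_mult_right[OF u(3), of "word [l]"] by (simp add: word_append mult.assoc)
  have EF: ?case if "uq_eq q (kp m * word [l]) (scal d * word [l] * kp m)" "l = GE \<or> l = GF" for d
  proof -
    have "uq_eq q (word (w @ [l])) (scal c * word u * (scal d * word [l] * kp m))"
      using * by (rule uq_eq_trans) (intro uq_eq_mult_left that)
    also have "\<dots> = scal (c * d) * word (u @ [l]) * kp m"
      by (simp add: scal_mult word_append scal_commute[of "word u"] flip: mult.assoc)
         (simp add: scal_commute[of "word u"] mult.assoc)
    finally show ?thesis using that(2) u by (intro exI[of _ "u @ [l]"] exI[of _ "c * d"] exI[of _ m]) auto
  qed
  have K: ?case if "uq_eq q (kp m * word [l]) (kp m')" "l = GK \<or> l = GKi" for m'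
  proof -
    have "uq_eq q (word (w @ [l])) (scal c * word u * kp m')"
      using * by (rule uq_eq_trans) (intro uq_eq_mult_left that)
    then show ?thesis using that(2) u by (intro exI[of _ u] exI[of _ c] exI[of _ m']) auto
  qed
  show ?case
  proof (cases l)
    case GK then show ?thesis using K uq_eq_kp_K[of q m] by (simp add: word_simps)
  next
    case GKi then show ?thesis using K uq_eq_kp_Ki[of q m] by (simp add: word_simps)
  next
    case GE then show ?thesis using EF uq_eq_kp_E[OF assms, of m] by (simp add: word_simps)
  next
    case GF then show ?thesis using EF uq_eq_kp_F[OF assms, of m] by (simp add: word_simps)
  qed
qed

definition k_commutes :: "real \<Rightarrow> complex \<Rightarrow> falg \<Rightarrow> bool" where
  "k_commutes q c h \<longleftrightarrow> c \<noteq> 0 \<and> uq_eq q (gk * h) (scal c * h * gk)"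

lemma k_commutes_E: "q \<noteq> 0 \<Longrightarrow> k_commutes q (of_real (q^2)) ge"
  using uq_eq_K_E by (simp add: k_commutes_def)

lemma k_commutes_F: "q \<noteq> 0 \<Longrightarrow> k_commutes q (of_real (inverse (q^2))) gf"
  using uq_eq_K_F[of q] by (simp add: k_commutes_def)

lemma k_commutes_mult:
  assumes "k_commutes q c g" and "k_commutes q d h"
  shows "k_commutes q (c * d) (g * h)"
proof -
  have "uq_eq q (gk * g * h) (scal c * g * gk * h)"
    using assms by (intro uq_eq_mult_right) (simp add: k_commutes_def)
  also have "\<dots> = scal c * g * (gk * h)" by (simp add: mult.assoc)
  also have "uq_eq q \<dots> (scal c * g * (scal d * h * gk))"
    using assms by (intro uq_eq_mult_left) (simp add: k_commutes_def)
  also have "\<dots> = scal (c * d) * (g * h) * gk"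
    by (simp add: scal_mult mult.assoc) (simp add: scal_commute[of g] flip: mult.assoc)
  finally show ?thesis using assms by (simp add: k_commutes_def mult.assoc)
qed

lemma k_commutes_1: "k_commutes q 1 1"
  by (simp add: k_commutes_def)

lemma k_commutes_power: "k_commutes q c h \<Longrightarrow> k_commutes q (c ^ n) (h ^ n)"
  by (induction n) (simp_all add: k_commutes_1 k_commutes_mult)

lemma k_commutes_word:
  assumes "set w \<subseteq> {GE, GF}" and "q \<noteq> 0"
  shows "\<exists>c. k_commutes q c (word w)"
  using assms(1)
proof (induction w)
  case (Cons l w)
  then obtain c where "k_commutes q c (word w)" by auto
  moreover have "\<exists>d. k_commutes q d (word [l])"
    using Cons.prems k_commutes_E[OF assms(2)] k_commutes_F[OF assms(2)] by (auto simp: word_simps)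
  ultimately show ?case using k_commutes_mult word_Cons[of l w] by metis
qed (use k_commutes_1 in auto)

text \<open>Modulo values of lower degree, invariance on either side trades f for k^-1 e, and the
  letters e, f commute. Hence every f can be turned into e at the cost of a scalar and a shift of
  the power of k, which leaves e^d. There two evaluations of x(f e^(d-1) k^(m+1)), from the left and
  from the right, force x(e^d k^m) = 0.\<close>

lemma biinvariant_eq_0_step:
  assumes q: "0 < q" "q < 1" and x: "biinvariant q a x" and d: "d > 0"
    and IH: "\<And>w. ef_degree w < d \<Longrightarrow> x (word w) = 0"
    and u: "set u \<subseteq> {GE, GF}" "length u = d"
  shows "x (word u * kp m) = 0"
proof -
  have xu: "uq_functional q x" and xk: "kregular q x" and xR: "\<And>g. x (g * xel q a) = wt q a * x g"
    and xL: "\<And>g. x (xel q a * g) = wt q a * x g" using x by (auto simp: biinvariant_def)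
  have xl: "func_linear x" using xu by (simp add: uq_functional_def)
  note lin = func_linearD[OF xl]
  have scal: "x (g * (scal c * h)) = c * x (g * h)" for g c h
    using lin(2)[of c "g * h"] by (simp add: scal_commute[of g] flip: mult.assoc)
  have q0: "q \<noteq> 0" "complex_of_real q \<noteq> 0" using q by auto
  have low: "x (word w * kp m) = 0" if "ef_degree w < d" for w m
    using kp_eq_word[of m] IH that by (metis add.right_neutral ef_degree_simps(2) word_append)
  have left: "x (gf * word v * kp m) = x (gki * ge * word v * kp m)" if "ef_degree v < d" for v m
  proof -
    have "x (xel q a * (word v * kp m)) = 0" unfolding xL using low[OF that] by simp
    moreover have "x (gki * word v * kp m) = 0"
      using low[of "GKi # v" m] that word_append[of "[GKi]" v] by (simp add: word_simps)
    ultimately show ?thesis using rho_nonzero[OF q(1)]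
      by (simp add: xel_def distrib_right left_diff_distrib mult.assoc lin)
  qed
  have right: "x (word v * kp m * gf) = x (word v * kp m * (gki * ge))" if "ef_degree v < d" for v m
  proof -
    have "x (word v * kp m * xel q a) = 0" unfolding xR using low[OF that] by simp
    moreover have "x (word v * kp m * gki) = 0"
      using low[OF that, of "m - 1"] uq_functional_cong2[OF xu uq_eq_kp_Ki[of q m], of "word v" 1]
      by (simp add: mult.assoc)
    ultimately show ?thesis using rho_nonzero[OF q(1)]
      by (simp add: xel_def distrib_left right_diff_distrib scal lin)
  qed
  have swap: "x (word (u1 @ [GE, GF] @ u2) * kp m) = x (word (u1 @ [GF, GE] @ u2) * kp m)"
    if "ef_degree u1 + ef_degree u2 + 2 = d" for u1 u2 m
  proof -
    have "x (word u1 * gk * (word u2 * kp m)) = 0" "x (word u1 * gki * (word u2 * kp m)) = 0"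
      using low[of "u1 @ [GK] @ u2" m] low[of "u1 @ [GKi] @ u2" m] that
      unfolding word_append word_simps by (simp_all add: mult.assoc)
    then have "x (word u1 * (ge * gf) * (word u2 * kp m)) = x (word u1 * (gf * ge) * (word u2 * kp m))"
      using uq_functional_rules(5)[OF xu, of "word u1" "word u2 * kp m"] by simp
    then show ?thesis
      using word_append[of "[GE]" "[GF]"] word_append[of "[GF]" "[GE]"]
      by (simp add: word_append[of u1] word_append[of "[_, _]" u2, simplified] word_simps mult.assoc)
  qed
  have front: "x (word (replicate n GE @ GF # u2) * kp m) = x (word (GF # replicate n GE @ u2) * kp m)"
    if "n + ef_degree u2 + 1 = d" for n u2 m
    using that
  proof (induction n arbitrary: u2)
    case (Suc n)
    have "x (word (replicate (Suc n) GE @ GF # u2) * kp m) = x (word (replicate n GE @ [GE, GF] @ u2) * kp m)"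
      by (simp add: replicate_app_Cons_same)
    also have "\<dots> = x (word (replicate n GE @ [GF, GE] @ u2) * kp m)"
      by (rule swap) (use Suc.prems in simp)
    also have "\<dots> = x (word (GF # replicate n GE @ GE # u2) * kp m)"
      using Suc.IH[of "GE # u2"] Suc.prems by simp
    also have "\<dots> = x (word (GF # replicate (Suc n) GE @ u2) * kp m)"
      by (simp add: replicate_app_Cons_same)
    finally show ?case .
  qed simp
  have Ki_move: "x (gki * h * kp m) = inverse c * x (h * kp (m - 1))" if "k_commutes q c h" for c h m
  proof -
    have "uq_eq q (gki * h) (scal (inverse c) * h * gki)"
      using that uq_eq_Ki_swap by (simp add: k_commutes_def)
    then have "x (gki * h * kp m) = inverse c * x (h * gki * kp m)"
      using uq_functional_cong2[OF xu, of "gki * h" _ 1 "kp m"] lin(2)[of "inverse c" "h * gki * kp m"]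
      by (simp add: mult.assoc)
    also have "x (h * gki * kp m) = x (h * kp (m - 1))"
      using uq_functional_cong2[OF xu uq_eq_kp_add[of q "- 1" m], of h 1] by (simp add: kp_m1 mult.assoc)
    finally show ?thesis .
  qed
  obtain d' where d': "d = Suc d'" using d gr0_implies_Suc by blast
  have E_front: "\<exists>c. \<forall>m. x (word (replicate n GE @ GF # u2) * kp m) = c * x (word (replicate (Suc n) GE @ u2) * kp (m - 1))"
    if n: "n + length u2 = d'" and u2: "set u2 \<subseteq> {GE, GF}" for n u2
  proof -
    let ?w = "replicate (Suc n) GE @ u2"
    have "set ?w \<subseteq> {GE, GF}" using u2 by (auto dest: in_set_replicate[THEN iffD1])
    then obtain c where c: "k_commutes q c (word ?w)"
      using k_commutes_word[of ?w q] q0 by blast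
    have "x (word (replicate n GE @ GF # u2) * kp m) = inverse c * x (word ?w * kp (m - 1))" for m
    proof -
      have "x (word (replicate n GE @ GF # u2) * kp m) = x (word (GF # replicate n GE @ u2) * kp m)"
        by (rule front) (use n d' ef_degree_eq_length[OF u2] in simp)
      also have "\<dots> = x (gki * ge * word (replicate n GE @ u2) * kp m)"
        using left[of "replicate n GE @ u2" m] n d' ef_degree_eq_length[OF u2]
        by (simp add: word_Cons[of GF "replicate n GE @ u2"] word_simps)
      also have "\<dots> = x (gki * word ?w * kp m)"
        by (simp add: word_Cons[of GE "replicate n GE @ u2"] word_simps mult.assoc)
      also have "\<dots> = inverse c * x (word ?w * kp (m - 1))" by (rule Ki_move[OF c])
      finally show ?thesis .
    qed
    then show ?thesis by blast
  qed
  have E: "x (ge ^ d * kp m) = 0" for m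
  proof (rule kregular_vanish_int[OF q xk xu])
    fix m :: int assume "m \<ge> 0"
    have Ed: "k_commutes q ((of_real (q^2)) ^ d) (ge ^ d)"
      by (rule k_commutes_power[OF k_commutes_E[OF q0(1)]])
    have "x (gf * ge ^ d' * kp (m + 1)) = x (gki * ge ^ d * kp (m + 1))"
      using left[of "replicate d' GE" "m + 1"] d' by (simp add: word_replicate word_simps mult.assoc)
    also have "\<dots> = inverse (of_real (q^2) ^ d) * x (ge ^ d * kp m)"
      using Ki_move[OF Ed, of "m + 1"] by simp
    finally have A: "x (gf * ge ^ d' * kp (m + 1)) = inverse (of_real (q^2) ^ d) * x (ge ^ d * kp m)" .
    have "x (ge ^ d' * (kp (m + 1) * gf)) = of_real q powi (- 2 * (m + 1)) * x (ge ^ d' * gf * kp (m + 1))"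
      using uq_functional_cong2[OF xu uq_eq_kp_F[OF q0(1), of "m + 1"], of "ge ^ d'" 1]
      by (simp add: scal mult.assoc)
    moreover have "x (ge ^ d' * (kp (m + 1) * gf)) = x (ge ^ d' * kp (m + 1) * (gki * ge))"
      using right[of "replicate d' GE" "m + 1"] d' by (simp add: word_replicate word_simps mult.assoc)
    moreover have "\<dots> = x (ge ^ d' * kp m * ge)"
      using uq_functional_cong2[OF xu uq_eq_kp_Ki[of q "m + 1"], of "ge ^ d'" ge] by (simp add: mult.assoc)
    moreover have "\<dots> = of_real q powi (2 * m) * x (ge ^ d * kp m)"
      using uq_functional_cong2[OF xu uq_eq_kp_E[OF q0(1), of m], of "ge ^ d'" 1]
      by (simp add: scal mult.assoc d' power_commutes) (simp flip: mult.assoc add: power_commutes)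
    moreover have "x (ge ^ d' * gf * kp (m + 1)) = x (gf * ge ^ d' * kp (m + 1))"
      using front[of d' "[]" "m + 1"] d'
      by (simp add: word_append word_Cons[of GF "replicate _ _"] word_replicate word_simps)
    ultimately have "of_real q powi (2 * m) * x (ge ^ d * kp m)
      = of_real q powi (- 2 * (m + 1)) * (inverse (of_real (q^2) ^ d) * x (ge ^ d * kp m))"
      using A by simp
    \<comment> \<open>The exponents 2m and -2(m+1) - 2d coincide only at m = -(d+1)/2, which m >= 0
      excludes; \<open>kregular_vanish_int\<close> carries the result to the remaining m.\<close>
    moreover have "of_real q powi (2 * m) \<noteq> of_real q powi (- 2 * (m + 1)) * inverse (of_real (q^2) ^ d :: complex)"
    proof
      assume "of_real q powi (2 * m) = of_real q powi (- 2 * (m + 1)) * inverse (of_real (q^2) ^ d :: complex)"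
      then have "q powi (2 * m) = q powi (- 2 * (m + 1)) * inverse ((q^2) ^ d)"
        by (simp flip: of_real_power_int of_real_power of_real_inverse of_real_mult del: of_real_eq_iff add: of_real_eq_iff)
      also have "inverse ((q^2) ^ d) = q powi (- 2 * int d)"
        by (simp add: power_int_minus power_int_def nat_mult_distrib power_inverse flip: power_mult)
      also have "q powi (- 2 * (m + 1)) * q powi (- 2 * int d) = q powi (- 2 * (m + 1) - 2 * int d)"
        using q0 by (simp add: power_int_add flip: power_int_add)
      finally have "q powi (2 * m) = q powi (- 2 * (m + 1) - 2 * int d)" .
      moreover have "q powi (2 * m) < q powi (- 2 * (m + 1) - 2 * int d)"
        using q d \<open>m \<ge> 0\<close> by (intro power_int_strict_decreasing) auto
      ultimately show False by simp
    qed
    ultimately show "x (ge ^ d * kp m) = 0" by (metis (no_types, lifting) mult.assoc mult_cancel_right)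
  qed
  \<comment> \<open>Induction on the number of letters f: the first of them has only letters e
    before it and becomes e by \<open>E_front\<close>.\<close>
  have "x (word u * kp m) = 0" if "set u \<subseteq> {GE, GF}" "length u = d" "count_list u GF = n" for u n m
    using that
  proof (induction n arbitrary: u m)
    case 0
    then have "set u \<subseteq> {GE}" by (auto simp: count_list_0_iff)
    then have "u = replicate d GE" using 0(2) by (metis replicate_eqI singletonD subsetD)
    then show ?case using E by (simp add: word_replicate word_simps)
  next
    case (Suc n)
    then have "GF \<in> set u" by (metis count_notin nat.distinct(1))
    then obtain u1 u2 where u: "u = u1 @ GF # u2" "GF \<notin> set u1" by (meson split_list_first)
    have "set u1 \<subseteq> {GE}" using Suc.prems(1) u by auto
    then have u1: "u1 = replicate (length u1) GE" by (metis replicate_eqI singletonD subsetD)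
    have "length u1 + length u2 = d'" "set u2 \<subseteq> {GE, GF}" using Suc.prems u d' by auto
    then obtain c where "x (word (replicate (length u1) GE @ GF # u2) * kp m)
        = c * x (word (replicate (Suc (length u1)) GE @ u2) * kp (m - 1))"
      using E_front by blast
    then have "x (word (u1 @ GF # u2) * kp m) = c * x (word (GE # u1 @ u2) * kp (m - 1))"
      by (simp flip: u1)
    moreover have "x (word (GE # u1 @ u2) * kp (m - 1)) = 0"
      using Suc.prems u by (intro Suc.IH) auto
    ultimately show ?case using u by simp
  qed
  then show ?thesis using u by blast
qed

theorem biinvariant_eq_0:
  assumes q: "0 < q" "q < 1" and x: "biinvariant q a x" and 0: "\<And>m. x (gk ^ m) = 0"
  shows "x h = 0"
proof -
  have xu: "uq_functional q x" and xk: "kregular q x" using x by (auto simp: biinvariant_def)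
  have xl: "func_linear x" using xu by (simp add: uq_functional_def)
  have K: "x (kp m) = 0" for m
    using kregular_vanish_int[OF q xk xu, of 0 1 m] 0 by (metis kp_of_nat mult_1 zero_le_imp_eq_int)
  have "x (word w) = 0" for w
  proof (induction "ef_degree w" arbitrary: w rule: less_induct)
    case less
    obtain u c m where u: "set u \<subseteq> {GE, GF}" "length u = ef_degree w" "uq_eq q (word w) (scal c * word u * kp m)"
      using word_normal_form[of q w] q by auto
    have "x (word u * kp m) = 0"
    proof (cases "ef_degree w = 0")
      case True
      then show ?thesis using u K by simp
    next
      case False
      show ?thesis
        by (rule biinvariant_eq_0_step[OF q x _ _ u(1,2)]) (use False less in auto)
    qed
    then show ?case using uq_functional_cong[OF xu u(3)] by (simp add: mult.assoc func_linearD[OF xl])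
  qed
  then show ?thesis
  proof (induction h rule: falg_induct)
    case (single w c)
    then show ?case by (simp add: func_linear_single[OF xl, of w c])
  qed (simp add: func_linearD[OF xl])
qed

section \<open>The radial part of the Casimir element\<close>

text \<open>In base p = Q^2 with parameters A, B, Q, Q the Askey--Wilson coefficient is
  (1-Ay)(1-By)(1-Qy)^2 / ((1-y^2)(1-Q^2 y^2)). One factor 1 - Qy is cancelled here, and (1-Ay)(1-By)
  is written as (1+Qy)^2 + QTy, using AB = Q^2 and A + B = -Q(T+2); T stands for t^2.\<close>

definition aw_forward :: "complex \<Rightarrow> complex \<Rightarrow> complex \<Rightarrow> complex" where
  "aw_forward Q T y = (1 - Q * y) * ((1 + Q * y)^2 + Q * T * y) / ((1 - y^2) * (1 + Q * y))"

text \<open>The forward coefficient at 1/y (\<open>aw_backward_eq\<close>). The factor y - Q makes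
  it vanish at the first grid point.\<close>

definition aw_backward :: "complex \<Rightarrow> complex \<Rightarrow> complex \<Rightarrow> complex" where
  "aw_backward Q T y = (y - Q) * ((y + Q)^2 + Q * T * y) / ((y^2 - 1) * (y + Q))"

text \<open>
  The Askey--Wilson difference equation in base \<open>Q\<^sup>2\<close> on the points \<open>y = Q\<^bsup>2m+1\<^esup>\<close>.  At \<open>m = 0\<close> the
  backward coefficient vanishes, so the junk value \<open>f (0 - 1)\<close> is harmless.
\<close>

definition aw_equation :: "complex \<Rightarrow> complex \<Rightarrow> complex \<Rightarrow> (nat \<Rightarrow> complex) \<Rightarrow> bool" where
  "aw_equation Q T l f \<longleftrightarrow> (\<forall>m. aw_forward Q T (Q ^ (2 * m + 1)) * (f (m + 1) - f m)
      + aw_backward Q T (Q ^ (2 * m + 1)) * (f (m - 1) - f m) = l * f m)"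

text \<open>In base p = Q^2 this is the usual p^-n (1 - p^n)(1 - ABCD p^(n-1)) with ABCD =
  Q^4.\<close>

definition aw_eigenvalue :: "complex \<Rightarrow> nat \<Rightarrow> complex" where
  "aw_eigenvalue Q n = (inverse (Q ^ (2 * n)) - 1) * (1 - Q ^ (2 * n + 2))"

definition casimir :: "real \<Rightarrow> falg" where
  "casimir q = gf * ge + scal (of_real (inverse (q - inverse q)) ^ 2)
     * (scal (of_real q) * gk + scal (of_real (inverse q)) * gki)"

text \<open>The scalar by which the Casimir element acts in spin n/2
  (\<open>rep_casimir\<close>).\<close>

definition casimir_value :: "real \<Rightarrow> nat \<Rightarrow> complex" where
  "casimir_value q n = of_real (inverse (q - inverse q)) ^ 2 * (of_real q ^ (n + 1) + inverse (of_real q) ^ (n + 1))"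

text \<open>In the application Z = Q^(2M+2), N = Q^(2n), and p0, p1, p2 are the values at k^(M-1),
  k^M, k^(M+1). Multiplication by W = 1 - Z^2/Q^2 splits each coefficient into a part free of T and
  a multiple of T; the T-parts together form the right side of S.\<close>

lemma radial_algebra:
  fixes Q Z N T p0 p1 p2 :: complex
  assumes nz: "Q \<noteq> 0" "N \<noteq> 0" "1 + Z \<noteq> 0" "Q^2 + Z \<noteq> 0" "Q^2 \<noteq> Z^2"
    and S: "- Q * ((Z^2 / Q^2 - 1) * ((Q * N + 1 / (Q * N)) * p1 - Q * p2 - p0 / Q) - (p2 - p0) * (Q - 1 / Q))
       = T * (Z * (1 - Z) / (1 + Z) * (p2 - p1) - Z * (Q^2 - Z) / (Q^2 + Z) * (p1 - p0))"
  shows "aw_forward Q T (Z / Q) * (p2 - p1) + aw_backward Q T (Z / Q) * (p0 - p1)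
     = (1 / N - 1) * (1 - Q^2 * N) * p1"
proof -
  define W where "W = 1 - Z^2 / Q^2"
  have W: "W \<noteq> 0" using nz by (simp add: W_def field_simps)
  have a: "aw_forward Q T (Z / Q) * W = (1 - Z^2) + T * (Z * (1 - Z) / (1 + Z))"
  proof -
    have "aw_forward Q T (Z / Q) = (1 - Z) * ((1 + Z)^2 + T * Z) / (W * (1 + Z))"
      using nz by (simp add: aw_forward_def W_def power_divide)
    then have "aw_forward Q T (Z / Q) * W = (1 - Z) * ((1 + Z)^2 + T * Z) / (1 + Z)"
      using W by simp
    also have "\<dots> = (1 - Z^2) + T * (Z * (1 - Z) / (1 + Z))"
      using nz by (simp add: field_simps) algebra
    finally show ?thesis .
  qed
  have b: "aw_backward Q T (Z / Q) * W = (Q^2 - Z^2 / Q^2) + T * (Z * (Q^2 - Z) / (Q^2 + Z))"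
  proof -
    have ZQ: "Z / Q + Q = (Q^2 + Z) / Q" "Z / Q - Q = (Z - Q^2) / Q"
      using nz by (simp_all add: field_simps power2_eq_square)
    have "aw_backward Q T (Z / Q) = (Z / Q - Q) * ((Z / Q + Q)^2 + T * Z) / (- W * (Z / Q + Q))"
      using nz by (simp add: aw_backward_def W_def power_divide)
    then have "aw_backward Q T (Z / Q) * W = - ((Z / Q - Q) * ((Z / Q + Q)^2 + T * Z) / (Z / Q + Q))"
      using W by simp
    also have "\<dots> = (Q^2 - Z^2 / Q^2) + T * (Z * (Q^2 - Z) / (Q^2 + Z))"
    proof -
      have *: "- (u * (v^2 + w) / v) = - (u * v) - w * (u / v)" if "v \<noteq> 0" for u v w :: complex
        using that by (simp add: field_simps power2_eq_square)
      have v: "Z / Q + Q \<noteq> 0" unfolding ZQ using nz by simp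
      have "- ((Z / Q - Q) * ((Z / Q + Q)^2 + T * Z) / (Z / Q + Q))
          = - ((Z / Q - Q) * (Z / Q + Q)) - T * Z * ((Z / Q - Q) / (Z / Q + Q))"
        using *[OF v] .
      also have "(Z / Q - Q) / (Z / Q + Q) = - ((Q^2 - Z) / (Q^2 + Z))"
        unfolding ZQ using nz by (simp add: minus_divide_left)
      also have "(Z / Q - Q) * (Z / Q + Q) = Z^2 / Q^2 - Q^2"
        using nz by (simp add: field_simps power2_eq_square)
      finally show ?thesis by simp
    qed
    finally show ?thesis .
  qed
  have gen: "(A + T * U) * (p2 - p1) + (B + T * V) * (p0 - p1)
      = A * (p2 - p1) + B * (p0 - p1) + T * (U * (p2 - p1) - V * (p1 - p0))" for A B U V
    by (simp add: algebra_simps)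
  have "(aw_forward Q T (Z / Q) * (p2 - p1) + aw_backward Q T (Z / Q) * (p0 - p1)) * W
     = (aw_forward Q T (Z / Q) * W) * (p2 - p1) + (aw_backward Q T (Z / Q) * W) * (p0 - p1)"
    by (simp add: algebra_simps)
  also have "\<dots> = (1 - Z^2) * (p2 - p1) + (Q^2 - Z^2 / Q^2) * (p0 - p1)
       + T * (Z * (1 - Z) / (1 + Z) * (p2 - p1) - Z * (Q^2 - Z) / (Q^2 + Z) * (p1 - p0))"
    unfolding a b by (rule gen)
  also have "\<dots> = (1 / N - 1) * (1 - Q^2 * N) * p1 * W"
    unfolding S[symmetric] W_def using nz(1,2)
    by (simp add: field_simps power2_eq_square)
  finally show ?thesis using W by simp
qed

text \<open>The values at f k^j follow from those on powers of k. Left invariance and right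
  invariance at f k^(M+1), the commutator and the Casimir element give four linear equations for
  x(ff k^(M+1)), x(ef k^M) and x(fe k^M); eliminating these three leaves the difference equation at
  M.\<close>

lemma radial_part:
  assumes q: "0 < q" "q < 1" and x: "biinvariant q a x"
    and C: "\<And>g. x (casimir q * g) = casimir_value q (2 * n) * x g"
  shows "aw_equation (of_real q) (of_real ((tpar q a)^2)) (aw_eigenvalue (of_real q) n) (\<lambda>m. x (gk ^ m))"
proof -
  have xu: "uq_functional q x" and xR: "\<And>g. x (g * xel q a) = wt q a * x g"
    and xL: "\<And>g. x (xel q a * g) = wt q a * x g" using x by (auto simp: biinvariant_def)
  have xl: "func_linear x" using xu by (simp add: uq_functional_def)
  note lin = func_linearD[OF xl]
  have scal: "x (g * (scal c * h)) = c * x (g * h)" for g c h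
    using lin(2)[of c "g * h"] by (simp add: scal_commute[of g] flip: mult.assoc)
  note cong = uq_functional_cong2[OF xu]
  define Q where "Q = complex_of_real q"
  define \<kappa> where "\<kappa> = inverse (Q - inverse Q)"
  define t where "t = complex_of_real (tpar q a)"
  have q0: "q \<noteq> 0" "Q \<noteq> 0" using q by (auto simp: Q_def)
  have Q2: "Q - inverse Q \<noteq> 0"
  proof
    assume "Q - inverse Q = 0"
    then have "q = inverse q" by (metis Q_def eq_iff_diff_eq_0 of_real_eq_iff of_real_inverse)
    then show False using q by (metis less_irrefl one_less_inverse order_less_trans)
  qed
  have wt: "wt q a = \<kappa> * t"
    by (simp add: wt_def \<kappa>_def t_def Q_def qnum_def tpar_def divide_inverse mult.commute)
  define \<psi> where "\<psi> j = x (kp j)" for j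
  define F where "F j = x (gf * kp j)" for j
  have KF: "x (g * kp j * gf * h) = Q powi (- 2 * j) * x (g * gf * kp j * h)" for g h j
    using cong[OF uq_eq_kp_F[OF q0(1), of j], of g h] by (simp add: scal mult.assoc Q_def)
  have KE: "x (g * kp j * ge * h) = Q powi (2 * j) * x (g * ge * kp j * h)" for g h j
    using cong[OF uq_eq_kp_E[OF q0(1), of j], of g h] by (simp add: scal mult.assoc Q_def)
  have KK: "x (g * kp i * kp j * h) = x (g * kp (i + j) * h)" for g h i j
    using cong[OF uq_eq_kp_add[of q i j], of g h] by (simp add: mult.assoc)
  have xel: "x (xel q a * h) = rho q * (x (gf * h) - x (kp (-1) * ge * h)) + wt q a * x (kp (-1) * h)"
    "x (g * xel q a) = rho q * (x (g * gf) - x (g * kp (-1) * ge)) + wt q a * x (g * kp (-1))" for g h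
    by (simp_all add: xel_def kp_m1 distrib_right left_diff_distrib distrib_left right_diff_distrib mult.assoc lin scal)
  \<comment> \<open>Left and right invariance at k^j are two equations for F j and G = x(e k^(j-1)).
    Eliminating G leaves a factor 1 - Q^(2j), which is nonzero for j >= 1.\<close>
  have F: "rho q * (1 + Q powi (2 * j)) * F j = Q powi (2 * j) * wt q a * (\<psi> j - \<psi> (j - 1))" if "j \<ge> 1" for j
  proof -
    define G where "G = x (ge * kp (j - 1))"
    have "x (kp (-1) * ge * kp j) = Q powi (-2) * G"
      using KE[of 1 "-1" "kp j"] KK[of ge "-1" j 1] by (simp add: G_def)
    then have L: "rho q * (F j - Q powi (-2) * G) = wt q a * (\<psi> j - \<psi> (j - 1))"
      using xL[of "kp j"] KK[of 1 "-1" j 1] unfolding xel by (simp add: F_def \<psi>_def algebra_simps)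
    have "x (kp j * gf) = Q powi (- 2 * j) * F j"
      using KF[of 1 j 1] by (simp add: F_def)
    moreover have "x (kp j * kp (-1) * ge) = Q powi (2 * j - 2) * G"
      using KE[of 1 "j - 1" 1] KK[of 1 j "-1" ge] by (simp add: G_def algebra_simps)
    ultimately have R: "rho q * (Q powi (- 2 * j) * F j - Q powi (2 * j - 2) * G) = wt q a * (\<psi> j - \<psi> (j - 1))"
      using xR[of "kp j"] KK[of 1 j "-1" 1] unfolding xel by (simp add: \<psi>_def algebra_simps)
    define Z where "Z = Q powi (2 * j)"
    have Z: "Z \<noteq> 0" "Q powi (- 2 * j) = inverse Z" "Q powi (2 * j - 2) = Z * Q powi (-2)"
      using q0 power_int_add[of Q "2 * j" "-2"] by (auto simp: Z_def simp flip: power_int_minus)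
    have "Z \<noteq> 1"
    proof
      assume "Z = 1"
      then have "q powi (2 * j) = q powi 0"
        unfolding Z_def Q_def by (metis of_real_1 of_real_eq_iff of_real_power_int power_int_0_right)
      moreover have "q powi (2 * j) < q powi 0" using q that by (intro power_int_strict_decreasing) auto
      ultimately show False by simp
    qed
    let ?w = "wt q a * (\<psi> j - \<psi> (j - 1))"
    have "(1 - Z) * (rho q * (1 + Z) * F j) = (1 - Z) * (Z * ?w)"
    proof -
      have "rho q * (inverse Z * F j - Z * F j) = rho q * (Q powi (- 2 * j) * F j - Q powi (2 * j - 2) * G)
          - Z * (rho q * (F j - Q powi (-2) * G))"
        unfolding Z(2,3) by (simp add: algebra_simps)
      then have "rho q * (inverse Z * F j - Z * F j) = ?w - Z * ?w" unfolding L R .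
      then have "Z * (rho q * (inverse Z * F j - Z * F j)) = Z * (?w - Z * ?w)" by simp
      moreover have "Z * (rho q * (inverse Z * F j - Z * F j)) = (1 - Z) * (rho q * (1 + Z) * F j)"
        using Z(1) by (simp add: field_simps)
      ultimately have "(1 - Z) * (rho q * (1 + Z) * F j) = Z * (?w - Z * ?w)" by (rule trans[OF sym, rotated])
      then show ?thesis by (simp add: algebra_simps)
    qed
    then have "rho q * (1 + Z) * F j = Z * ?w" using \<open>Z \<noteq> 1\<close> by simp
    then show ?thesis by (simp add: Z_def mult.assoc)
  qed
  have "aw_forward Q (t^2) (Q ^ (2 * M + 1)) * (x (gk ^ (M + 1)) - x (gk ^ M))
      + aw_backward Q (t^2) (Q ^ (2 * M + 1)) * (x (gk ^ (M - 1)) - x (gk ^ M)) = aw_eigenvalue Q n * x (gk ^ M)" for M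
  proof -
    define m where "m = int M + 1"
    define Z where "Z = Q ^ (2 * M + 2)"
    have Z: "Q powi (2 * m) = Z" "Q powi (- 2 * m) = inverse Z" "Q powi (2 * (m - 1)) = Z / Q^2" "Z \<noteq> 0"
    proof -
      show *: "Q powi (2 * m) = Z" unfolding Z_def m_def by (simp add: power_int_def nat_add_distrib nat_mult_distrib)
      then show "Q powi (- 2 * m) = inverse Z" by (simp add: power_int_minus)
      show "Q powi (2 * (m - 1)) = Z / Q^2" using * q0 power_int_diff[of Q "2 * m" 2] by (simp add: algebra_simps)
      show "Z \<noteq> 0" using q0 by (simp add: Z_def)
    qed
    define FF EF FE where "FF = x (gf * gf * kp m)" and "EF = x (ge * gf * kp (m - 1))" and "FE = x (gf * ge * kp (m - 1))"
    have 1: "rho q * (FF - EF) = wt q a * (F m - Q^2 * F (m - 1))"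
    proof -
      have "x (kp (-1) * ge * (gf * kp m)) = Q powi (-2) * (Q powi 2 * EF)"
        using KE[of 1 "-1" "gf * kp m"] KF[of ge "-1" "kp m"] KK[of "ge * gf" "-1" m 1]
        by (simp add: EF_def mult.assoc)
      then have "x (kp (-1) * ge * (gf * kp m)) = EF" using q0 by (simp add: power_int_minus flip: mult.assoc)
      moreover have "x (kp (-1) * (gf * kp m)) = Q^2 * F (m - 1)"
        using KF[of 1 "-1" "kp m"] KK[of gf "-1" m 1] by (simp add: F_def mult.assoc)
      ultimately show ?thesis
        using xL[of "gf * kp m"] unfolding xel by (simp add: FF_def F_def algebra_simps)
    qed
    have 2: "rho q * (inverse Z * FF - Z / Q^2 * FE) = wt q a * (F m - F (m - 1))"
    proof -
      have "x (gf * kp m * gf) = inverse Z * FF"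
        using KF[of gf m 1] Z(2) by (simp add: FF_def)
      moreover have "x (gf * kp m * kp (-1) * ge) = Z / Q^2 * FE"
        using KE[of gf "m - 1" 1] KK[of gf m "-1" ge] Z(3) by (simp add: FE_def)
      moreover have "x (gf * kp m * kp (-1)) = F (m - 1)"
        using KK[of gf m "-1" 1] by (simp add: F_def)
      ultimately show ?thesis
        using xR[of "gf * kp m"] unfolding xel by (simp add: F_def algebra_simps)
    qed
    have 3: "EF = FE + \<kappa> * (\<psi> m - \<psi> (m - 2))"
      using uq_functional_rules(5)[OF xu, of 1 "kp (m - 1)"] KK[of 1 1 "m - 1" 1] KK[of 1 "-1" "m - 1" 1]
      by (simp add: EF_def FE_def \<kappa>_def Q_def \<psi>_def kp_1 kp_m1)
    define N where "N = Q ^ (2 * n)"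
    have N0: "N \<noteq> 0" using q0 by (simp add: N_def)
    have cv: "casimir_value q (2 * n) = \<kappa>^2 * (Q * N + 1 / (Q * N))"
      by (simp add: casimir_value_def \<kappa>_def Q_def N_def divide_inverse power_inverse)
    have 4: "FE = \<kappa>^2 * ((Q * N + 1 / (Q * N)) * \<psi> (m - 1) - Q * \<psi> m - \<psi> (m - 2) / Q)"
    proof -
      have "x (casimir q * kp (m - 1)) = FE + \<kappa>^2 * (Q * \<psi> m + inverse Q * \<psi> (m - 2))"
        using KK[of 1 1 "m - 1" 1] KK[of 1 "-1" "m - 1" 1]
        by (simp add: casimir_def distrib_right mult.assoc lin FE_def \<kappa>_def Q_def \<psi>_def kp_1 kp_m1)
      then show ?thesis using C[of "kp (m - 1)"] unfolding cv
        by (simp add: \<psi>_def algebra_simps divide_inverse)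
    qed
    have nz: "1 + Z \<noteq> 0" "Q^2 + Z \<noteq> 0" "Q^2 \<noteq> Z^2"
    proof -
      have Zr: "Z = of_real (q ^ (2 * M + 2))" by (simp add: Z_def Q_def)
      have "1 + Z = of_real (1 + q ^ (2 * M + 2))" by (simp add: Zr)
      moreover have "1 + q ^ (2 * M + 2) > 0" using q by (simp add: add_pos_pos)
      ultimately show "1 + Z \<noteq> 0" by (metis less_irrefl of_real_eq_0_iff)
      have "Q^2 + Z = of_real (q^2 + q ^ (2 * M + 2))" by (simp add: Zr Q_def)
      moreover have "q^2 + q ^ (2 * M + 2) > 0" using q by (simp add: add_pos_pos)
      ultimately show "Q^2 + Z \<noteq> 0" by (metis less_irrefl of_real_eq_0_iff)
      have "q ^ (4 * M + 4) < q ^ 2" using q by (intro power_strict_decreasing) auto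
      moreover have "(q ^ (2 * M + 2))^2 = q ^ (4 * M + 4)"
        unfolding power_mult[symmetric] by (rule arg_cong[where f = "power q"]) simp
      then have "Z^2 = of_real (q ^ (4 * M + 4))" unfolding Zr by (metis of_real_power)
      ultimately show "Q^2 \<noteq> Z^2" unfolding Q_def by (metis less_irrefl of_real_eq_iff of_real_power)
    qed
    have Fm: "rho q * F m = Z / (1 + Z) * (wt q a * (\<psi> m - \<psi> (m - 1)))"
      using F[of m] nz(1) unfolding Z by (simp add: m_def field_simps)
    \<comment> \<open>At M = 0 this concerns F 0, which the formula above does not cover; there Q^2
      - Z = 0 and both sides vanish.\<close>
    have Fm1: "rho q * F (m - 1) * (Q^2 - Z) = Z * (Q^2 - Z) / (Q^2 + Z) * (wt q a * (\<psi> (m - 1) - \<psi> (m - 2)))"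
    proof (cases "M = 0")
      case True
      then show ?thesis by (simp add: Z_def power2_eq_square)
    next
      case False
      have e: "Q\<^sup>2 * (1 + Z / Q^2) = Q\<^sup>2 + Z" using q0 by (simp add: field_simps)
      have "rho q * (1 + Z / Q^2) * F (m - 1) = Z / Q^2 * wt q a * (\<psi> (m - 1) - \<psi> (m - 2))"
        using F[of "m - 1"] False unfolding Z by (simp add: m_def)
      then have "Q^2 * (rho q * (1 + Z / Q^2) * F (m - 1)) = Q^2 * (Z / Q^2 * wt q a * (\<psi> (m - 1) - \<psi> (m - 2)))" by simp
      then have "(Q^2 + Z) * (rho q * F (m - 1)) = Z * (wt q a * (\<psi> (m - 1) - \<psi> (m - 2)))"
        unfolding e[symmetric] using q0 by (simp add: mult_ac)
      then have "rho q * F (m - 1) = Z / (Q^2 + Z) * (wt q a * (\<psi> (m - 1) - \<psi> (m - 2)))"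
        using nz(2) by (simp add: field_simps)
      then show ?thesis by simp
    qed
    have r2: "rho q * rho q = - Q" using rho_sq[OF q(1)] by (simp add: Q_def)
    have "rho q * (- EF + Z^2 / Q^2 * FE) = rho q * (FF - EF) - Z * (rho q * (inverse Z * FF - Z / Q^2 * FE))"
      using Z(4) by (simp add: algebra_simps power2_eq_square)
    also have "\<dots> = wt q a * (F m * (1 - Z) - F (m - 1) * (Q^2 - Z))"
      unfolding 1 2 by (simp add: algebra_simps)
    finally have "rho q * (rho q * (- EF + Z^2 / Q^2 * FE))
        = rho q * (wt q a * (F m * (1 - Z) - F (m - 1) * (Q^2 - Z)))" by simp
    also have "\<dots> = wt q a * ((rho q * F m) * (1 - Z) - (rho q * F (m - 1) * (Q^2 - Z)))"
      by (simp add: algebra_simps)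
    also have "\<dots> = \<kappa>^2 * (t^2 * (Z * (1 - Z) / (1 + Z) * (\<psi> m - \<psi> (m - 1))
        - Z * (Q^2 - Z) / (Q^2 + Z) * (\<psi> (m - 1) - \<psi> (m - 2))))"
    proof -
      have gen: "(k * t) * ((U * ((k * t) * d1)) * W - V * ((k * t) * d2)) = k^2 * (t^2 * (U * W * d1 - V * d2))"
        for k t U W V d1 d2 :: complex by (simp add: algebra_simps power2_eq_square)
      have "Z * (1 - Z) / (1 + Z) = Z / (1 + Z) * (1 - Z)" by simp
      then show ?thesis unfolding Fm Fm1 wt by (simp only: gen)
    qed
    finally have 5: "- Q * (- EF + Z^2 / Q^2 * FE) = \<dots>" using r2 by (simp flip: mult.assoc)
    have \<kappa>: "\<kappa> \<noteq> 0" "\<kappa> = \<kappa>^2 * (Q - 1 / Q)"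
      using Q2 by (simp_all add: \<kappa>_def power2_eq_square divide_inverse)
    have "- Q * (- EF + Z^2 / Q^2 * FE) = - Q * ((Z^2 / Q^2 - 1) * FE - \<kappa> * (\<psi> m - \<psi> (m - 2)))"
      unfolding 3 by (simp add: algebra_simps)
    also have "\<dots> = - Q * ((Z^2 / Q^2 - 1) * FE - \<kappa>^2 * (Q - 1 / Q) * (\<psi> m - \<psi> (m - 2)))"
      using \<kappa>(2) by simp
    also have "\<dots> = \<kappa>^2 * (- Q * ((Z^2 / Q^2 - 1) * ((Q * N + 1 / (Q * N)) * \<psi> (m - 1) - Q * \<psi> m - \<psi> (m - 2) / Q)
        - (\<psi> m - \<psi> (m - 2)) * (Q - 1 / Q)))"
    proof -
      have gen: "- Q * (A * (k * B) - k * C * D) = k * (- Q * (A * B - D * C))" for A B C D k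
        by (simp add: algebra_simps)
      show ?thesis unfolding 4 by (rule gen)
    qed
    finally have S: "- Q * ((Z^2 / Q^2 - 1) * ((Q * N + 1 / (Q * N)) * \<psi> (m - 1) - Q * \<psi> m - \<psi> (m - 2) / Q)
        - (\<psi> m - \<psi> (m - 2)) * (Q - 1 / Q)) = t^2 * (Z * (1 - Z) / (1 + Z) * (\<psi> m - \<psi> (m - 1))
        - Z * (Q^2 - Z) / (Q^2 + Z) * (\<psi> (m - 1) - \<psi> (m - 2)))"
      unfolding 5 using \<kappa>(1) by (metis (no_types) mult_left_cancel power_not_zero)
    have y: "Z / Q = Q ^ (2 * M + 1)" using q0 by (simp add: Z_def)
    have l: "(1 / N - 1) * (1 - Q^2 * N) = aw_eigenvalue Q n"
      by (simp add: aw_eigenvalue_def N_def divide_inverse power_add power2_eq_square mult.commute)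
    have p: "\<psi> m = x (gk ^ (M + 1))" "\<psi> (m - 1) = x (gk ^ M)"
      using kp_of_nat[of "M + 1"] kp_of_nat[of M] by (simp_all add: \<psi>_def m_def add.commute)
    \<comment> \<open>At M = 0 the derivation produces the value at k^-1, whereas natural
      subtraction yields k^0; the coefficient is zero at y = Q.\<close>
    have p0: "aw_backward Q (t^2) (Q ^ (2 * M + 1)) * (\<psi> (m - 2) - \<psi> (m - 1))
        = aw_backward Q (t^2) (Q ^ (2 * M + 1)) * (x (gk ^ (M - 1)) - x (gk ^ M))"
    proof (cases "M = 0")
      case True
      then show ?thesis by (simp add: aw_backward_def)
    next
      case False
      then have "m - 2 = int (M - 1)" by (simp add: m_def)
      then have "\<psi> (m - 2) = x (gk ^ (M - 1))" by (simp only: \<psi>_def kp_of_nat)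
      then show ?thesis by (simp add: p)
    qed
    show ?thesis
      using radial_algebra[OF q0(2) N0 nz S] unfolding y l p0[unfolded p] p .
  qed
  then show ?thesis by (simp add: aw_equation_def Q_def t_def)
qed

section \<open>Askey--Wilson polynomials\<close>

definition aw_basis :: "complex \<Rightarrow> complex \<Rightarrow> nat \<Rightarrow> complex \<Rightarrow> complex" where
  "aw_basis p A k y = qpoch (A * y) p k * qpoch (A / y) p k"

lemma qpoch_Suc: "qpoch x p (Suc k) = qpoch x p k * (1 - x * p ^ k)"
  by (simp add: qpoch_def)

lemma qpoch_Suc_shift: "qpoch x p (Suc k) = (1 - x) * qpoch (x * p) p k"
  unfolding qpoch_def prod.lessThan_Suc_shift by (simp add: mult_ac)

lemma aw_basis_inverse: "aw_basis p A k (1 / y) = aw_basis p A k y"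
  by (simp add: aw_basis_def)

lemma aw_basis_Suc: "aw_basis p A (Suc k) y = aw_basis p A k y * ((1 - A * p ^ k * y) * (1 - A * p ^ k / y))"
  by (simp add: aw_basis_def qpoch_Suc mult_ac)

lemma aw_backward_eq: "y \<noteq> 0 \<Longrightarrow> aw_backward Q T y = aw_forward Q T (1 / y)"
proof -
  assume y: "y \<noteq> 0"
  have e: "1 - Q * (1 / y) = (y - Q) / y" "1 + Q * (1 / y) = (y + Q) / y" "1 - (1 / y)^2 = (y^2 - 1) / y^2"
    using y by (simp_all add: field_simps)
  have "aw_forward Q T (1 / y) = ((y - Q) / y) * (((y + Q)^2 + Q * T * y) / y^2) / (((y^2 - 1) / y^2) * ((y + Q) / y))"
  proof -
    have "((y + Q) / y)^2 + Q * T * (1 / y) = ((y + Q)^2 + Q * T * y) / y^2"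
      using y by (simp add: field_simps power2_eq_square)
    then show ?thesis unfolding aw_forward_def e by simp
  qed
  also have "\<dots> = ((y - Q) * ((y + Q)^2 + Q * T * y) / y^3) / ((y^2 - 1) * (y + Q) / y^3)"
    by (simp add: power3_eq_cube power2_eq_square)
  also have "\<dots> = aw_backward Q T y" using y by (simp add: aw_backward_def)
  finally show ?thesis by simp
qed

text \<open>Replacing y by Q^2 y changes only outer factors of the two shifted factorials, so
  \<open>R1 * R2\<close> is common to both values. The difference carries (1 - Qy)(1 + Qy), which
  cancels the denominator 1 + Qy.\<close>

lemma aw_forward_basis:
  assumes y: "y \<noteq> 0" "1 + Q * y \<noteq> 0" "y^2 \<noteq> 1" and Q: "Q \<noteq> 0"
    and AB: "A * B = Q^2" "A + B = - Q * (T + 2)"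
  shows "aw_forward Q T y * (aw_basis (Q^2) A (Suc k) (Q^2 * y) - aw_basis (Q^2) A (Suc k) y)
    = - A * (1 - Q^2 * (Q^2) ^ k) / Q^2 * ((1 - Q * y)^2 * (1 - B * y) * (1 - A * (Q^2) ^ k * y) / (y * (1 - y^2)))
      * aw_basis (Q^2) A k y"
proof -
  define p where "p = Q^2"
  define r where "r = p ^ k"
  have p: "p \<noteq> 0" using Q by (simp add: p_def)
  define R1 R2 where "R1 = qpoch (A * y * p) p k" and "R2 = qpoch (A / y) p k"
  have b1: "aw_basis p A (Suc k) (p * y) = (R1 * (1 - A * r * p * y)) * ((1 - A / (p * y)) * R2)"
  proof -
    have "qpoch (A * (p * y)) p (Suc k) = R1 * (1 - A * r * p * y)"
      by (simp add: qpoch_Suc R1_def r_def mult_ac)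
    moreover have "qpoch (A / (p * y)) p (Suc k) = (1 - A / (p * y)) * R2"
      using p by (simp add: qpoch_Suc_shift R2_def)
    ultimately show ?thesis by (simp add: aw_basis_def)
  qed
  have b2: "aw_basis p A (Suc k) y = ((1 - A * y) * R1) * (R2 * (1 - A * r / y))"
  proof -
    have "qpoch (A * y) p (Suc k) = (1 - A * y) * R1" by (simp add: qpoch_Suc_shift R1_def mult_ac)
    moreover have "qpoch (A / y) p (Suc k) = R2 * (1 - A * r / y)" by (simp add: qpoch_Suc R2_def r_def)
    ultimately show ?thesis by (simp add: aw_basis_def)
  qed
  have b3: "(1 - A * y) * R1 * R2 = (1 - A * r * y) * aw_basis p A k y"
  proof -
    have "(1 - A * y) * R1 = qpoch (A * y) p k * (1 - A * r * y)"
      unfolding R1_def qpoch_Suc_shift[symmetric] by (simp add: qpoch_Suc r_def mult_ac)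
    then show ?thesis by (simp add: aw_basis_def R2_def)
  qed
  have d: "aw_basis p A (Suc k) (p * y) - aw_basis p A (Suc k) y
      = - A * (1 - p * r) / p * ((1 - Q * y) * (1 + Q * y) / y) * (R1 * R2)"
  proof -
    have "(1 - A * r * p * y) * (1 - A / (p * y)) - (1 - A * y) * (1 - A * r / y)
        = - A * (1 - p * r) / p * ((1 - Q * y) * (1 + Q * y) / y)"
      using y(1) p Q by (simp add: p_def field_simps power2_eq_square)
    moreover have "aw_basis p A (Suc k) (p * y) - aw_basis p A (Suc k) y
      = ((1 - A * r * p * y) * (1 - A / (p * y)) - (1 - A * y) * (1 - A * r / y)) * (R1 * R2)"
      unfolding b1 b2 by (simp add: algebra_simps)
    ultimately show ?thesis by simp
  qed
  have f: "aw_forward Q T y * ((1 - Q * y) * (1 + Q * y)) = (1 - Q * y)^2 * (1 - B * y) * (1 - A * y) / (1 - y^2)"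
  proof -
    have "(1 + Q * y)^2 + Q * T * y = (1 - A * y) * (1 - B * y)"
      using AB by (simp add: power2_eq_square) algebra
    then have "aw_forward Q T y = (1 - Q * y) * ((1 - A * y) * (1 - B * y)) / ((1 - y^2) * (1 + Q * y))"
      by (simp add: aw_forward_def)
    then show ?thesis using y(2) by (simp add: power2_eq_square)
  qed
  have "aw_forward Q T y * (aw_basis p A (Suc k) (p * y) - aw_basis p A (Suc k) y)
      = - A * (1 - p * r) / p * ((aw_forward Q T y * ((1 - Q * y) * (1 + Q * y))) / y) * (R1 * R2)"
    unfolding d by simp
  also have "\<dots> = - A * (1 - p * r) / p * ((1 - Q * y)^2 * (1 - B * y) / (y * (1 - y^2))) * ((1 - A * y) * R1 * R2)"
    unfolding f by (simp add: mult_ac)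
  also have "\<dots> = - A * (1 - p * r) / p * ((1 - Q * y)^2 * (1 - B * y) * (1 - A * r * y) / (y * (1 - y^2)))
      * aw_basis p A k y"
    unfolding b3 by simp
  finally show ?thesis by (simp add: p_def r_def)
qed

text \<open>The backward half is the forward half at 1/y. In the sum the pole at y^2 = 1 disappears,
  and the operator sends the basis element of degree k + 1 to a combination of degrees k + 1 and
  k.\<close>

lemma aw_basis_equation:
  assumes y: "y \<noteq> 0" "1 + Q * y \<noteq> 0" "y + Q \<noteq> 0" "y^2 \<noteq> 1" and Q: "Q \<noteq> 0"
    and AB: "A * B = Q^2" "A + B = - Q * (T + 2)"
  shows "aw_forward Q T y * (aw_basis (Q^2) A (Suc k) (Q^2 * y) - aw_basis (Q^2) A (Suc k) y)
      + aw_backward Q T y * (aw_basis (Q^2) A (Suc k) (y / Q^2) - aw_basis (Q^2) A (Suc k) y)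
    = aw_eigenvalue Q (Suc k) * aw_basis (Q^2) A (Suc k) y
      - (1 - Q^2 * (Q^2) ^ k)^2 * (1 - A * Q * (Q^2) ^ k)^2 / (Q^2 * (Q^2) ^ k) * aw_basis (Q^2) A k y"
proof -
  define r where "r = (Q^2) ^ k"
  have r: "r \<noteq> 0" using Q by (simp add: r_def)
  let ?\<phi> = "aw_basis (Q^2) A k y"
  let ?G = "\<lambda>y. (1 - Q * y)^2 * (1 - B * y) * (1 - A * r * y) / (y * (1 - y^2))"
  have y': "1 - y^2 \<noteq> 0" using y(4) by simp
  have f: "aw_forward Q T y * (aw_basis (Q^2) A (Suc k) (Q^2 * y) - aw_basis (Q^2) A (Suc k) y)
     = - A * (1 - Q^2 * r) / Q^2 * ?G y * ?\<phi>"
    using aw_forward_basis[OF y(1,2,4) Q AB, of k] by (simp add: r_def)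
  have "aw_forward Q T (1 / y) * (aw_basis (Q^2) A (Suc k) (Q^2 * (1 / y)) - aw_basis (Q^2) A (Suc k) (1 / y))
     = - A * (1 - Q^2 * r) / Q^2 * ?G (1 / y) * aw_basis (Q^2) A k (1 / y)"
    using aw_forward_basis[OF _ _ _ Q AB, of "1 / y" k] y by (simp add: r_def field_simps)
  moreover have "aw_basis (Q^2) A (Suc k) (Q^2 * (1 / y)) = aw_basis (Q^2) A (Suc k) (y / Q^2)"
    using aw_basis_inverse[of "Q^2" A "Suc k" "y / Q^2"] by simp
  ultimately have b: "aw_backward Q T y * (aw_basis (Q^2) A (Suc k) (y / Q^2) - aw_basis (Q^2) A (Suc k) y)
     = - A * (1 - Q^2 * r) / Q^2 * ?G (1 / y) * ?\<phi>"
    by (simp only: aw_basis_inverse aw_backward_eq[OF y(1)])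
  have G': "?G (1 / y) = - ((y - Q)^2 * (y - B) * (y - A * r) / (y * (1 - y^2)))"
  proof -
    have e: "1 - Q * (1 / y) = (y - Q) / y" "1 - B * (1 / y) = (y - B) / y" "1 - A * r * (1 / y) = (y - A * r) / y"
      "1 - (1 / y)^2 = - ((1 - y^2) / y^2)"
      using y(1) by (simp_all add: field_simps)
    have "?G (1 / y) = - (((y - Q)^2 * (y - B) * (y - A * r) / y^4) / ((1 - y^2) / y^3))"
      unfolding e by (simp add: power2_eq_square power3_eq_cube power4_eq_xxxx)
    also have "((y - Q)^2 * (y - B) * (y - A * r) / y^4) / ((1 - y^2) / y^3) = (y - Q)^2 * (y - B) * (y - A * r) / (y * (1 - y^2))"
      using y(1) by (simp add: power4_eq_xxxx power3_eq_cube)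
    finally show ?thesis .
  qed
  \<comment> \<open>The combined numerator is divisible by 1 - y^2. The quotient is split into the
    factor that extends \<open>aw_basis\<close> from k to k + 1 and a constant.\<close>
  have key: "- A * r * (?G y + ?G (1 / y)) = (1 - Q^4 * r) * ((1 - A * r * y) * (1 - A * r / y)) - (1 - Q^2 * r) * (1 - A * Q * r)^2"
  proof -
    have "- A * r * ((1 - Q * y)^2 * (1 - B * y) * (1 - A * r * y) - (y - Q)^2 * (y - B) * (y - A * r))
      = (1 - y^2) * ((1 - Q^4 * r) * (1 - A * r * y) * (y - A * r) - (1 - Q^2 * r) * (1 - A * Q * r)^2 * y)"
      using AB(1) by algebra
    then have "- A * r * ((1 - Q * y)^2 * (1 - B * y) * (1 - A * r * y) - (y - Q)^2 * (y - B) * (y - A * r)) / (y * (1 - y^2))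
      = ((1 - Q^4 * r) * (1 - A * r * y) * (y - A * r) - (1 - Q^2 * r) * (1 - A * Q * r)^2 * y) / y"
      using y' y(1) by simp
    also have "\<dots> = (1 - Q^4 * r) * ((1 - A * r * y) * ((y - A * r) / y)) - (1 - Q^2 * r) * (1 - A * Q * r)^2"
    proof -
      have gen: "(a * b * c - d * y) / y = a * (b * (c / y)) - d" for a b c d
        using y(1) by (simp add: diff_divide_distrib)
      show ?thesis by (rule gen)
    qed
    also have "(y - A * r) / y = 1 - A * r / y" using y(1) by (simp add: diff_divide_distrib)
    finally have K: "- A * r * ((1 - Q * y)^2 * (1 - B * y) * (1 - A * r * y) - (y - Q)^2 * (y - B) * (y - A * r)) / (y * (1 - y^2))
      = (1 - Q^4 * r) * ((1 - A * r * y) * (1 - A * r / y)) - (1 - Q^2 * r) * (1 - A * Q * r)^2" .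
    have "- A * r * (?G y + ?G (1 / y))
        = - A * r * ((1 - Q * y)^2 * (1 - B * y) * (1 - A * r * y) - (y - Q)^2 * (y - B) * (y - A * r)) / (y * (1 - y^2))"
    proof -
      have gen: "c * (u / d + - (v / d)) = c * (u - v) / d" for c u v d :: complex
        by (simp add: diff_divide_distrib right_diff_distrib)
      show ?thesis unfolding G' by (rule gen)
    qed
    then show ?thesis unfolding K .
  qed
  have ev: "aw_eigenvalue Q (Suc k) = (1 - Q^2 * r) / (Q^2 * r) * (1 - Q^4 * r)"
  proof -
    have "Q ^ (2 * Suc k) = Q^2 * r" by (simp add: r_def power2_eq_square power_mult)
    moreover have "Q ^ (2 * Suc k + 2) = Q^4 * r"
      by (simp add: r_def power2_eq_square power4_eq_xxxx power_mult)
    moreover have "inverse (Q^2 * r) - 1 = (1 - Q^2 * r) / (Q^2 * r)"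
      using Q r by (simp add: diff_divide_distrib inverse_eq_divide)
    ultimately show ?thesis by (simp only: aw_eigenvalue_def)
  qed
  have "aw_forward Q T y * (aw_basis (Q^2) A (Suc k) (Q^2 * y) - aw_basis (Q^2) A (Suc k) y)
      + aw_backward Q T y * (aw_basis (Q^2) A (Suc k) (y / Q^2) - aw_basis (Q^2) A (Suc k) y)
    = (1 - Q^2 * r) / (Q^2 * r) * (- A * r * (?G y + ?G (1 / y))) * ?\<phi>"
  proof -
    have gen: "- A * W / p * G1 * \<phi> + - A * W / p * G2 * \<phi> = W / (p * r) * (- A * r * (G1 + G2)) * \<phi>"
      for W p G1 G2 \<phi> :: complex
    proof -
      have "W / (p * r) * (- A * r * (G1 + G2)) = - A * W / p * (G1 + G2)" using r by simp
      then show ?thesis by (simp only: distrib_left distrib_right)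
    qed
    show ?thesis unfolding f b by (rule gen)
  qed
  also have "\<dots> = aw_eigenvalue Q (Suc k) * aw_basis (Q^2) A (Suc k) y
      - (1 - Q^2 * r)^2 * (1 - A * Q * r)^2 / (Q^2 * r) * ?\<phi>"
  proof -
    have gen: "W / s * (E * Y - W * Z) * \<phi> = W / s * E * (\<phi> * Y) - W^2 * Z / s * \<phi>" for W s E Y Z \<phi> :: complex
      by (simp add: right_diff_distrib left_diff_distrib power2_eq_square mult_ac)
    show ?thesis unfolding key ev aw_basis_Suc r_def[symmetric] by (rule gen)
  qed
  finally show ?thesis by (simp add: r_def)
qed


lemma aw_equation_linear:
  assumes "aw_equation Q T l f" and "aw_equation Q T l g"
  shows "aw_equation Q T l (\<lambda>m. c * f m + d * g m)"
  unfolding aw_equation_def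
proof
  fix m
  let ?F = "aw_forward Q T (Q ^ (2 * m + 1))" and ?B = "aw_backward Q T (Q ^ (2 * m + 1))"
  have "?F * ((c * f (m + 1) + d * g (m + 1)) - (c * f m + d * g m))
      + ?B * ((c * f (m - 1) + d * g (m - 1)) - (c * f m + d * g m))
    = c * (?F * (f (m + 1) - f m) + ?B * (f (m - 1) - f m)) + d * (?F * (g (m + 1) - g m) + ?B * (g (m - 1) - g m))"
    by (simp add: algebra_simps)
  also have "\<dots> = l * (c * f m + d * g m)"
    using assms unfolding aw_equation_def by (simp add: algebra_simps)
  finally show "?F * ((c * f (m + 1) + d * g (m + 1)) - (c * f m + d * g m))
      + ?B * ((c * f (m - 1) + d * g (m - 1)) - (c * f m + d * g m)) = l * (c * f m + d * g m)" .
qed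

section \<open>Specialization to the parameters of the sphere and the grid y = q^(2m+1)\<close>

locale aw_params =
  fixes q a :: real
  assumes q: "0 < q" "q < 1"
begin

definition Q :: complex where "Q = of_real q"
definition T :: complex where "T = of_real ((tpar q a)^2)"
definition A :: complex where "A = of_real (- (q powr (- 2 * a + 1)))"
definition B :: complex where "B = of_real (- (q powr (2 * a + 1)))"

definition ypt :: "nat \<Rightarrow> complex" where "ypt m = Q ^ (2 * m + 1)"

lemma Q0: "Q \<noteq> 0" and A0: "A \<noteq> 0"
  using q by (auto simp: Q_def A_def)

lemma AB: "A * B = Q^2" "A + B = - Q * (T + 2)"
proof -
  have "q powr (- 2 * a + 1) * q powr (2 * a + 1) = q ^ 2"
    using q by (simp add: powr_numeral flip: powr_add)
  then show "A * B = Q^2" by (simp add: A_def B_def Q_def flip: of_real_mult of_real_power)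
  have "(q powr a)^2 = q powr (2 * a)" "(q powr (- a))^2 = q powr (- 2 * a)" "q powr a * q powr (- a) = 1"
    using q by (simp_all add: power2_eq_square flip: powr_add)
  then have "(tpar q a)^2 = q powr (2 * a) + q powr (- 2 * a) - 2"
    by (simp add: tpar_def power2_diff)
  moreover have "q powr (2 * a + 1) = q * q powr (2 * a)" "q powr (- 2 * a + 1) = q * q powr (- 2 * a)"
    using q powr_add[of q "2 * a" 1] powr_add[of q "- 2 * a" 1] by (simp_all only: powr_one mult.commute less_imp_le)
  ultimately have "q powr (- 2 * a + 1) + q powr (2 * a + 1) = q * ((tpar q a)^2 + 2)"
    by (simp add: algebra_simps)
  then have "- (q powr (- 2 * a + 1)) + - (q powr (2 * a + 1)) = - q * ((tpar q a)^2 + 2)" by simp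
  then have "complex_of_real (- (q powr (- 2 * a + 1)) + - (q powr (2 * a + 1))) = of_real (- q * ((tpar q a)^2 + 2))"
    by (rule arg_cong)
  then show "A + B = - Q * (T + 2)" unfolding A_def B_def Q_def T_def by simp
qed

lemma ypt_real: "ypt m = of_real (q ^ (2 * m + 1))"
  by (simp add: ypt_def Q_def)

lemma ypt_conditions: "ypt m \<noteq> 0" "1 + Q * ypt m \<noteq> 0" "ypt m + Q \<noteq> 0" "(ypt m)^2 \<noteq> 1" "1 - Q * ypt m \<noteq> 0"
proof -
  define y where "y = q ^ (2 * m + 1)"
  have y: "0 < y" "y < 1" using q power_Suc_less_one[of q "2 * m"] by (simp_all add: y_def)
  have yp: "ypt m = of_real y" by (simp add: ypt_real y_def)
  show "ypt m \<noteq> 0" using y by (simp add: yp)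
  have "1 + q * y > 0" "y + q > 0" using y q by (simp_all add: add_pos_pos)
  then show "1 + Q * ypt m \<noteq> 0" "ypt m + Q \<noteq> 0" unfolding yp Q_def
    by (metis less_irrefl of_real_0 of_real_1 of_real_add of_real_eq_iff of_real_mult)+
  have "y^2 \<noteq> 1" using y by (simp add: power2_eq_1_iff)
  then show "(ypt m)^2 \<noteq> 1" unfolding yp by (metis of_real_1 of_real_eq_iff of_real_power)
  have "q * y < 1" using y q by (metis mult_strict_mono mult_1 less_eq_real_def zero_less_one)
  then show "1 - Q * ypt m \<noteq> 0" unfolding yp Q_def
    by (metis eq_iff_diff_eq_0 less_irrefl of_real_1 of_real_eq_iff of_real_mult)
qed

lemma ypt_Suc: "ypt (m + 1) = Q^2 * ypt m"
  by (simp add: ypt_def power2_eq_square)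

lemma aw_forward_nonzero: "aw_forward Q T (ypt m) \<noteq> 0"
proof -
  have "(1 + q * q ^ (2 * m + 1))^2 + q * (tpar q a)^2 * q ^ (2 * m + 1) > 0"
    using q by (intro add_pos_nonneg zero_less_power) simp_all
  moreover have "(1 + Q * ypt m)^2 + Q * T * ypt m = of_real ((1 + q * q ^ (2 * m + 1))^2 + q * (tpar q a)^2 * q ^ (2 * m + 1))"
    by (simp add: Q_def T_def ypt_real)
  ultimately have "(1 + Q * ypt m)^2 + Q * T * ypt m \<noteq> 0" by (metis less_irrefl of_real_eq_0_iff)
  then show ?thesis using ypt_conditions[of m] by (simp add: aw_forward_def)
qed

text \<open>The forward coefficient never vanishes on the grid, so each value is determined by the
  earlier ones.\<close>

lemma aw_equation_zero:
  assumes "aw_equation Q T l h" and "h 0 = 0"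
  shows "h m = 0"
proof (induction m rule: less_induct)
  case (less m)
  show ?case
  proof (cases m)
    case (Suc k)
    have "aw_forward Q T (ypt k) * (h (k + 1) - h k) + aw_backward Q T (ypt k) * (h (k - 1) - h k) = l * h k"
      using assms(1) by (simp add: aw_equation_def ypt_def)
    then show ?thesis using less[of k] less[of "k - 1"] aw_forward_nonzero[of k] Suc by simp
  qed (use assms in simp)
qed

text \<open>A combination of the two solutions that vanishes at m = 0 vanishes everywhere. The
  cross-multiplied form covers vanishing initial values as well.\<close>

lemma aw_equation_unique:
  assumes "aw_equation Q T l f" and "aw_equation Q T l g"
  shows "f m * g 0 = g m * f 0"
  using aw_equation_zero[OF aw_equation_linear[OF assms, of "g 0" "- f 0"], of m]
  by (simp add: algebra_simps)

definition awb :: "nat \<Rightarrow> nat \<Rightarrow> complex" where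
  "awb k m = aw_basis (Q^2) A k (ypt m)"

definition aw_beta :: "nat \<Rightarrow> complex" where
  "aw_beta k = - ((1 - Q^2 * (Q^2) ^ k)^2 * (1 - A * Q * (Q^2) ^ k)^2 / (Q^2 * (Q^2) ^ k))"

lemma awb_0: "awb 0 m = 1"
  by (simp add: awb_def aw_basis_def qpoch_def)

lemma awb_equation:
  "aw_forward Q T (ypt m) * (awb (Suc k) (m + 1) - awb (Suc k) m)
    + aw_backward Q T (ypt m) * (awb (Suc k) (m - 1) - awb (Suc k) m)
   = aw_eigenvalue Q (Suc k) * awb (Suc k) m + aw_beta k * awb k m"
proof -
  have "aw_backward Q T (ypt m) * (awb (Suc k) (m - 1) - awb (Suc k) m)
      = aw_backward Q T (ypt m) * (aw_basis (Q^2) A (Suc k) (ypt m / Q^2) - aw_basis (Q^2) A (Suc k) (ypt m))"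
  \<comment> \<open>At m = 0 the point Q^-1 lies off the grid, but its coefficient is zero.\<close>
  proof (cases m)
    case 0
    then show ?thesis by (simp add: aw_backward_def ypt_def)
  next
    case (Suc m')
    then have "ypt m / Q^2 = ypt (m - 1)" using ypt_Suc[of m'] Q0 by simp
    then show ?thesis by (simp add: awb_def)
  qed
  then show ?thesis
    using aw_basis_equation[OF ypt_conditions(1-4)[of m] Q0 AB, of k]
    by (simp only: awb_def ypt_Suc aw_beta_def mult_minus_left add_uminus_conv_diff)
qed

text \<open>These turn out to be the values of u at k^m (\<open>sph_1_0_chi\<close>). With 2X = y +
  1/y this is the affine argument of P_n in the Askey--Wilson normalization.\<close>

definition chi :: "nat \<Rightarrow> complex" where
  "chi m = (ypt m + 1 / ypt m + of_real (inverse (q + inverse q) * (tpar q a)^2))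
      / of_real (q + inverse q + inverse (q + inverse q) * (tpar q a)^2)"

lemma chi_denom_pos: "q + inverse q + inverse (q + inverse q) * (tpar q a)^2 > 0"
  using q by (intro add_pos_nonneg) (auto simp: add_pos_pos)

lemma chi_0: "chi 0 = 1"
proof -
  have "ypt 0 + 1 / ypt 0 + of_real (inverse (q + inverse q) * (tpar q a)^2)
      = complex_of_real (q + inverse q + inverse (q + inverse q) * (tpar q a)^2)"
    by (simp add: ypt_def Q_def divide_inverse)
  then show ?thesis unfolding chi_def using chi_denom_pos by (metis divide_self less_irrefl of_real_eq_0_iff)
qed

lemma chi_equation: "aw_equation Q T (aw_eigenvalue Q 1) chi"
proof -
  define d where "d = complex_of_real (inverse (q + inverse q) * (tpar q a)^2)"
  define D where "D = complex_of_real (q + inverse q + inverse (q + inverse q) * (tpar q a)^2)"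
  have D0: "D \<noteq> 0" unfolding D_def using chi_denom_pos by (metis less_irrefl of_real_eq_0_iff)
  have "q + inverse q > 0" "1 + q^2 > 0" using q by (auto simp: add_pos_pos)
  then have "(1 + q^2) * (inverse (q + inverse q) * (tpar q a)^2) = q * (tpar q a)^2"
    using q by (simp add: field_simps power2_eq_square)
  then have "complex_of_real ((1 + q^2) * (inverse (q + inverse q) * (tpar q a)^2)) = of_real (q * (tpar q a)^2)"
    by (rule arg_cong)
  then have d: "(1 + Q^2) * d = Q * T" by (simp add: Q_def T_def d_def)
  have b1: "awb (Suc 0) m = 1 + A^2 - A * (ypt m + 1 / ypt m)" for m
    using ypt_conditions(1)[of m] by (simp add: awb_def aw_basis_def qpoch_def field_simps power2_eq_square)
  have chi: "chi m = (- 1 / (A * D)) * awb (Suc 0) m + ((1 + A^2) / A + d) / D" for m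
    unfolding chi_def d_def[symmetric] D_def[symmetric] b1 using A0 D0 by (simp add: field_simps)
  \<comment> \<open>An affine function of \<open>awb 1\<close> is an eigenfunction only for one
    constant term; this condition holds for the d with (1 + Q^2) d = Q T.\<close>
  have "aw_eigenvalue Q 1 * (1 + A^2 + A * d) + aw_beta 0 = 0"
  proof -
    have "(1 - A * Q)^2 = (1 + Q^2) * (1 + A^2) + A * ((1 + Q^2) * d)"
      unfolding d using AB by algebra
    then have e: "(1 - A * Q)^2 = (1 + Q^2) * (1 + A^2 + A * d)" by (simp add: algebra_simps)
    have "aw_eigenvalue Q 1 = (1 - Q^2) * (1 - Q^4) / Q^2"
    proof -
      have "inverse (Q^2) - 1 = (1 - Q^2) / Q^2" using Q0 by (simp add: field_simps)
      then show ?thesis by (simp add: aw_eigenvalue_def)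
    qed
    also have "1 - Q^4 = (1 - Q^2) * (1 + Q^2)" by algebra
    finally have "aw_eigenvalue Q 1 * (1 + A^2 + A * d) = (1 - Q^2)^2 * ((1 + Q^2) * (1 + A^2 + A * d)) / Q^2"
      by (simp add: power2_eq_square mult_ac)
    then show ?thesis by (simp add: aw_beta_def flip: e)
  qed
  then have beta: "aw_beta 0 = - (aw_eigenvalue Q 1 * (1 + A^2 + A * d))" by (simp add: eq_neg_iff_add_eq_0 add.commute)
  show ?thesis unfolding aw_equation_def
  proof
    fix m
    have "aw_forward Q T (ypt m) * (chi (m + 1) - chi m) + aw_backward Q T (ypt m) * (chi (m - 1) - chi m)
      = (- 1 / (A * D)) * (aw_forward Q T (ypt m) * (awb (Suc 0) (m + 1) - awb (Suc 0) m)
        + aw_backward Q T (ypt m) * (awb (Suc 0) (m - 1) - awb (Suc 0) m))"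
    proof -
      have gen: "F * ((c * u + d) - (c * v + d)) + G * ((c * w + d) - (c * v + d)) = c * (F * (u - v) + G * (w - v))"
        for F G u v w c d :: complex by (simp add: algebra_simps)
      show ?thesis unfolding chi by (rule gen)
    qed
    also have "\<dots> = (- 1 / (A * D)) * (aw_eigenvalue Q 1 * (awb (Suc 0) m - (1 + A^2 + A * d)))"
      unfolding awb_equation awb_0 beta by (simp add: algebra_simps)
    also have "\<dots> = aw_eigenvalue Q 1 * chi m"
      unfolding chi using A0 D0 by (simp add: field_simps)
    finally show "aw_forward Q T (Q ^ (2 * m + 1)) * (chi (m + 1) - chi m)
      + aw_backward Q T (Q ^ (2 * m + 1)) * (chi (m - 1) - chi m) = aw_eigenvalue Q 1 * chi m"
      by (simp add: ypt_def)
  qed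
qed

text \<open>y + 1/y takes equal values only at a point and its inverse, and the grid lies in (0,
  1).\<close>

lemma chi_inj: "inj chi"
proof (rule injI)
  fix m n assume eq: "chi m = chi n"
  have pos: "0 < q ^ (2 * k + 1)" "q ^ (2 * k + 1) < 1" for k
    using q power_Suc_less_one[of q "2 * k"] by simp_all
  have D0: "complex_of_real (q + inverse q + inverse (q + inverse q) * (tpar q a)^2) \<noteq> 0"
    using chi_denom_pos by (metis less_irrefl of_real_eq_0_iff)
  have "ypt m + 1 / ypt m = ypt n + 1 / ypt n" using eq D0 by (simp add: chi_def)
  then have "(ypt m - ypt n) * (ypt m * ypt n - 1) = 0"
    using ypt_conditions(1)[of m] ypt_conditions(1)[of n] by (simp add: field_simps)
  moreover have "ypt m * ypt n \<noteq> 1"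
  proof -
    have "q ^ (2 * m + 1) * q ^ (2 * n + 1) < 1"
      using pos[of m] pos[of n] by (metis mult_strict_mono mult_1 less_eq_real_def zero_less_one)
    then show ?thesis unfolding ypt_real by (metis less_irrefl of_real_1 of_real_eq_iff of_real_mult)
  qed
  ultimately have "q ^ (2 * m + 1) = q ^ (2 * n + 1)" unfolding ypt_real
    by (metis eq_iff_diff_eq_0 mult_eq_0_iff of_real_eq_iff)
  then have "2 * m + 1 = 2 * n + 1"
    using q by (metis linorder_neqE_nat order_less_irrefl power_strict_decreasing)
  then show "m = n" by simp
qed

lemma poly_chi_zero:
  assumes "\<And>m. poly P (chi m) = 0"
  shows "P = 0"
proof (rule ccontr)
  assume "P \<noteq> 0"
  then have "finite {z. poly P z = 0}" by (rule poly_roots_finite)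
  moreover have "range chi \<subseteq> {z. poly P z = 0}" using assms by auto
  ultimately have "finite (range chi)" by (rule rev_finite_subset)
  then show False using chi_inj finite_imageD infinite_UNIV_nat by blast
qed


section \<open>The terminating series: coefficients, difference equation and polynomial\<close>

definition aw_coeff :: "nat \<Rightarrow> nat \<Rightarrow> complex" where
  "aw_coeff n k = qpoch (inverse ((Q^2) ^ n)) (Q^2) k * qpoch (A * B * Q * Q * (Q^2) ^ n / Q^2) (Q^2) k
     / (qpoch (A * B) (Q^2) k * qpoch (A * Q) (Q^2) k * qpoch (A * Q) (Q^2) k * qpoch (Q^2) (Q^2) k) * (Q^2) ^ k"

lemma AQ_real: "A * Q = of_real (- (q powr (- 2 * a + 1) * q))"
  by (simp add: A_def Q_def)

lemma AQ_factor: "1 - A * Q * (Q^2) ^ i \<noteq> 0"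
proof -
  have "1 + q powr (- 2 * a + 1) * q * (q^2) ^ i > 0" using q by (intro add_pos_nonneg) auto
  moreover have "1 - A * Q * (Q^2) ^ i = of_real (1 + q powr (- 2 * a + 1) * q * (q^2) ^ i)"
    unfolding AQ_real by (simp add: Q_def)
  ultimately show ?thesis by (metis less_irrefl of_real_eq_0_iff)
qed

lemma Q_power_neq_1: "j > 0 \<Longrightarrow> Q ^ j \<noteq> 1"
proof
  assume "j > 0" "Q ^ j = 1"
  then have "q ^ j = 1" by (metis Q_def of_real_1 of_real_eq_iff of_real_power)
  moreover have "q ^ j < 1" using q \<open>j > 0\<close> by (simp add: power_less_one_iff)
  ultimately show False by simp
qed

lemma Q2_factor: "1 - Q^2 * (Q^2) ^ i \<noteq> 0"
proof -
  have "Q^2 * (Q^2) ^ i = Q ^ (2 * Suc i)" by (simp only: power_mult power_Suc)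
  then show ?thesis using Q_power_neq_1[of "2 * Suc i"] by simp
qed

lemma qpoch_nonzero: "(\<And>i. i < k \<Longrightarrow> 1 - x * p ^ i \<noteq> 0) \<Longrightarrow> qpoch x p k \<noteq> (0 :: complex)"
  by (simp add: qpoch_def)

text \<open>AB = Q^2 turns the first factorial into the third, and AQ is negative.\<close>

lemma denominators_nonzero: "qpoch (A * B) (Q^2) k \<noteq> 0" "qpoch (A * Q) (Q^2) k \<noteq> 0" "qpoch (Q^2) (Q^2) k \<noteq> 0"
  unfolding AB(1) by (intro qpoch_nonzero Q2_factor AQ_factor)+

lemma ABQQ: "A * B * Q * Q * (Q^2) ^ n / Q^2 = Q^2 * (Q^2) ^ n"
  unfolding AB(1) using Q0 by (simp add: power2_eq_square)

text \<open>The factor 1 - p^(i-n) vanishes only at i = n, and this factor first enters at k = n +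
  1.\<close>

lemma aw_coeff_nonzero: "aw_coeff n n \<noteq> 0"
proof -
  have "qpoch (inverse ((Q^2) ^ n)) (Q^2) n \<noteq> 0"
  proof (rule qpoch_nonzero)
    fix i assume "i < n"
    show "1 - inverse ((Q^2) ^ n) * (Q^2) ^ i \<noteq> 0"
    proof
      assume "1 - inverse ((Q^2) ^ n) * (Q^2) ^ i = 0"
      then have "(Q^2) ^ n = (Q^2) ^ i" using Q0 by (simp add: field_simps)
      also have "(Q^2) ^ n = (Q^2) ^ i * (Q^2) ^ (n - i)" using \<open>i < n\<close> by (simp flip: power_add)
      finally have "Q ^ (2 * (n - i)) = 1" using Q0 by (simp add: power_mult)
      then show False using Q_power_neq_1[of "2 * (n - i)"] \<open>i < n\<close> by simp
    qed
  qed
  moreover have "qpoch (Q^2 * (Q^2) ^ n) (Q^2) n \<noteq> 0"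
    by (rule qpoch_nonzero) (use Q2_factor[of "n + _"] in \<open>simp add: power_add mult.assoc\<close>)
  ultimately show ?thesis using denominators_nonzero Q0 unfolding aw_coeff_def ABQQ by simp
qed

text \<open>The ratio of consecutive coefficients is exactly the one for which the series becomes an
  eigenfunction of the two-term operator.\<close>

lemma aw_coeff_recurrence:
  "aw_coeff n (Suc k) * aw_beta k = (aw_eigenvalue Q n - aw_eigenvalue Q k) * aw_coeff n k"
proof -
  define p r N where "p = Q^2" and "r = p ^ k" and "N = p ^ n"
  have nz: "p \<noteq> 0" "r \<noteq> 0" "N \<noteq> 0" using Q0 by (auto simp: p_def r_def N_def)
  have f: "1 - p * r \<noteq> 0" "1 - A * Q * r \<noteq> 0" using Q2_factor[of k] AQ_factor[of k] by (simp_all add: p_def r_def)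
  have ev: "(inverse (p ^ j) - 1) * (1 - p * p ^ j) = aw_eigenvalue Q j" for j
  proof -
    have "Q ^ (2 * j) = p ^ j" by (simp only: power_mult p_def)
    moreover have "Q ^ (2 * j + 2) = p * p ^ j" by (simp add: power_add p_def power_mult power2_eq_square)
    ultimately show ?thesis by (simp only: aw_eigenvalue_def)
  qed
  have "aw_coeff n (Suc k) = aw_coeff n k * ((1 - inverse N * r) * (1 - p * N * r) * p
      / ((1 - p * r) * (1 - A * Q * r) * (1 - A * Q * r) * (1 - p * r)))"
    unfolding aw_coeff_def ABQQ unfolding AB(1) p_def[symmetric] qpoch_Suc r_def N_def by (simp add: mult_ac)
  also have "\<dots> * aw_beta k = aw_coeff n k * ((1 - inverse N * r) * (1 - p * N * r)) * (p
      / ((1 - p * r)^2 * (1 - A * Q * r)^2) * - ((1 - p * r)^2 * (1 - A * Q * r)^2 / (p * r)))"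
    unfolding aw_beta_def p_def[symmetric] r_def[symmetric] by (simp add: power2_eq_square mult_ac)
  also have "p / ((1 - p * r)^2 * (1 - A * Q * r)^2) * - ((1 - p * r)^2 * (1 - A * Q * r)^2 / (p * r)) = - 1 / r"
    using f nz by simp
  also have "aw_coeff n k * ((1 - inverse N * r) * (1 - p * N * r)) * (- 1 / r)
      = ((inverse N - 1) * (1 - p * N) - (inverse r - 1) * (1 - p * r)) * aw_coeff n k"
    using nz by (simp add: field_simps)
  also have "(inverse N - 1) * (1 - p * N) = aw_eigenvalue Q n"
    unfolding N_def by (rule ev)
  also have "(inverse r - 1) * (1 - p * r) = aw_eigenvalue Q k"
    unfolding r_def by (rule ev)
  finally show ?thesis .
qed

definition aw_value :: "nat \<Rightarrow> nat \<Rightarrow> complex" where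
  "aw_value n m = (\<Sum>k\<le>n. aw_coeff n k * awb k m)"

lemma aw_value_equation: "aw_equation Q T (aw_eigenvalue Q n) (aw_value n)"
  unfolding aw_equation_def ypt_def[symmetric]
proof
  fix m
  let ?L = "\<lambda>f. aw_forward Q T (ypt m) * (f (m + 1) - f m) + aw_backward Q T (ypt m) * (f (m - 1) - f m)"
  have ev0: "aw_eigenvalue Q 0 = 0" by (simp add: aw_eigenvalue_def)
  have "?L (aw_value n) = (\<Sum>k\<le>n. aw_coeff n k * ?L (awb k))"
    by (simp add: aw_value_def sum_subtractf[symmetric] sum_distrib_left sum.distrib[symmetric] algebra_simps)
  also have "\<dots> = (\<Sum>k\<le>n. aw_coeff n k * (aw_eigenvalue Q k * awb k m)) + (\<Sum>k<n. aw_coeff n (Suc k) * (aw_beta k * awb k m))"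
  proof (cases n)
    case 0
    then show ?thesis by (simp add: awb_0 ev0)
  next
    case (Suc n')
    have "(\<Sum>k\<le>n. aw_coeff n k * ?L (awb k)) = (\<Sum>k<n. aw_coeff n (Suc k) * ?L (awb (Suc k)))"
      unfolding Suc sum.atMost_Suc_shift by (simp add: awb_0 lessThan_Suc_atMost)
    also have "\<dots> = (\<Sum>k<n. aw_coeff n (Suc k) * (aw_eigenvalue Q (Suc k) * awb (Suc k) m))
        + (\<Sum>k<n. aw_coeff n (Suc k) * (aw_beta k * awb k m))"
      unfolding awb_equation by (simp add: distrib_left sum.distrib)
    also have "(\<Sum>k<n. aw_coeff n (Suc k) * (aw_eigenvalue Q (Suc k) * awb (Suc k) m))
        = (\<Sum>k\<le>n. aw_coeff n k * (aw_eigenvalue Q k * awb k m))"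
      unfolding Suc sum.atMost_Suc_shift by (simp add: ev0 lessThan_Suc_atMost)
    finally show ?thesis .
  qed
  also have "(\<Sum>k<n. aw_coeff n (Suc k) * (aw_beta k * awb k m))
      = (\<Sum>k<n. (aw_eigenvalue Q n - aw_eigenvalue Q k) * aw_coeff n k * awb k m)"
    unfolding mult.assoc[symmetric] aw_coeff_recurrence ..
  \<comment> \<open>The term k = n may be added because its eigenvalue difference is zero.\<close>
  also have "\<dots> = (\<Sum>k\<le>n. (aw_eigenvalue Q n - aw_eigenvalue Q k) * aw_coeff n k * awb k m)"
    by (simp add: lessThan_Suc_atMost[symmetric])
  also have "(\<Sum>k\<le>n. aw_coeff n k * (aw_eigenvalue Q k * awb k m)) + \<dots> = aw_eigenvalue Q n * aw_value n m"
    by (simp add: aw_value_def sum_distrib_left sum.distrib[symmetric] algebra_simps)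
  finally show "?L (aw_value n) = aw_eigenvalue Q n * aw_value n m" .
qed

definition aw_poly :: "nat \<Rightarrow> complex poly" where
  "aw_poly n = (\<Sum>k\<le>n. smult (aw_coeff n k) (\<Prod>i<k. [: 1 + A^2 * (Q^2) ^ (2 * i), - 2 * A * (Q^2) ^ i :]))"

lemma poly_aw_poly:
  "poly (aw_poly n) X = (\<Sum>k\<le>n. aw_coeff n k * (\<Prod>i<k. 1 - 2 * A * X * (Q^2) ^ i + A^2 * (Q^2) ^ (2 * i)))"
  by (simp add: aw_poly_def poly_sum poly_prod algebra_simps)

lemma poly_aw_poly_ypt: "poly (aw_poly n) ((ypt m + 1 / ypt m) / 2) = aw_value n m"
proof -
  have "(\<Prod>i<k. 1 - 2 * A * ((ypt m + 1 / ypt m) / 2) * (Q^2) ^ i + A^2 * (Q^2) ^ (2 * i)) = awb k m" for k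
    unfolding awb_def aw_basis_def qpoch_def prod.distrib[symmetric]
  proof (rule prod.cong[OF refl])
    fix i
    have "(Q^2) ^ (2 * i) = (Q^2) ^ i * (Q^2) ^ i" by (simp add: mult_2 power_add)
    then show "1 - 2 * A * ((ypt m + 1 / ypt m) / 2) * (Q^2) ^ i + A^2 * (Q^2) ^ (2 * i)
        = (1 - A * ypt m * (Q^2) ^ i) * (1 - A / ypt m * (Q^2) ^ i)"
      using ypt_conditions(1)[of m] by (simp add: field_simps power2_eq_square)
  qed
  then show ?thesis by (simp add: poly_aw_poly aw_value_def)
qed

text \<open>The k-th product has degree exactly k, so only the summand k = n reaches degree n, and
  its coefficient is nonzero.\<close>

lemma degree_aw_poly: "degree (aw_poly n) = n" and aw_poly_nonzero: "aw_poly n \<noteq> 0"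
proof -
  let ?p = "\<lambda>k. \<Prod>i<k. [: 1 + A^2 * (Q^2) ^ (2 * i), - 2 * A * (Q^2) ^ i :]"
  have deg: "degree (?p k) = k" for k
    by (subst degree_prod_sum_eq) (simp_all add: A0 Q0)
  have lc: "coeff (?p n) n \<noteq> 0"
  proof -
    have "?p n \<noteq> 0" using A0 Q0 by simp
    then have "coeff (?p n) (degree (?p n)) \<noteq> 0" by (rule leading_coeff_neq_0)
    then show ?thesis unfolding deg .
  qed
  have "coeff (aw_poly n) n = (\<Sum>k\<le>n. aw_coeff n k * coeff (?p k) n)"
    by (simp add: aw_poly_def coeff_sum)
  also have "\<dots> = aw_coeff n n * coeff (?p n) n + (\<Sum>k<n. aw_coeff n k * coeff (?p k) n)"
    by (simp add: lessThan_Suc_atMost[symmetric])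
  also have "(\<Sum>k<n. aw_coeff n k * coeff (?p k) n) = 0"
  proof (rule sum.neutral, rule ballI)
    fix k assume "k \<in> {..<n}"
    then have "degree (?p k) < n" unfolding deg by simp
    then have "coeff (?p k) n = 0" by (rule coeff_eq_0)
    then show "aw_coeff n k * coeff (?p k) n = 0" by (simp only: mult_zero_right)
  qed
  finally have c: "coeff (aw_poly n) n \<noteq> 0" using lc aw_coeff_nonzero by simp
  then show "aw_poly n \<noteq> 0" by auto
  have "degree (aw_poly n) \<le> n"
    unfolding aw_poly_def
  proof (rule degree_sum_le)
    fix k assume "k \<in> {..n}"
    then show "degree (smult (aw_coeff n k) (?p k)) \<le> n"
      using degree_smult_le[of "aw_coeff n k" "?p k"] unfolding deg by simp
  qed simp
  then show "degree (aw_poly n) = n" using c le_degree by (metis le_antisym)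
qed

lemma aw_poly_normalized:
  obtains P where "degree P = n" "normalized_askey_wilson q a n P" "poly P 1 = 1"
    "aw_equation Q T (aw_eigenvalue Q n) (\<lambda>m. poly P (chi m))"
proof -
  define d where "d = complex_of_real (inverse (q + inverse q) * (tpar q a)^2)"
  define D where "D = complex_of_real (q + inverse q + inverse (q + inverse q) * (tpar q a)^2)"
  have D0: "D \<noteq> 0" unfolding D_def using chi_denom_pos by (metis less_irrefl of_real_eq_0_iff)
  \<comment> \<open>The inner polynomial is the inverse of the substitution X \<mapsto> (2X +
    d)/D.\<close>
  define R where "R = pcompose (aw_poly n) [: - d / 2, D / 2 :]"
  have R: "poly R ((2 * X + d) / D) = poly (aw_poly n) X" for X
  proof -
    have "poly [: - d / 2, D / 2 :] ((2 * X + d) / D) = X" using D0 by (simp add: field_simps)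
    then show ?thesis by (simp only: R_def poly_pcompose)
  qed
  have R_chi: "poly R (chi m) = aw_value n m" for m
  proof -
    have "2 * ((ypt m + 1 / ypt m) / 2) = ypt m + 1 / ypt m" by simp
    then show ?thesis
      using R[of "(ypt m + 1 / ypt m) / 2"] by (simp only: chi_def d_def D_def poly_aw_poly_ypt)
  qed
  have degR: "degree R = n" using D0 by (simp add: R_def degree_pcompose degree_aw_poly)
  have "R \<noteq> 0" using aw_poly_nonzero R by (metis D0 poly_0 poly_all_0_iff_0)
  \<comment> \<open>A solution that vanishes at m = 0 vanishes on the whole grid, and R would have
    infinitely many zeros.\<close>
  have v0: "aw_value n 0 \<noteq> 0"
  proof
    assume "aw_value n 0 = 0"
    then have "aw_value n m = 0" for m using aw_equation_zero[OF aw_value_equation] by blast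
    then have "R = 0" by (intro poly_chi_zero) (simp add: R_chi)
    then show False using \<open>R \<noteq> 0\<close> by blast
  qed
  define P where "P = smult (inverse (aw_value n 0)) R"
  show ?thesis
  proof (rule that)
    show "degree P = n" using v0 degR by (simp add: P_def)
    show "poly P 1 = 1" using R_chi[of 0] v0 by (simp add: P_def chi_0)
    show "aw_equation Q T (aw_eigenvalue Q n) (\<lambda>m. poly P (chi m))"
      using aw_equation_linear[OF aw_value_equation aw_value_equation, of n "inverse (aw_value n 0)" 0]
      by (simp add: P_def R_chi)
    define pref where "pref = qpoch (A * B) (Q^2) n * qpoch (A * Q) (Q^2) n * qpoch (A * Q) (Q^2) n / A ^ n"
    have pref: "pref \<noteq> 0" using denominators_nonzero A0 by (simp add: pref_def)
    have aw: "askey_wilson n X A B Q Q (Q^2) = pref * poly (aw_poly n) X" for X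
      unfolding askey_wilson_def pref_def poly_aw_poly aw_coeff_def ..
    have "poly P ((2 * X + d) / D) = inverse (aw_value n 0) * inverse pref * askey_wilson n X A B Q Q (Q^2)" for X
      using pref by (simp add: P_def R aw)
    then show "normalized_askey_wilson q a n P"
      unfolding normalized_askey_wilson_def d_def D_def A_def B_def Q_def using v0 pref
      by (intro exI[of _ "inverse (aw_value n 0) * inverse pref"]) (simp add: Q_def)
  qed
qed

end

section \<open>The representations \<open>H\<^sub>s\<close>\<close>

declare zero_fun_apply [simp del] plus_fun_apply [simp del] minus_apply [simp del] uminus_apply [simp del]

lemmas fun_simps = fun_eq_iff zero_fun_apply plus_fun_apply minus_apply uminus_apply

text \<open>One scaling for vectors of H_s and for functionals (\<open>ascale_eq_vscale\<close>), so
  that both are instances of the same vector space.\<close>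

definition vscale :: "complex \<Rightarrow> ('x \<Rightarrow> complex) \<Rightarrow> 'x \<Rightarrow> complex" where
  "vscale c v = (\<lambda>i. c * v i)"

lemma vscale_apply: "vscale c v i = c * v i"
  by (simp add: vscale_def)

lemma ascale_eq_vscale: "ascale = vscale"
  by (simp add: fun_simps vscale_apply ascale_def)

lemma spins_iff: "j \<in> spins (real N / 2) \<longleftrightarrow> (\<exists>m\<le>N. j = real m - real N / 2)"
proof
  assume "j \<in> spins (real N / 2)"
  then obtain m where m: "j = real m - real N / 2" "j \<le> real N / 2" by (auto simp: spins_def)
  then have "m \<le> N" by simp
  then show "\<exists>m\<le>N. j = real m - real N / 2" using m by blast
qed (auto simp: spins_def)

lemma spins_eq: "spins (real N / 2) = (\<lambda>m. real m - real N / 2) ` {..N}"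
  by (auto simp: spins_iff)

lemma finite_spins [simp]: "finite (spins (real N / 2))"
  by (simp add: spins_eq)

lemma inj_spin: "inj_on (\<lambda>m. real m - real N / 2) {..N}"
  by (auto simp: inj_on_def)

lemma sum_spins: "(\<Sum>j\<in>spins (real N / 2). f j) = (\<Sum>m\<le>N. f (real m - real N / 2))"
  unfolding spins_eq by (subst sum.reindex[OF inj_spin]) simp

lemma hspaceI: "(\<And>j. j \<notin> spins s \<Longrightarrow> v j = 0) \<Longrightarrow> v \<in> hspace s"
  by (simp add: hspace_def)

lemma hspace_eqI:
  assumes "v \<in> hspace (real N / 2)" and "w \<in> hspace (real N / 2)"
    and "\<And>m. m \<le> N \<Longrightarrow> v (real m - real N / 2) = w (real m - real N / 2)"
  shows "v = w"
proof
  fix j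
  show "v j = w j"
    using assms by (cases "j \<in> spins (real N / 2)") (auto simp: hspace_def spins_iff)
qed

lemma rep_gen_add: "rep_gen q s l (v + w) = rep_gen q s l v + rep_gen q s l w"
  by (cases l) (simp_all add: fun_simps vscale_apply sum.distrib distrib_right)

lemma rep_gen_scale: "rep_gen q s l (vscale c v) = vscale c (rep_gen q s l v)"
  by (cases l) (simp_all add: fun_simps vscale_apply sum_distrib_left mult.assoc)

lemma foldr_rep_gen_add: "foldr (rep_gen q s) w (u + v) = foldr (rep_gen q s) w u + foldr (rep_gen q s) w v"
  by (induction w) (simp_all add: rep_gen_add)

lemma foldr_rep_gen_scale: "foldr (rep_gen q s) w (vscale c v) = vscale c (foldr (rep_gen q s) w v)"
  by (induction w) (simp_all add: rep_gen_scale)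

lemma rep_add_left: "rep q s (g + h) v = rep q s g v + rep q s h v"
  unfolding rep_def plus_fun_def
  by (rule ext, rule linear_ext_add[where F = "\<lambda>w c. c * foldr (rep_gen q s) w v i" for i])
     (simp_all add: distrib_right)

lemma rep_single: "rep q s (Poly_Mapping.single w c) v = vscale c (foldr (rep_gen q s) w v)"
  by (simp add: rep_def fun_simps vscale_apply)

lemma rep_add: "rep q s h (u + v) = rep q s h u + rep q s h v"
  by (simp add: rep_def fun_simps foldr_rep_gen_add distrib_left sum.distrib)

lemma rep_scale: "rep q s h (vscale c v) = vscale c (rep q s h v)"
  by (simp add: rep_def fun_simps vscale_apply foldr_rep_gen_scale sum_distrib_left mult_ac)

lemma rep_zero: "rep q s h 0 = 0"
  using rep_scale[of q s h 0 0] by (simp add: fun_simps vscale_apply vscale_def zero_fun_def)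

lemma rep_mult: "rep q s (g * h) v = rep q s g (rep q s h v)"
proof (induction g rule: falg_induct)
  case (add g1 g2)
  then show ?case by (simp add: distrib_right rep_add_left)
next
  case (single w c)
  show ?case
  proof (induction h rule: falg_induct)
    case (add g1 g2)
    then show ?case by (simp add: distrib_left rep_add_left rep_add)
  next
    case (single w' c')
    show ?case
      by (simp add: mult_single rep_single plus_list_def foldr_rep_gen_scale) (simp add: vscale_def mult.assoc)
  qed
qed

lemma rep_scal: "rep q s (scal c) v = vscale c v"
  by (simp add: scal_def rep_single)

lemma rep_1: "rep q s 1 v = v"
  using rep_scal[of q s 1 v] by (simp add: vscale_def)

lemma rep_gens: "rep q s gk v = rep_gen q s GK v" "rep q s gki v = rep_gen q s GKi v"
  "rep q s ge v = rep_gen q s GE v" "rep q s gf v = rep_gen q s GF v"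
  by (simp_all add: gk_def gki_def ge_def gf_def rep_single vscale_def)

lemma rep_uminus: "rep q s (- h) v = - rep q s h v"
proof -
  have "- h = scal (- 1) * h" by (simp add: scal_uminus)
  then show ?thesis by (simp only: rep_mult rep_scal) (simp add: fun_simps vscale_apply)
qed

lemma rep_diff: "rep q s (g - h) v = rep q s g v - rep q s h v"
  using rep_add_left[of q s g "- h"] by (simp add: rep_uminus)

lemma hspace_add: "u \<in> hspace s \<Longrightarrow> v \<in> hspace s \<Longrightarrow> u + v \<in> hspace s"
  and hspace_scale: "v \<in> hspace s \<Longrightarrow> vscale c v \<in> hspace s"
  by (simp_all add: hspace_def plus_fun_apply vscale_apply)

lemma hinner_add: "hinner s u (v + w) = hinner s u v + hinner s u w"
  by (simp add: hinner_def plus_fun_apply distrib_left sum.distrib)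

lemma hinner_scale: "hinner s u (vscale c v) = c * hinner s u v"
  by (simp add: hinner_def vscale_apply sum_distrib_left mult_ac)

lemma hinner_add_left: "hinner s (u + v) w = hinner s u w + hinner s v w"
  by (simp add: hinner_def plus_fun_apply distrib_right sum.distrib)

lemma hinner_scale_left: "hinner s (vscale c u) v = cnj c * hinner s u v"
  by (simp add: hinner_def vscale_apply sum_distrib_left mult_ac)

lemma hinner_cnj: "cnj (hinner s u v) = hinner s v u"
  by (simp add: hinner_def mult_ac)

lemma hinner_diff: "hinner s u (v - w) = hinner s u v - hinner s u w"
  and hinner_diff_left: "hinner s (v - w) u = hinner s v u - hinner s w u"
  by (simp_all add: hinner_def minus_apply right_diff_distrib left_diff_distrib sum_subtractf)

lemma hinner_hbasis:
  assumes "j \<in> spins (real N / 2)"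
  shows "hinner (real N / 2) (hbasis j) v = v j"
proof -
  have "cnj (hbasis j i) * v i = (if i = j then v i else 0)" for i by (simp add: hbasis_def)
  then show ?thesis unfolding hinner_def using assms by (simp add: sum.delta)
qed

text \<open>Matrix entries for the transitions \<open>m \<rightarrow> m + 1\<close> and \<open>m + 1 \<rightarrow> m\<close>, with \<open>m = s + j\<close>.\<close>

definition e_entry :: "real \<Rightarrow> nat \<Rightarrow> nat \<Rightarrow> real" where
  "e_entry q N m = q powr (real m - real N / 2 + 1) * sqrt (qnum q (real N - real m) * qnum q (real m + 1))"

definition f_entry :: "real \<Rightarrow> nat \<Rightarrow> nat \<Rightarrow> real" where
  "f_entry q N m = q powr (- (real m - real N / 2 + 1)) * sqrt (qnum q (real m + 1) * qnum q (real N - real m))"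

lemma qnum_0 [simp]: "qnum q 0 = 0"
  by (simp add: qnum_def)

lemma qnum_pos:
  assumes "0 < q" "q < 1" "x > 0"
  shows "qnum q x > 0"
proof -
  have "q powr x < q powr (- x)" using assms by (intro powr_less_mono') auto
  moreover have "q < inverse q" using assms by (metis less_trans one_less_inverse)
  ultimately show ?thesis unfolding qnum_def by (intro divide_neg_neg) auto
qed

lemma qnum_nonneg: "0 < q \<Longrightarrow> q < 1 \<Longrightarrow> x \<ge> 0 \<Longrightarrow> qnum q x \<ge> 0"
  using qnum_pos[of q x] by (cases "x = 0") auto

lemma rep_gen_GK:
  "rep_gen q (real N / 2) GK v i = (if i \<in> spins (real N / 2) then of_real (q powr (2 * i)) * v i else 0)"
proof -
  have "v j * of_real (q powr (2 * j)) * hbasis j i = (if i = j then of_real (q powr (2 * i)) * v i else 0)" for j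
    by (simp add: hbasis_def)
  then show ?thesis by (simp add: sum.delta')
qed

lemma rep_gen_GKi:
  "rep_gen q (real N / 2) GKi v i = (if i \<in> spins (real N / 2) then of_real (q powr (- 2 * i)) * v i else 0)"
proof -
  have "v j * of_real (q powr (- 2 * j)) * hbasis j i = (if i = j then of_real (q powr (- 2 * i)) * v i else 0)" for j
    by (simp add: hbasis_def)
  then show ?thesis by (simp add: sum.delta')
qed

lemma rep_gen_GE:
  "rep_gen q (real N / 2) GE v i = (if i - 1 \<in> spins (real N / 2) then v (i - 1) *
     of_real (q powr i * sqrt (qnum q (real N / 2 - (i - 1)) * qnum q (real N / 2 + i))) else 0)"
proof -
  have "v j * of_real (q powr (j + 1) * sqrt (qnum q (real N / 2 - j) * qnum q (real N / 2 + j + 1))) * hbasis (j + 1) i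
    = (if i - 1 = j then v (i - 1) * of_real (q powr i * sqrt (qnum q (real N / 2 - (i - 1)) * qnum q (real N / 2 + i))) else 0)" for j
    by (auto simp: hbasis_def)
  then show ?thesis by (simp add: sum.delta')
qed

lemma rep_gen_GF:
  "rep_gen q (real N / 2) GF v i = (if i + 1 \<in> spins (real N / 2) then v (i + 1) *
     of_real (q powr (- (i + 1)) * sqrt (qnum q (real N / 2 + i + 1) * qnum q (real N / 2 - i))) else 0)"
proof -
  have "v j * of_real (q powr (- j) * sqrt (qnum q (real N / 2 + j) * qnum q (real N / 2 - j + 1))) * hbasis (j - 1) i
    = (if i + 1 = j then v (i + 1) * of_real (q powr (- (i + 1)) * sqrt (qnum q (real N / 2 + i + 1) * qnum q (real N / 2 - i))) else 0)" for j
    by (auto simp: hbasis_def add.assoc[symmetric])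
  then show ?thesis by (simp add: sum.delta' del: minus_add_distrib)
qed

context
  fixes N :: nat
begin

abbreviation spt :: "nat \<Rightarrow> real" where "spt m \<equiv> real m - real N / 2"

lemma spt_in: "m \<le> N \<Longrightarrow> spt m \<in> spins (real N / 2)"
  by (auto simp: spins_iff)

lemma spt_shift: "spt m + 1 = spt (Suc m)" "spt (Suc m) - 1 = spt m"
  by simp_all

lemma spt_in_iff: "spt m \<in> spins (real N / 2) \<longleftrightarrow> m \<le> N"
  by (auto simp: spins_iff)

lemma spt_pred_notin: "spt 0 - 1 \<notin> spins (real N / 2)"
  by (auto simp: spins_iff)

lemma K_coord: "m \<le> N \<Longrightarrow> rep q (real N / 2) gk v (spt m) = of_real (q powr (2 * spt m)) * v (spt m)"
  and Ki_coord: "m \<le> N \<Longrightarrow> rep q (real N / 2) gki v (spt m) = of_real (q powr (- 2 * spt m)) * v (spt m)"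
  using spt_in[of m] by (simp_all only: rep_gens rep_gen_GK rep_gen_GKi if_True)

lemma E_coord_0: "rep q (real N / 2) ge v (spt 0) = 0"
  using spt_pred_notin by (simp only: rep_gens rep_gen_GE if_False)

lemma E_coord_Suc: "m < N \<Longrightarrow> rep q (real N / 2) ge v (spt (Suc m)) = of_real (e_entry q N m) * v (spt m)"
proof -
  assume "m < N"
  then have "spt (Suc m) - 1 \<in> spins (real N / 2)" using spt_in[of m] by simp
  then have "rep q (real N / 2) ge v (spt (Suc m)) = v (spt (Suc m) - 1) *
     of_real (q powr spt (Suc m) * sqrt (qnum q (real N / 2 - (spt (Suc m) - 1)) * qnum q (real N / 2 + spt (Suc m))))"
    by (simp only: rep_gens rep_gen_GE if_True)
  also have "real N / 2 - (spt (Suc m) - 1) = real N - real m" by simp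
  also have "real N / 2 + spt (Suc m) = real m + 1" by simp
  finally show ?thesis by (simp add: e_entry_def algebra_simps)
qed

lemma F_coord: "m < N \<Longrightarrow> rep q (real N / 2) gf v (spt m) = of_real (f_entry q N m) * v (spt (Suc m))"
proof -
  assume "m < N"
  then have "spt m + 1 \<in> spins (real N / 2)" using spt_in[of "Suc m"] by (simp add: algebra_simps)
  then have "rep q (real N / 2) gf v (spt m) = v (spt m + 1) *
     of_real (q powr (- (spt m + 1)) * sqrt (qnum q (real N / 2 + spt m + 1) * qnum q (real N / 2 - spt m)))"
    by (simp only: rep_gens rep_gen_GF if_True)
  also have "real N / 2 - spt m = real N - real m" by simp
  also have "real N / 2 + spt m + 1 = real m + 1" by simp
  also have "spt m + 1 = spt (Suc m)" by (rule spt_shift)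
  finally show ?thesis by (simp add: f_entry_def algebra_simps)
qed

lemma F_coord_N: "rep q (real N / 2) gf v (spt N) = 0"
proof -
  have "spt N + 1 \<notin> spins (real N / 2)" using spt_in_iff[of "Suc N"] by simp
  then show ?thesis by (simp only: rep_gens rep_gen_GF if_False)
qed

text \<open>At the ends of the range e and f point outside the space, but there the coefficient
  contains [0] = 0.\<close>

lemma rep_gens_hspace:
  "rep q (real N / 2) gk v \<in> hspace (real N / 2)" "rep q (real N / 2) gki v \<in> hspace (real N / 2)"
  "rep q (real N / 2) ge v \<in> hspace (real N / 2)" "rep q (real N / 2) gf v \<in> hspace (real N / 2)"
proof -
  show "rep q (real N / 2) gk v \<in> hspace (real N / 2)" "rep q (real N / 2) gki v \<in> hspace (real N / 2)"
    by (rule hspaceI, simp only: rep_gens rep_gen_GK rep_gen_GKi if_False)+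
  show "rep q (real N / 2) ge v \<in> hspace (real N / 2)"
  proof (rule hspaceI)
    fix i assume i: "i \<notin> spins (real N / 2)"
    show "rep q (real N / 2) ge v i = 0"
    proof (cases "i - 1 \<in> spins (real N / 2)")
      case True
      then obtain m where m: "m \<le> N" "i - 1 = spt m" by (auto simp: spins_iff)
      then have "i = spt (Suc m)" by simp
      then have "\<not> Suc m \<le> N" using i spt_in_iff[of "Suc m"] by simp
      then have "m = N" using m by simp
      then have "real N / 2 - (i - 1) = 0" using m by simp
      then show ?thesis by (simp only: rep_gens rep_gen_GE) simp
    qed (simp only: rep_gens rep_gen_GE if_False)
  qed
  show "rep q (real N / 2) gf v \<in> hspace (real N / 2)"
  proof (rule hspaceI)
    fix i assume i: "i \<notin> spins (real N / 2)"
    show "rep q (real N / 2) gf v i = 0"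
    proof (cases "i + 1 \<in> spins (real N / 2)")
      case True
      then obtain m where m: "m \<le> N" "i + 1 = spt m" by (auto simp: spins_iff)
      have "m = 0"
      proof (cases m)
        case (Suc m')
        then have "i = spt m'" "m' \<le> N" using m by auto
        then show ?thesis using i spt_in by blast
      qed
      then have "real N / 2 + i + 1 = 0" using m by simp
      then show ?thesis by (simp only: rep_gens rep_gen_GF) simp
    qed (simp only: rep_gens rep_gen_GF if_False)
  qed
qed

lemma rep_hspace:
  assumes "v \<in> hspace (real N / 2)"
  shows "rep q (real N / 2) h v \<in> hspace (real N / 2)"
proof (induction h rule: falg_induct)
  case (add g h)
  then show ?case by (simp add: rep_add_left hspace_add)
next
  case (single w c)
  have "foldr (rep_gen q (real N / 2)) w v \<in> hspace (real N / 2)"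
  proof (cases w)
    case (Cons l w')
    then show ?thesis
      using rep_gens_hspace[of q "foldr (rep_gen q (real N / 2)) w' v"] unfolding rep_gens
      by (cases l) (simp_all only: foldr_Cons comp_apply)
  qed (simp add: assms)
  then show ?case by (simp add: rep_single hspace_scale)
qed

end

lemma qnum_mult:
  assumes "0 < q"
  shows "qnum q x * qnum q y = (inverse (q - inverse q))^2
    * (q powr (x + y) + q powr (- (x + y)) - q powr (x - y) - q powr (y - x))"
proof -
  have "(q powr x - q powr (- x)) * (q powr y - q powr (- y))
      = q powr (x + y) + q powr (- (x + y)) - q powr (x - y) - q powr (y - x)"
    by (simp add: algebra_simps flip: powr_add)
  then show ?thesis by (simp add: qnum_def divide_inverse power2_eq_square mult_ac)
qed

lemma entries_mult:
  assumes "0 < q" "q < 1" "m < N"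
  shows "e_entry q N m * f_entry q N m = qnum q (real N - real m) * qnum q (real m + 1)"
proof -
  have "sqrt (qnum q (real m + 1) * qnum q (real N - real m)) * sqrt (qnum q (real m + 1) * qnum q (real N - real m))
      = qnum q (real m + 1) * qnum q (real N - real m)"
    using assms by (intro real_sqrt_mult_self[THEN trans] abs_of_nonneg mult_nonneg_nonneg qnum_nonneg) auto
  moreover have "q powr (real m - real N / 2 + 1) * q powr (- (real m - real N / 2 + 1)) = 1"
    using assms(1) by (simp flip: powr_add)
  moreover have "e_entry q N m * f_entry q N m
      = (q powr (real m - real N / 2 + 1) * q powr (- (real m - real N / 2 + 1)))
        * (sqrt (qnum q (real m + 1) * qnum q (real N - real m)) * sqrt (qnum q (real m + 1) * qnum q (real N - real m)))"
    unfolding e_entry_def f_entry_def by (simp only: mult_ac)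
  ultimately show ?thesis by (simp only: mult_1 mult.commute)
qed

lemma entries_adjoint:
  assumes "0 < q"
  shows "e_entry q N m = q powr (2 * (real (Suc m) - real N / 2)) * f_entry q N m"
proof -
  have "q powr (real m - real N / 2 + 1) = q powr (2 * (real (Suc m) - real N / 2)) * q powr (- (real m - real N / 2 + 1))"
    by (simp add: algebra_simps flip: powr_add)
  then show ?thesis unfolding e_entry_def f_entry_def by (simp add: mult_ac)
qed

lemma fun_sum_apply: "(\<Sum>i\<in>S. f i) x = (\<Sum>i\<in>S. f i x)"
  by (induction S rule: infinite_finite_induct) (simp_all add: plus_fun_apply zero_fun_apply)

lemma rep_sum: "rep q s h (\<Sum>i\<in>S. f i) = (\<Sum>i\<in>S. rep q s h (f i))"
  by (induction S rule: infinite_finite_induct) (simp_all add: rep_zero rep_add)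

lemma hinner_zero: "hinner s u 0 = 0"
  by (simp add: hinner_def zero_fun_apply)

lemma hinner_sum: "hinner s u (\<Sum>i\<in>S. f i) = (\<Sum>i\<in>S. hinner s u (f i))"
  by (induction S rule: infinite_finite_induct) (simp_all add: hinner_zero hinner_add)

lemma hbasis_expansion:
  assumes "u \<in> hspace (real N / 2)"
  shows "u = (\<Sum>m\<le>N. vscale (u (real m - real N / 2)) (hbasis (real m - real N / 2)))"
proof
  fix j
  have "(\<Sum>m\<le>N. vscale (u (real m - real N / 2)) (hbasis (real m - real N / 2))) j = (\<Sum>i\<in>spins (real N / 2). u i * hbasis i j)"
    by (simp add: sum_spins vscale_apply fun_sum_apply)
  also have "\<dots> = (\<Sum>i\<in>spins (real N / 2). if j = i then u j else 0)"
    by (intro sum.cong) (auto simp: hbasis_def)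
  also have "\<dots> = u j" using assms by (auto simp: sum.delta' hspace_def)
  finally show "u j = (\<Sum>m\<le>N. vscale (u (real m - real N / 2)) (hbasis (real m - real N / 2))) j" by simp
qed

section \<open>Relations, adjoints and matrix coefficients of H_s\<close>

context
  fixes N :: nat and q :: real
  assumes q: "0 < q" "q < 1"
begin

abbreviation (input) rp :: "falg \<Rightarrow> hvec \<Rightarrow> hvec" where "rp \<equiv> rep q (real N / 2)"
abbreviation (input) Hs :: "hvec set" where "Hs \<equiv> hspace (real N / 2)"
abbreviation (input) pt :: "nat \<Rightarrow> real" where "pt m \<equiv> real m - real N / 2"

lemma EF_coord:
  assumes "m \<le> N"
  shows "rp ge (rp gf v) (pt m) = of_real (qnum q (real N - real m + 1) * qnum q (real m)) * v (pt m)"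
proof (cases m)
  case 0
  then show ?thesis using E_coord_0[of q N] by simp
next
  case (Suc m')
  then have "rp ge (rp gf v) (pt m) = of_real (e_entry q N m' * f_entry q N m') * v (pt m)"
    using assms E_coord_Suc[of m' N q "rp gf v"] F_coord[of m' N q v] by (simp only: Suc_le_eq of_real_mult mult.assoc)
  also have "e_entry q N m' * f_entry q N m' = qnum q (real N - real m + 1) * qnum q (real m)"
    using entries_mult[OF q, of m' N] Suc assms by (simp add: add.commute)
  finally show ?thesis .
qed

lemma FE_coord:
  assumes "m \<le> N"
  shows "rp gf (rp ge v) (pt m) = of_real (qnum q (real N - real m) * qnum q (real m + 1)) * v (pt m)"
proof (cases "m = N")
  case True
  then show ?thesis using F_coord_N[of q N "rp ge v"] by simp
next
  case False
  then have m: "m < N" using assms by simp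
  have "rp gf (rp ge v) (pt m) = of_real (f_entry q N m * e_entry q N m) * v (pt m)"
    using F_coord[OF m, of q "rp ge v"] E_coord_Suc[OF m, of q v] by (simp only: of_real_mult mult.assoc)
  then show ?thesis using entries_mult[OF q m] by (simp add: mult.commute)
qed

lemma rep_K_Ki:
  assumes "v \<in> Hs"
  shows "rp gk (rp gki v) = v" "rp gki (rp gk v) = v"
proof -
  have "q powr (2 * x) * q powr (- 2 * x) = 1" for x using q by (simp flip: powr_add)
  then have *: "complex_of_real (q powr (2 * x)) * of_real (q powr (- 2 * x)) = 1"
    "complex_of_real (q powr (- 2 * x)) * of_real (q powr (2 * x)) = 1" for x
    by (metis mult.commute of_real_1 of_real_mult)+
  show "rp gk (rp gki v) = v"
    by (intro hspace_eqI[of _ N] rep_hspace assms) (simp only: K_coord Ki_coord mult.assoc[symmetric] * mult_1)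
  show "rp gki (rp gk v) = v"
    by (intro hspace_eqI[of _ N] rep_hspace assms) (simp only: K_coord Ki_coord mult.assoc[symmetric] * mult_1)
qed

lemma rep_K_E: "v \<in> Hs \<Longrightarrow> rp gk (rp ge v) = vscale (of_real (q^2)) (rp ge (rp gk v))"
proof (rule hspace_eqI[of _ N])
  fix m assume m: "m \<le> N"
  show "rp gk (rp ge v) (pt m) = vscale (of_real (q^2)) (rp ge (rp gk v)) (pt m)"
  proof (cases m)
    case 0
    then show ?thesis using K_coord[OF m, of q "rp ge v"] E_coord_0[of q N] by (simp add: vscale_apply)
  next
    case (Suc m')
    have "q powr (2 * pt m) = q^2 * q powr (2 * pt m')"
    proof -
      have "q powr (2 * pt m) = q powr (2 + 2 * pt m')" using Suc by (simp add: algebra_simps)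
      also have "\<dots> = q powr 2 * q powr (2 * pt m')" by (rule powr_add)
      finally show ?thesis using q by (simp add: powr_numeral)
    qed
    then show ?thesis
      using K_coord[OF m, of q "rp ge v"] E_coord_Suc[of m' N q "rp gk v"] E_coord_Suc[of m' N q v]
        K_coord[of m' N q v] m Suc by (simp add: vscale_apply)
  qed
qed (simp_all add: rep_hspace hspace_scale)

lemma rep_K_F: "v \<in> Hs \<Longrightarrow> rp gk (rp gf v) = vscale (of_real (inverse (q^2))) (rp gf (rp gk v))"
proof (rule hspace_eqI[of _ N])
  fix m assume m: "m \<le> N"
  show "rp gk (rp gf v) (pt m) = vscale (of_real (inverse (q^2))) (rp gf (rp gk v)) (pt m)"
  proof (cases "m = N")
    case True
    then show ?thesis using K_coord[OF m, of q "rp gf v"] F_coord_N[of q N] by (simp add: vscale_apply)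
  next
    case False
    then have m': "m < N" using m by simp
    have "q powr (2 * pt (Suc m)) = q^2 * q powr (2 * pt m)"
    proof -
      have "q powr (2 * pt (Suc m)) = q powr (2 + 2 * pt m)" by (simp add: algebra_simps)
      also have "\<dots> = q powr 2 * q powr (2 * pt m)" by (rule powr_add)
      finally show ?thesis using q by (simp add: powr_numeral)
    qed
    then have "complex_of_real (q powr (2 * pt (Suc m))) = of_real (q^2) * of_real (q powr (2 * pt m))"
      by (metis of_real_mult)
    then have e: "complex_of_real (inverse (q^2)) * of_real (q powr (2 * pt (Suc m))) = of_real (q powr (2 * pt m))"
      using q by simp
    have "vscale (of_real (inverse (q^2))) (rp gf (rp gk v)) (pt m)
      = of_real (inverse (q^2)) * (of_real (f_entry q N m) * (of_real (q powr (2 * pt (Suc m))) * v (pt (Suc m))))"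
      using m' by (simp only: vscale_apply F_coord K_coord Suc_le_eq)
    also have "\<dots> = (of_real (inverse (q^2)) * of_real (q powr (2 * pt (Suc m)))) * (of_real (f_entry q N m) * v (pt (Suc m)))"
      by (simp only: mult_ac)
    also have "\<dots> = rp gk (rp gf v) (pt m)"
      using m m' unfolding e by (simp only: F_coord K_coord)
    finally show ?thesis by simp
  qed
qed (simp_all add: rep_hspace hspace_scale)

lemma qnum_bracket:
  assumes "m \<le> N"
  shows "qnum q (real N - real m + 1) * qnum q (real m) - qnum q (real N - real m) * qnum q (real m + 1)
    = inverse (q - inverse q) * (q powr (2 * pt m) - q powr (- 2 * pt m))"
proof -
  have k: "q - inverse q \<noteq> 0"
    using q by (metis eq_iff_diff_eq_0 less_irrefl less_trans one_less_inverse)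
  have "qnum q (real N - real m + 1) * qnum q (real m) - qnum q (real N - real m) * qnum q (real m + 1)
      = (inverse (q - inverse q))^2 * (q powr (real N - 2 * real m - 1) + q powr (2 * real m + 1 - real N)
          - q powr (real N - 2 * real m + 1) - q powr (2 * real m - 1 - real N))"
    unfolding qnum_mult[OF q(1)] by (simp add: algebra_simps)
  also have "q powr (real N - 2 * real m - 1) = q powr (- 2 * pt m) * inverse q"
    using q powr_add[of q "- 2 * pt m" "- 1"] by (simp add: algebra_simps powr_minus)
  also have "q powr (2 * real m + 1 - real N) = q powr (2 * pt m) * q"
    using q powr_add[of q "2 * pt m" "1"] by (simp add: algebra_simps)
  also have "q powr (real N - 2 * real m + 1) = q powr (- 2 * pt m) * q"
    using q powr_add[of q "- 2 * pt m" "1"] by (simp add: algebra_simps)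
  also have "q powr (2 * real m - 1 - real N) = q powr (2 * pt m) * inverse q"
    using q powr_add[of q "2 * pt m" "- 1"] by (simp add: algebra_simps powr_minus)
  also have "q powr (- 2 * pt m) * inverse q + q powr (2 * pt m) * q - q powr (- 2 * pt m) * q - q powr (2 * pt m) * inverse q
      = (q - inverse q) * (q powr (2 * pt m) - q powr (- 2 * pt m))" by (simp only: algebra_simps)
  finally show ?thesis using k by (simp add: power2_eq_square)
qed

lemma rep_E_F:
  assumes v: "v \<in> Hs"
  shows "rp ge (rp gf v) = rp gf (rp ge v) + vscale (of_real (inverse (q - inverse q))) (rp gk v - rp gki v)"
proof (rule hspace_eqI[of _ N])
  have "vscale c (rp gk v - rp gki v) = vscale c (rp gk v + vscale (- 1) (rp gki v))" for c
    by (simp add: fun_simps vscale_apply)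
  then show "rp gf (rp ge v) + vscale (of_real (inverse (q - inverse q))) (rp gk v - rp gki v) \<in> Hs"
    using v by (simp only: rep_hspace hspace_add hspace_scale)
  show "rp ge (rp gf v) \<in> Hs" using v by (intro rep_hspace)
  fix m assume m: "m \<le> N"
  let ?a = "qnum q (real N - real m + 1) * qnum q (real m)" and ?b = "qnum q (real N - real m) * qnum q (real m + 1)"
  have "complex_of_real ?a = of_real (?b + inverse (q - inverse q) * (q powr (2 * pt m) - q powr (- 2 * pt m)))"
    by (rule arg_cong[where f = of_real]) (use qnum_bracket[OF m] in linarith)
  then show "rp ge (rp gf v) (pt m)
      = (rp gf (rp ge v) + vscale (of_real (inverse (q - inverse q))) (rp gk v - rp gki v)) (pt m)"
    by (simp only: plus_fun_apply minus_apply vscale_apply EF_coord[OF m] FE_coord[OF m] K_coord[OF m] Ki_coord[OF m]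
         of_real_add of_real_mult of_real_diff distrib_right left_diff_distrib right_diff_distrib mult.assoc)
qed

lemma rep_casimir:
  assumes v: "v \<in> Hs"
  shows "rp (casimir q) v = vscale (casimir_value q N) v"
proof (rule hspace_eqI[of _ N])
  show "rp (casimir q) v \<in> Hs" "vscale (casimir_value q N) v \<in> Hs"
    using v by (simp_all add: rep_hspace hspace_scale)
  fix m assume m: "m \<le> N"
  let ?k = "inverse (q - inverse q)"
  have "qnum q (real N - real m) * qnum q (real m + 1) + ?k^2 * (q * q powr (2 * pt m) + inverse q * q powr (- 2 * pt m))
     = ?k^2 * (q ^ (N + 1) + inverse q ^ (N + 1))"
  proof -
    have "q * q powr (2 * pt m) = q powr (real m + 1 - (real N - real m))"
      using q powr_add[of q 1 "2 * pt m"] by (simp add: algebra_simps)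
    moreover have "inverse q * q powr (- 2 * pt m) = q powr (real N - real m - (real m + 1))"
      using q powr_add[of q "- 1" "- 2 * pt m"] by (simp add: algebra_simps powr_minus)
    moreover have "q ^ (N + 1) = q powr (real N - real m + (real m + 1))"
      using powr_realpow[OF q(1), of "N + 1"] by (simp add: add.commute)
    moreover from this have "inverse q ^ (N + 1) = q powr (- (real N - real m + (real m + 1)))"
      unfolding powr_minus power_inverse by simp
    ultimately show ?thesis unfolding qnum_mult[OF q(1)] by (simp add: algebra_simps)
  qed
  then have *: "complex_of_real (qnum q (real N - real m) * qnum q (real m + 1))
      + of_real ?k ^ 2 * (of_real q * of_real (q powr (2 * pt m)) + of_real (inverse q) * of_real (q powr (- 2 * pt m)))
     = casimir_value q N"
    unfolding casimir_value_def
    by (metis (no_types, opaque_lifting) of_real_add of_real_inverse of_real_mult of_real_power)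
  have "rp (casimir q) v (pt m) = (of_real (qnum q (real N - real m) * qnum q (real m + 1))
      + of_real ?k ^ 2 * (of_real q * of_real (q powr (2 * pt m)) + of_real (inverse q) * of_real (q powr (- 2 * pt m)))) * v (pt m)"
    unfolding casimir_def rep_add_left rep_mult rep_scal plus_fun_apply vscale_apply
      FE_coord[OF m] K_coord[OF m] Ki_coord[OF m] by (simp only: distrib_right distrib_left mult.assoc)
  then show "rp (casimir q) v (pt m) = vscale (casimir_value q N) v (pt m)"
    unfolding * by (simp add: vscale_apply)
qed

text \<open>This is f^* = k^-1 e, read off from \<open>entries_adjoint\<close>. The end terms drop
  because the image of f has no component at the highest vector and the image of e none at the
  lowest.\<close>

lemma hinner_F:
  assumes "v \<in> Hs" "w \<in> Hs"
  shows "hinner (real N / 2) v (rp gf w) = hinner (real N / 2) (rp (gki * ge) v) w"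
proof -
  have F: "(\<Sum>m\<le>N. cnj (v (pt m)) * rp gf w (pt m)) = (\<Sum>m<N. cnj (v (pt m)) * (of_real (f_entry q N m) * w (pt (Suc m))))"
  proof -
    have "(\<Sum>m\<le>N. cnj (v (pt m)) * rp gf w (pt m)) = (\<Sum>m<N. cnj (v (pt m)) * rp gf w (pt m)) + cnj (v (pt N)) * rp gf w (pt N)"
      by (simp add: lessThan_Suc_atMost[symmetric])
    then show ?thesis unfolding F_coord_N by (simp add: F_coord)
  qed
  have "(\<Sum>m\<le>N. cnj (rp (gki * ge) v (pt m)) * w (pt m))
      = cnj (rp (gki * ge) v (pt 0)) * w (pt 0) + (\<Sum>m<N. cnj (rp (gki * ge) v (pt (Suc m))) * w (pt (Suc m)))"
  proof (cases N)
    case (Suc n)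
    then show ?thesis unfolding Suc sum.atMost_Suc_shift lessThan_Suc_atMost by simp
  qed simp
  also have "rp (gki * ge) v (pt 0) = 0"
    using E_coord_0[of q N v] Ki_coord[of 0 N q "rp ge v"] by (simp add: rep_mult)
  also have "(\<Sum>m<N. cnj (rp (gki * ge) v (pt (Suc m))) * w (pt (Suc m)))
      = (\<Sum>m<N. cnj (v (pt m)) * (of_real (f_entry q N m) * w (pt (Suc m))))"
  proof (rule sum.cong[OF refl])
    fix m assume "m \<in> {..<N}"
    then have m: "m < N" by simp
    have "q powr (- 2 * pt (Suc m)) * e_entry q N m = f_entry q N m"
      unfolding entries_adjoint[OF q(1)] mult.assoc[symmetric] using q by (simp flip: powr_add)
    then have "complex_of_real (q powr (- 2 * pt (Suc m))) * of_real (e_entry q N m) = of_real (f_entry q N m)"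
      by (metis of_real_mult)
    then have "rp (gki * ge) v (pt (Suc m)) = of_real (f_entry q N m) * v (pt m)"
      using m by (simp only: rep_mult Ki_coord Suc_le_eq E_coord_Suc mult.assoc[symmetric])
    then show "cnj (rp (gki * ge) v (pt (Suc m))) * w (pt (Suc m)) = cnj (v (pt m)) * (of_real (f_entry q N m) * w (pt (Suc m)))"
      by (simp del: of_nat_Suc)
  qed
  finally show ?thesis unfolding hinner_def sum_spins F by simp
qed

lemma hinner_Ki: "hinner (real N / 2) v (rp gki w) = hinner (real N / 2) (rp gki v) w"
  unfolding hinner_def sum_spins by (intro sum.cong refl) (simp add: Ki_coord del: mult_minus_left)

text \<open>f and k^-1 e are adjoint to each other and \<open>rho q\<close> is purely imaginary, so
  their difference times \<open>rho q\<close> is self-adjoint.\<close>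

lemma hinner_xel:
  assumes "v \<in> Hs" "w \<in> Hs"
  shows "hinner (real N / 2) v (rp (xel q a) w) = hinner (real N / 2) (rp (xel q a) v) w"
proof -
  have E: "hinner (real N / 2) v (rp (gki * ge) w) = hinner (real N / 2) (rp gf v) w"
    using hinner_F[OF assms(2,1)] by (metis hinner_cnj)
  have "cnj (rho q) = - rho q" "cnj (wt q a) = wt q a" by (simp_all add: rho_def wt_def)
  then show ?thesis
    unfolding xel_def rep_add_left rep_mult[of _ _ "scal _"] rep_scal rep_diff
    by (simp add: hinner_add hinner_scale hinner_add_left hinner_scale_left hinner_diff hinner_diff_left
        hinner_F[OF assms] E hinner_Ki algebra_simps)
qed

lemma mcoef_linear: "func_linear (mcoef q (real N / 2) \<xi> \<zeta>)"
  by (simp add: func_linear_def mcoef_def rep_add_left rep_mult rep_scal hinner_add hinner_scale)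

lemma uq_functional_mcoef:
  assumes "\<zeta> \<in> Hs"
  shows "uq_functional q (mcoef q (real N / 2) \<xi> \<zeta>)"
proof (rule uq_functionalI[OF mcoef_linear])
  fix g h
  have w: "rp h \<zeta> \<in> Hs" using assms by (rule rep_hspace)
  show "mcoef q (real N / 2) \<xi> \<zeta> (g * (gk * gki) * h) = mcoef q (real N / 2) \<xi> \<zeta> (g * h)"
    "mcoef q (real N / 2) \<xi> \<zeta> (g * (gki * gk) * h) = mcoef q (real N / 2) \<xi> \<zeta> (g * h)"
    by (simp_all only: mcoef_def rep_mult rep_K_Ki[OF w])
  show "mcoef q (real N / 2) \<xi> \<zeta> (g * (gk * ge) * h) = of_real (q^2) * mcoef q (real N / 2) \<xi> \<zeta> (g * (ge * gk) * h)"
    by (simp only: mcoef_def rep_mult rep_K_E[OF w] rep_scale hinner_scale)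
  show "mcoef q (real N / 2) \<xi> \<zeta> (g * (gk * gf) * h) = of_real (inverse (q^2)) * mcoef q (real N / 2) \<xi> \<zeta> (g * (gf * gk) * h)"
    by (simp only: mcoef_def rep_mult rep_K_F[OF w] rep_scale hinner_scale)
  have d: "rp g (u - v) = rp g u - rp g v" for u v
    using rep_add[of q "real N / 2" g "u - v" v] by (simp add: eq_diff_eq)
  show "mcoef q (real N / 2) \<xi> \<zeta> (g * (ge * gf) * h) = mcoef q (real N / 2) \<xi> \<zeta> (g * (gf * ge) * h)
     + of_real (inverse (q - inverse q)) * (mcoef q (real N / 2) \<xi> \<zeta> (g * gk * h) - mcoef q (real N / 2) \<xi> \<zeta> (g * gki * h))"
    by (simp only: mcoef_def rep_mult rep_E_F[OF w] rep_add rep_scale d hinner_add hinner_scale hinner_diff)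
qed

text \<open>Coordinates are matrix coefficients, and these vanish on the ideal.\<close>

lemma rep_cong:
  assumes "v \<in> Hs" and "uq_eq q g h"
  shows "rp g v = rp h v"
proof (rule hspace_eqI[of _ N])
  show "rp g v \<in> Hs" "rp h v \<in> Hs" using assms by (simp_all add: rep_hspace)
  fix m assume "m \<le> N"
  then have "u (pt m) = hinner (real N / 2) (hbasis (pt m)) u" for u
    using hinner_hbasis[OF spt_in] by metis
  then show "rp g v (pt m) = rp h v (pt m)"
    using uq_functional_cong[OF uq_functional_mcoef[OF assms(1), of "hbasis (pt m)"] assms(2)]
    by (simp add: mcoef_def)
qed

lemma rep_K_power:
  assumes "v \<in> Hs" "m \<le> N"
  shows "rp (gk ^ n) v (pt m) = of_real (q powr (2 * pt m)) ^ n * v (pt m)"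
proof (induction n)
  case 0
  then show ?case by (simp add: rep_1)
next
  case (Suc n)
  then show ?case using assms(2) by (simp add: rep_mult K_coord del: of_real_power)
qed

text \<open>k is diagonal with eigenvalues q^(2m-N), m = 0, ..., N, so multiplication by (q^n)^N
  leaves only nonnegative powers of q^n.\<close>

lemma kregular_mcoef:
  assumes "\<zeta> \<in> Hs"
  shows "kregular q (mcoef q (real N / 2) \<xi> \<zeta>)"
  unfolding kregular_def
proof (intro allI)
  fix g h
  define w where "w = rp h \<zeta>"
  have w: "w \<in> Hs" unfolding w_def using assms by (rule rep_hspace)
  let ?c = "\<lambda>m. w (pt m) * hinner (real N / 2) \<xi> (rp g (hbasis (pt m)))"
  have "mcoef q (real N / 2) \<xi> \<zeta> (g * gk ^ n * h) * (of_real q ^ n) ^ N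
      = poly (\<Sum>m\<le>N. monom (?c m) (2 * m)) (of_real q ^ n)" for n
  proof -
    have "rp (gk ^ n) w = (\<Sum>m\<le>N. vscale (rp (gk ^ n) w (pt m)) (hbasis (pt m)))"
      by (rule hbasis_expansion[OF rep_hspace[OF w]])
    also have "\<dots> = (\<Sum>m\<le>N. vscale (of_real (q powr (2 * pt m)) ^ n * w (pt m)) (hbasis (pt m)))"
      by (intro sum.cong refl) (simp only: rep_K_power[OF w] atMost_iff)
    finally have "mcoef q (real N / 2) \<xi> \<zeta> (g * gk ^ n * h) = (\<Sum>m\<le>N. of_real (q powr (2 * pt m)) ^ n * ?c m)"
      by (simp add: mcoef_def rep_mult w_def rep_sum rep_scale hinner_sum hinner_scale mult.assoc)
    moreover have P: "complex_of_real (q powr (2 * pt m)) ^ n * (of_real q ^ n) ^ N = (of_real q ^ n) ^ (2 * m)" for m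
    proof -
      have "q powr (2 * pt m) * q ^ N = q ^ (2 * m)"
        using q by (simp add: powr_realpow[symmetric] algebra_simps flip: powr_add)
      then have "(q powr (2 * pt m) * q ^ N) ^ n = (q ^ (2 * m)) ^ n" by simp
      then have "(q powr (2 * pt m)) ^ n * (q ^ n) ^ N = (q ^ n) ^ (2 * m)"
        by (simp only: power_mult_distrib power_mult[symmetric] mult.commute)
      then show ?thesis by (metis of_real_mult of_real_power)
    qed
    moreover have "(of_real (q powr (2 * pt m)) ^ n * ?c m) * (of_real q ^ n) ^ N = ?c m * (of_real q ^ n) ^ (2 * m)" for m
      unfolding P[symmetric] by (simp only: mult_ac)
    ultimately show ?thesis by (simp only: sum_distrib_right poly_sum poly_monom)
  qed
  then show "\<exists>M p. \<forall>n. mcoef q (real N / 2) \<xi> \<zeta> (g * gk ^ n * h) * (of_real q ^ n) ^ M = poly p (of_real q ^ n)"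
    by blast
qed

end

section \<open>Eigenvectors\<close>

lemma vector_space_vscale: "vector_space (vscale :: complex \<Rightarrow> ('x \<Rightarrow> complex) \<Rightarrow> 'x \<Rightarrow> complex)"
  by unfold_locales (simp_all add: fun_simps vscale_apply algebra_simps)

lemma vscale_simps:
  "vscale c (u + v) = vscale c u + vscale c v" "vscale (c + d) v = vscale c v + vscale d v"
  "vscale c (vscale d v) = vscale (c * d) v" "vscale 1 v = v" "vscale 0 v = 0" "vscale c 0 = 0"
  by (simp_all add: fun_simps vscale_apply algebra_simps)

lemma vscale_eq_0_iff: "vscale c v = 0 \<longleftrightarrow> c = 0 \<or> v = 0"
  by (auto simp: fun_simps vscale_apply)

lemma vscale_sum: "vscale c (\<Sum>i\<in>I. f i) = (\<Sum>i\<in>I. vscale c (f i))"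
  by (simp add: fun_simps vscale_apply fun_sum_apply sum_distrib_left)

lemma eigenvectors_independent:
  fixes T :: "('x \<Rightarrow> complex) \<Rightarrow> 'x \<Rightarrow> complex"
  assumes add: "\<And>u v. T (u + v) = T u + T v" and scale: "\<And>c v. T (vscale c v) = vscale c (T v)"
    and "finite I" and "inj_on \<mu> I"
    and "\<And>i. i \<in> I \<Longrightarrow> T (v i) = vscale (\<mu> i) (v i)" and "(\<Sum>i\<in>I. v i) = 0"
    and "i \<in> I"
  shows "v i = 0"
  using assms(3-)
proof (induction I arbitrary: v i rule: finite_induct)
  case (insert k I)
  have T0: "T 0 = 0" using scale[of 0 0] by (simp add: vscale_simps)
  have Tsum: "T (\<Sum>i\<in>I. f i) = (\<Sum>i\<in>I. T (f i))" for f
    by (rule sum_comp_morphism[of T, unfolded comp_def, symmetric]) (rule T0, rule add)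
  have s: "v k + (\<Sum>i\<in>I. v i) = 0" using insert.prems(3) insert.hyps by simp
  have "(\<Sum>i\<in>I. vscale (\<mu> i - \<mu> k) (v i)) = 0"
  proof -
    have "0 = T (v k + (\<Sum>i\<in>I. v i))" unfolding s by (simp add: T0)
    also have "\<dots> = vscale (\<mu> k) (v k) + (\<Sum>i\<in>I. vscale (\<mu> i) (v i))"
      using insert.prems(2) by (simp add: add Tsum)
    also have "v k = vscale (- 1) (\<Sum>i\<in>I. v i)"
      using s by (simp add: fun_simps vscale_apply eq_neg_iff_add_eq_0)
    finally have "0 = vscale (\<mu> k) (vscale (- 1) (\<Sum>i\<in>I. v i)) + (\<Sum>i\<in>I. vscale (\<mu> i) (v i))" .
    also have "\<dots> = (\<Sum>i\<in>I. vscale (\<mu> i - \<mu> k) (v i))"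
      by (simp add: fun_simps vscale_apply fun_sum_apply sum_distrib_left left_diff_distrib sum_subtractf sum_negf)
    finally show ?thesis by simp
  qed
  then have "vscale (\<mu> j - \<mu> k) (v j) = 0" if "j \<in> I" for j
    using insert.prems(1,2) that
    by (intro insert.IH[of "\<lambda>i. vscale (\<mu> i - \<mu> k) (v i)"])
       (auto simp: scale vscale_simps mult.commute)
  moreover have "\<mu> j \<noteq> \<mu> k" if "j \<in> I" for j
    using insert.prems(1) insert.hyps that by (auto simp: inj_on_def)
  ultimately have I: "v j = 0" if "j \<in> I" for j
    using that by (metis eq_iff_diff_eq_0 vscale_eq_0_iff)
  then have "v k = 0" using s by simp
  then show ?case using I insert.prems by auto
qed simp

text \<open>Distinct eigenvalues give N + 1 independent vectors in a space spanned by N + 1 basis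
  vectors.\<close>

lemma eigenbasis_spans:
  assumes q: "0 < q" "q < 1"
    and e: "\<And>k. k \<le> N \<Longrightarrow> e k \<in> hspace (real N / 2)" "\<And>k. k \<le> N \<Longrightarrow> e k \<noteq> 0"
      "\<And>k. k \<le> N \<Longrightarrow> rep q (real N / 2) h (e k) = vscale (\<mu> k) (e k)"
    and \<mu>: "inj_on \<mu> {..N}" and v: "v \<in> hspace (real N / 2)"
  shows "\<exists>c. v = (\<Sum>k\<le>N. vscale (c k) (e k))"
proof -
  interpret vs: vector_space "vscale :: complex \<Rightarrow> hvec \<Rightarrow> hvec" by (rule vector_space_vscale)
  let ?T = "rep q (real N / 2) h"
  have inj: "inj_on e {..N}"
  proof (rule inj_onI)
    fix k l assume kl: "k \<in> {..N}" "l \<in> {..N}" "e k = e l"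
    then have "vscale (\<mu> k) (e k) = vscale (\<mu> l) (e k)" using e(3) by (metis atMost_iff)
    then have "vscale (\<mu> k - \<mu> l) (e k) = 0"
      by (simp add: fun_simps vscale_apply left_diff_distrib)
    then have "\<mu> k = \<mu> l" using e(2) kl by (simp add: vscale_eq_0_iff)
    then show "k = l" using \<mu> kl by (simp add: inj_on_def)
  qed
  let ?S = "e ` {..N}" and ?B = "(\<lambda>m. hbasis (real m - real N / 2)) ` {..N}"
  have indep: "vs.independent ?S"
  proof
    assume "vs.dependent ?S"
    then obtain u w where u: "w \<in> ?S" "u w \<noteq> 0" "(\<Sum>v\<in>?S. vscale (u v) v) = 0"
      by (auto simp: vs.dependent_finite)
    then obtain k where k: "k \<le> N" "w = e k" by auto
    have "vscale (u (e k)) (e k) = 0"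
    proof (rule eigenvectors_independent[of ?T "{..N}" \<mu> "\<lambda>k. vscale (u (e k)) (e k)"])
      show "(\<Sum>k\<le>N. vscale (u (e k)) (e k)) = 0" using u(3) by (simp add: sum.reindex[OF inj])
    qed (use \<mu> k e(3) in \<open>simp_all add: rep_add rep_scale vscale_simps mult.commute\<close>)
    then show False using u k e(2) by (simp add: vscale_eq_0_iff)
  qed
  have span: "w \<in> vs.span ?B" if "w \<in> hspace (real N / 2)" for w
  proof -
    have "w = (\<Sum>m\<le>N. vscale (w (real m - real N / 2)) (hbasis (real m - real N / 2)))"
      by (rule hbasis_expansion[OF that])
    also have "\<dots> \<in> vs.span ?B"
      by (intro vs.span_sum vs.span_scale vs.span_base) auto
    finally show ?thesis .
  qed
  have card: "card ?S = Suc N" by (simp add: card_image[OF inj])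
  have "v \<in> vs.span ?S"
  proof (rule ccontr)
    assume nv: "v \<notin> vs.span ?S"
    then have "vs.independent (insert v ?S)" by (rule vs.independent_insertI[OF _ indep])
    moreover have "insert v ?S \<subseteq> vs.span ?B" using span v e(1) by auto
    ultimately have "card (insert v ?S) \<le> card ?B" using vs.independent_span_bound[of ?B] by blast
    moreover have "card ?B \<le> Suc N" by (metis card_atMost card_image_le finite_atMost)
    moreover have "v \<notin> ?S" using nv vs.span_base[of v ?S] by metis
    ultimately show False using card by simp
  qed
  then obtain u where "v = (\<Sum>w\<in>?S. vscale (u w) w)"
    by (auto simp: vs.span_finite)
  then have "v = (\<Sum>k\<le>N. vscale (u (e k)) (e k))" by (simp add: sum.reindex[OF inj])
  then show ?thesis by (rule exI[of _ "\<lambda>k. u (e k)"])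
qed

section \<open>Distinctness of the weights and explicit eigenvectors of X\<close>

lemma qnum_strict_mono:
  assumes q: "0 < q" "q < 1" and "x < y"
  shows "qnum q x < qnum q y"
proof -
  have "q powr y < q powr x" "q powr (- x) < q powr (- y)"
    using assms by (auto intro!: powr_less_mono')
  then have "q powr y - q powr (- y) < q powr x - q powr (- x)" by simp
  moreover have "q - inverse q < 0" using q one_less_inverse[of q] by simp
  ultimately show ?thesis unfolding qnum_def by (rule divide_strict_right_mono_neg)
qed

lemma wt_inj: "0 < q \<Longrightarrow> q < 1 \<Longrightarrow> wt q x = wt q y \<Longrightarrow> x = y"
  using qnum_strict_mono[of q x y] qnum_strict_mono[of q y x]
  unfolding wt_def of_real_eq_iff by (metis less_irrefl linorder_less_linear)

text \<open>
  Up to normalization the coordinates of the eigenvectors are the coefficients of a product of two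
  \<open>q\<close>-shifted factorials; the first order \<open>q\<close>-difference equation of this product is the eigenvalue
  equation.
\<close>

definition eigen_poly :: "real \<Rightarrow> real \<Rightarrow> nat \<Rightarrow> nat \<Rightarrow> complex poly" where
  "eigen_poly q a N M =
     (let r = inverse (of_real (q^2)); g = \<i> * of_real (q powr ((real N - 1) / 2 + a));
          d = - \<i> * of_real (q powr ((real N - 1) / 2 - a))
      in (\<Prod>i<M. [:1, g * r ^ i:]) * (\<Prod>i<N - M. [:1, d * r ^ i:]))"

lemma eigen_poly_degree: "M \<le> N \<Longrightarrow> degree (eigen_poly q a N M) \<le> N"
proof -
  assume "M \<le> N"
  have d: "degree (\<Prod>i<k. [:1, c i:]) \<le> k" for k and c :: "nat \<Rightarrow> complex"
  proof (induction k)
    case (Suc k)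
    have "degree ((\<Prod>i<k. [:1, c i:]) * [:1, c k:]) \<le> degree (\<Prod>i<k. [:1, c i:]) + degree [:1, c k:]"
      by (rule degree_mult_le)
    also have "\<dots> \<le> k + 1" using Suc by (intro add_mono) auto
    finally show ?case by simp
  qed simp
  show ?thesis unfolding eigen_poly_def Let_def
    by (rule order_trans[OF degree_mult_le], rule order_trans[OF add_mono[OF d d]]) (simp add: \<open>M \<le> N\<close>)
qed

lemma coeff_0_prod_linear: "coeff (\<Prod>i<(k::nat). [:1, c i:]) 0 = (1 :: complex)"
  by (induction k) (simp_all add: coeff_mult)

lemma eigen_poly_coeff_0: "coeff (eigen_poly q a N M) 0 = 1"
  by (simp add: eigen_poly_def Let_def coeff_mult coeff_0_prod_linear)

text \<open>Passing from z to r z shifts the product by one factor.\<close>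

lemma prod_linear_shift:
  fixes g r z :: complex
  shows "(\<Prod>i<M. 1 + g * r ^ i * z) * (1 + g * r ^ M * z) = (1 + g * z) * (\<Prod>i<M. 1 + g * r ^ i * (r * z))"
proof -
  have "(\<Prod>i<M. 1 + g * r ^ i * z) * (1 + g * r ^ M * z) = (\<Prod>i<Suc M. 1 + g * r ^ i * z)" by simp
  also have "\<dots> = (1 + g * z) * (\<Prod>i<M. 1 + g * r ^ i * (r * z))"
    unfolding prod.lessThan_Suc_shift by (simp add: mult_ac)
  finally show ?thesis .
qed

text \<open>The underlying equation is p(z)(1 + g r^M z)(1 + d r^(N-M) z) = p(r z)(1 + g z)(1 + d
  z), and the recurrences compare its coefficients. The parameters g and d are chosen so that the
  quadratic on the left carries the weight a + N - 2M in \<beta> and the one on the right the weight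
  a in \<alpha>.\<close>

lemma eigen_poly_recurrence:
  fixes q a :: real and N M :: nat
  assumes q: "0 < q" "q < 1" and M: "M \<le> N"
  defines "c \<equiv> coeff (eigen_poly q a N M)" and "r \<equiv> inverse (of_real (q^2)) :: complex"
    and "G \<equiv> \<i> * of_real (q powr (- (real N + 1) / 2)) :: complex"
  defines "\<beta> \<equiv> G * (of_real (q powr (a + real N - 2 * real M)) - of_real (q powr (- (a + real N - 2 * real M))))"
    and "\<alpha> \<equiv> G * (of_real (q powr a) - of_real (q powr (- a)))"
  shows "(1 - r) * c 1 + (\<beta> - \<alpha> * of_real q ^ N) * c 0 = 0"
    and "(1 - r ^ (m + 2)) * c (m + 2) + (\<beta> - \<alpha> * of_real q ^ N * r ^ (m + 1)) * c (m + 1)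
       + (inverse (of_real q) ^ (N + 1) - of_real q ^ N * inverse (of_real q) * r ^ m) * c m = 0"
proof -
  define g where "g = \<i> * complex_of_real (q powr ((real N - 1) / 2 + a))"
  define d where "d = - \<i> * complex_of_real (q powr ((real N - 1) / 2 - a))"
  define p where "p = eigen_poly q a N M"
  have rr: "r ^ k = of_real (q powr (- 2 * real k))" for k
  proof -
    have "q powr (2 * real k) = q ^ (2 * k)" using powr_realpow[OF q(1), of "2 * k"] by simp
    then have "inverse (q^2) ^ k = q powr (- 2 * real k)"
      by (simp add: powr_minus power_inverse power_mult)
    moreover have "r ^ k = of_real (inverse (q^2) ^ k)" by (simp add: r_def)
    ultimately show ?thesis by (simp only:)
  qed
  have "p * ([:1, g * r ^ M:] * [:1, d * r ^ (N - M):]) = pcompose p [:0, r:] * ([:1, g:] * [:1, d:])"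
  proof (rule poly_eq_poly_eq_iff[THEN iffD1], rule ext)
    fix z
    have p: "poly p z = (\<Prod>i<M. 1 + g * r ^ i * z) * (\<Prod>i<N - M. 1 + d * r ^ i * z)" for z
      by (simp add: p_def eigen_poly_def Let_def poly_prod g_def d_def r_def algebra_simps)
    have "poly (p * ([:1, g * r ^ M:] * [:1, d * r ^ (N - M):])) z
      = ((\<Prod>i<M. 1 + g * r ^ i * z) * (1 + g * r ^ M * z)) * ((\<Prod>i<N - M. 1 + d * r ^ i * z) * (1 + d * r ^ (N - M) * z))"
      unfolding poly_mult p by (simp add: mult_ac)
    also have "\<dots> = poly (pcompose p [:0, r:] * ([:1, g:] * [:1, d:])) z"
      unfolding prod_linear_shift poly_mult poly_pcompose p by (simp add: mult_ac)
    finally show "poly (p * ([:1, g * r ^ M:] * [:1, d * r ^ (N - M):])) z = poly (pcompose p [:0, r:] * ([:1, g:] * [:1, d:])) z" .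
  qed
  moreover have "[:1, g * r ^ M:] * [:1, d * r ^ (N - M):] = [:1, \<beta>, inverse (of_real q) ^ (N + 1):]"
  proof -
    have "q powr ((real N - 1) / 2 + a) * q powr (- 2 * real M) = q powr (- (real N + 1) / 2) * q powr (a + real N - 2 * real M)"
      unfolding powr_add[symmetric] by (rule arg_cong[where f = "(powr) q"]) (simp add: field_simps)
    then have 1: "g * r ^ M = G * of_real (q powr (a + real N - 2 * real M))"
      unfolding g_def rr G_def mult.assoc of_real_mult[symmetric] by (simp only:)
    have "q powr ((real N - 1) / 2 - a) * q powr (- 2 * real (N - M)) = q powr (- (real N + 1) / 2) * q powr (- (a + real N - 2 * real M))"
      unfolding powr_add[symmetric] using M by (intro arg_cong[where f = "(powr) q"]) (simp add: field_simps of_nat_diff)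
    then have 2: "d * r ^ (N - M) = - (G * of_real (q powr (- (a + real N - 2 * real M))))"
      unfolding d_def rr G_def mult_minus_left mult.assoc of_real_mult[symmetric] by (simp only:)
    have "(q powr (- (real N + 1) / 2) * q powr (a + real N - 2 * real M)) * (q powr (- (real N + 1) / 2) * q powr (- (a + real N - 2 * real M)))
        = q powr (- real (N + 1))"
      unfolding powr_add[symmetric] by (rule arg_cong[where f = "(powr) q"]) (simp add: field_simps)
    also have "\<dots> = inverse q ^ (N + 1)"
      unfolding powr_minus powr_realpow[OF q(1)] power_inverse ..
    finally have "complex_of_real ((q powr (- (real N + 1) / 2) * q powr (a + real N - 2 * real M)) * (q powr (- (real N + 1) / 2) * q powr (- (a + real N - 2 * real M))))
        = of_real (inverse q ^ (N + 1))"
      by (rule arg_cong)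
    then have "complex_of_real (q powr (- (real N + 1) / 2)) * of_real (q powr (a + real N - 2 * real M))
        * (of_real (q powr (- (real N + 1) / 2)) * of_real (q powr (- (a + real N - 2 * real M)))) = inverse (of_real q) ^ (N + 1)"
      by (simp only: of_real_mult of_real_power of_real_inverse)
    then have 3: "(g * r ^ M) * (d * r ^ (N - M)) = inverse (of_real q) ^ (N + 1)"
      unfolding 1 2 G_def by (simp add: mult_ac)
    have "[:1, g * r ^ M:] * [:1, d * r ^ (N - M):] = [:1, g * r ^ M + d * r ^ (N - M), (g * r ^ M) * (d * r ^ (N - M)):]"
      by simp
    also have "g * r ^ M + d * r ^ (N - M) = \<beta>" unfolding 1 2 \<beta>_def by (simp add: right_diff_distrib)
    finally show ?thesis unfolding 3 .
  qed
  moreover have "[:1, g:] * [:1, d:] = [:1, \<alpha> * of_real q ^ N, of_real q ^ N * inverse (of_real q):]"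
  proof -
    have qN: "q powr real N = q ^ N" by (rule powr_realpow[OF q(1)])
    have "q powr ((real N - 1) / 2 + a) = q powr (- (real N + 1) / 2) * q powr a * q powr real N"
      unfolding powr_add[symmetric] by (rule arg_cong[where f = "(powr) q"]) (simp add: field_simps)
    then have 1: "g = G * of_real (q powr a) * of_real q ^ N"
      unfolding g_def G_def qN by (simp add: mult.assoc)
    have "q powr ((real N - 1) / 2 - a) = q powr (- (real N + 1) / 2) * q powr (- a) * q powr real N"
      unfolding powr_add[symmetric] by (rule arg_cong[where f = "(powr) q"]) (simp add: field_simps)
    then have 2: "d = - (G * of_real (q powr (- a)) * of_real q ^ N)"
      unfolding d_def G_def qN by (simp add: mult.assoc)
    have "q powr ((real N - 1) / 2 + a) * q powr ((real N - 1) / 2 - a) = q powr real N * q powr (- 1)"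
      unfolding powr_add[symmetric] by (rule arg_cong[where f = "(powr) q"]) (simp add: field_simps)
    then have "q powr ((real N - 1) / 2 + a) * q powr ((real N - 1) / 2 - a) = q ^ N * inverse q"
      using q unfolding qN by (simp add: powr_minus)
    then have "complex_of_real (q powr ((real N - 1) / 2 + a)) * of_real (q powr ((real N - 1) / 2 - a)) = of_real q ^ N * inverse (of_real q)"
      by (metis of_real_inverse of_real_mult of_real_power)
    then have 3: "g * d = of_real q ^ N * inverse (of_real q)"
      unfolding g_def d_def by (simp add: mult_ac)
    have "[:1, g:] * [:1, d:] = [:1, g + d, g * d:]" by simp
    also have "g + d = \<alpha> * of_real q ^ N" unfolding 1 2 \<alpha>_def by (simp add: algebra_simps)
    finally show ?thesis unfolding 3 .
  qed
  ultimately have eq: "p * [:1, \<beta>, inverse (of_real q) ^ (N + 1):]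
      = pcompose p [:0, r:] * [:1, \<alpha> * of_real q ^ N, of_real q ^ N * inverse (of_real q):]" by simp
  have quad: "coeff (u * [:1, x, y:]) 1 = coeff u 1 + x * coeff u 0"
    "coeff (u * [:1, x, y:]) (m + 2) = coeff u (m + 2) + x * coeff u (m + 1) + y * coeff u m" for u :: "complex poly" and x y m
    by (simp_all add: mult_pCons_right coeff_pCons numeral_2_eq_2 One_nat_def split: nat.splits)
  have e: "coeff (p * [:1, \<beta>, inverse (of_real q) ^ (N + 1):]) k
      = coeff (pcompose p [:0, r:] * [:1, \<alpha> * of_real q ^ N, of_real q ^ N * inverse (of_real q):]) k" for k
    using eq by simp
  have cp: "coeff (pcompose p [:0, r:]) k = r ^ k * c k" for k
    by (simp add: coeff_pcompose_linear c_def p_def)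
  show "(1 - r) * c 1 + (\<beta> - \<alpha> * of_real q ^ N) * c 0 = 0"
    using e[of 1] unfolding quad cp by (simp add: c_def p_def algebra_simps)
  show "(1 - r ^ (m + 2)) * c (m + 2) + (\<beta> - \<alpha> * of_real q ^ N * r ^ (m + 1)) * c (m + 1)
       + (inverse (of_real q) ^ (N + 1) - of_real q ^ N * inverse (of_real q) * r ^ m) * c m = 0"
    using e[of "m + 2"] unfolding quad cp by (simp add: c_def p_def algebra_simps)
qed


text \<open>The normalization of the coordinates: a diagonal rescaling that removes the square roots
  from the matrix entries (\<open>f_entry_weight\<close>, \<open>e_entry_weight\<close>).\<close>

primrec eigen_weight :: "real \<Rightarrow> nat \<Rightarrow> nat \<Rightarrow> real" where
  "eigen_weight q N 0 = 1"
| "eigen_weight q N (Suc m) = eigen_weight q N m * sqrt (qnum q (real m + 1) / qnum q (real N - real m))"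

definition eigen_vec :: "real \<Rightarrow> real \<Rightarrow> nat \<Rightarrow> nat \<Rightarrow> hvec" where
  "eigen_vec q a N M j = (if j \<in> spins (real N / 2) then
     let m = nat \<lfloor>j + real N / 2\<rfloor> in of_real (eigen_weight q N m) * coeff (eigen_poly q a N M) m else 0)"

lemma eigen_vec_coord:
  "m \<le> N \<Longrightarrow> eigen_vec q a N M (real m - real N / 2) = of_real (eigen_weight q N m) * coeff (eigen_poly q a N M) m"
  using spt_in[of m N] by (simp add: eigen_vec_def)

lemma sqrt_mult_divide:
  assumes "x > 0" "y > (0::real)"
  shows "sqrt (x * y) * sqrt (x / y) = x"
proof -
  have "sqrt (x * y) * sqrt (x / y) = sqrt ((x * y) * (x / y))" by (rule real_sqrt_mult[symmetric])
  also have "(x * y) * (x / y) = x^2" using assms by (simp add: power2_eq_square)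
  finally show ?thesis using assms by simp
qed

lemma f_entry_weight:
  assumes "0 < q" "q < 1" "m < N"
  shows "f_entry q N m * eigen_weight q N (Suc m)
    = (q powr (- (real m - real N / 2 + 1)) * qnum q (real m + 1)) * eigen_weight q N m"
  using sqrt_mult_divide[of "qnum q (real m + 1)" "qnum q (real N - real m)"] qnum_pos[OF assms(1,2)] assms(3)
  by (simp add: f_entry_def mult_ac)

lemma e_entry_weight:
  assumes "0 < q" "q < 1" "m < N"
  shows "e_entry q N m * eigen_weight q N m
    = (q powr (real m - real N / 2 + 1) * qnum q (real N - real m)) * eigen_weight q N (Suc m)"
proof -
  have "sqrt (qnum q (real N - real m) * qnum q (real m + 1))
      = qnum q (real N - real m) * sqrt (qnum q (real m + 1) / qnum q (real N - real m))"
  proof -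
    have p: "qnum q (real N - real m) > 0" "qnum q (real m + 1) > 0" using qnum_pos[OF assms(1,2)] assms(3) by simp_all
    have "qnum q (real N - real m) * qnum q (real m + 1)
        = (qnum q (real N - real m))^2 * (qnum q (real m + 1) / qnum q (real N - real m))"
      using p by (simp add: power2_eq_square)
    then have "sqrt (qnum q (real N - real m) * qnum q (real m + 1))
        = sqrt ((qnum q (real N - real m))^2) * sqrt (qnum q (real m + 1) / qnum q (real N - real m))"
      by (simp only: real_sqrt_mult)
    then show ?thesis using p by simp
  qed
  then show ?thesis by (simp add: e_entry_def mult_ac)
qed

text \<open>Up to the common rescaling, coordinate m of the eigenvalue equation is the coefficient
  recurrence of \<open>eigen_poly_recurrence\<close>. The facts \<open>k1\<close>,
  \<open>k2\<close>, \<open>k3\<close> bring the matrix entries into the form that occurs there, and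
  \<open>G\<close> ties the recurrence to \<open>rho q\<close>.\<close>

lemma eigen_vec_eigen:
  fixes q a :: real and N M :: nat
  assumes q: "0 < q" "q < 1" and M: "M \<le> N"
  shows "eigen_vec q a N M \<in> hspace (real N / 2)" "eigen_vec q a N M \<noteq> 0"
    "rep q (real N / 2) (xel q a) (eigen_vec q a N M)
       = vscale (wt q (a + real N - 2 * real M)) (eigen_vec q a N M)"
proof -
  let ?v = "eigen_vec q a N M" and ?c = "coeff (eigen_poly q a N M)"
  let ?pt = "\<lambda>m::nat. real m - real N / 2"
  show H: "?v \<in> hspace (real N / 2)" by (rule hspaceI) (simp add: eigen_vec_def)
  have "?v (?pt 0) = 1" by (subst eigen_vec_coord) (simp_all add: eigen_poly_coeff_0)
  then show "?v \<noteq> 0" by (metis zero_fun_apply zero_neq_one)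
  define b where "b = a + real N - 2 * real M"
  define \<kappa> where "\<kappa> = complex_of_real (inverse (q - inverse q))"
  define S where "S = complex_of_real (q powr (real N / 2))"
  define r where "r = complex_of_real (inverse (q^2))"
  define Q where "Q = complex_of_real q"
  have rk: "inverse (q^2) ^ k = q powr (- 2 * real k)" for k
  proof -
    have "q powr (2 * real k) = q ^ (2 * k)" using powr_realpow[OF q(1), of "2 * k"] by simp
    then show ?thesis by (simp add: powr_minus power_inverse power_mult)
  qed
  have qN: "q powr real N = q ^ N" by (rule powr_realpow[OF q(1)])
  have k1: "complex_of_real (q powr (- (?pt m + 1)) * qnum q (real m + 1)) = \<kappa> * S * (1 - r ^ (m + 1))" for m
  proof -
    have "q powr (- (?pt m + 1)) * q powr (real m + 1) = q powr (real N / 2)"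
      by (simp flip: powr_add)
    moreover have "q powr (- (?pt m + 1)) * q powr (- (real m + 1)) = q powr (real N / 2) * inverse (q^2) ^ (m + 1)"
      unfolding rk powr_add[symmetric] by (rule arg_cong[where f = "(powr) q"]) (simp add: field_simps)
    ultimately have "q powr (- (?pt m + 1)) * qnum q (real m + 1)
        = inverse (q - inverse q) * q powr (real N / 2) * (1 - inverse (q^2) ^ (m + 1))"
      by (simp only: qnum_def divide_inverse right_diff_distrib left_diff_distrib mult.assoc[symmetric]) (simp only: mult_ac mult_1_right)
    then have "complex_of_real (q powr (- (?pt m + 1)) * qnum q (real m + 1))
        = of_real (inverse (q - inverse q) * q powr (real N / 2) * (1 - inverse (q^2) ^ (m + 1)))" by (rule arg_cong)
    then show ?thesis by (simp only: \<kappa>_def S_def r_def of_real_mult of_real_diff of_real_power of_real_1)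
  qed
  have k2: "complex_of_real (q powr (- ?pt (Suc m)) * qnum q (real N - real m))
      = \<kappa> * S * (Q ^ N * inverse Q * r ^ m - inverse Q ^ (N + 1))" for m
  proof -
    have "q powr (- ?pt (Suc m)) * q powr (real N - real m) = q powr (real N / 2) * (q powr real N * q powr (- 1) * q powr (- 2 * real m))"
      unfolding powr_add[symmetric] by (rule arg_cong[where f = "(powr) q"]) (simp add: field_simps)
    moreover have "q powr (- ?pt (Suc m)) * q powr (- (real N - real m)) = q powr (real N / 2) * q powr (- real (N + 1))"
      unfolding powr_add[symmetric] by (rule arg_cong[where f = "(powr) q"]) (simp add: field_simps)
    moreover have "q powr (- real (N + 1)) = inverse q ^ (N + 1)"
      unfolding powr_minus powr_realpow[OF q(1)] power_inverse ..
    moreover have "q powr (- 1) = inverse q" using q by (simp add: powr_minus)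
    ultimately have "q powr (- ?pt (Suc m)) * qnum q (real N - real m)
        = inverse (q - inverse q) * q powr (real N / 2) * (q ^ N * inverse q * inverse (q^2) ^ m - inverse q ^ (N + 1))"
      unfolding rk[symmetric] qN
      by (simp only: qnum_def divide_inverse right_diff_distrib left_diff_distrib mult.assoc[symmetric]) (simp only: mult_ac)
    then have "complex_of_real (q powr (- ?pt (Suc m)) * qnum q (real N - real m))
        = of_real (inverse (q - inverse q) * q powr (real N / 2) * (q ^ N * inverse q * inverse (q^2) ^ m - inverse q ^ (N + 1)))"
      by (rule arg_cong)
    then show ?thesis
      by (simp only: \<kappa>_def S_def r_def Q_def of_real_mult of_real_diff of_real_power of_real_inverse)
  qed
  have k3: "complex_of_real (q powr (- 2 * ?pt m)) = Q ^ N * r ^ m" for m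
  proof -
    have "q powr (- 2 * ?pt m) = q ^ N * inverse (q^2) ^ m"
      unfolding rk qN[symmetric] powr_add[symmetric] by (rule arg_cong[where f = "(powr) q"]) (simp add: field_simps)
    then have "complex_of_real (q powr (- 2 * ?pt m)) = of_real (q ^ N * inverse (q^2) ^ m)" by (rule arg_cong)
    then show ?thesis by (simp only: Q_def r_def of_real_mult of_real_power)
  qed
  define G where "G = \<i> * complex_of_real (q powr (- (real N + 1) / 2))"
  have G: "rho q * S * G = - 1"
  proof -
    have "q powr (1 / 2) * q powr (real N / 2) * q powr (- (real N + 1) / 2) = q powr 0"
      unfolding powr_add[symmetric] by (rule arg_cong[where f = "(powr) q"]) (simp add: field_simps)
    then have "q powr (1 / 2) * q powr (real N / 2) * q powr (- (real N + 1) / 2) = 1" using q by simp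
    then have "complex_of_real (q powr (1 / 2) * q powr (real N / 2) * q powr (- (real N + 1) / 2)) = of_real 1"
      by (rule arg_cong)
    then have "complex_of_real (q powr (1 / 2)) * of_real (q powr (real N / 2)) * of_real (q powr (- (real N + 1) / 2)) = 1"
      by (simp only: of_real_mult of_real_1)
    then show ?thesis by (simp add: rho_def S_def G_def mult_ac)
  qed
  define \<alpha> \<beta> where "\<alpha> = G * (of_real (q powr a) - of_real (q powr (- a)))"
    and "\<beta> = G * (of_real (q powr b) - of_real (q powr (- b)))"
  have wt: "rho q * S * \<kappa> * \<alpha> = - wt q a" "rho q * S * \<kappa> * \<beta> = - wt q b"
  proof -
    have gen: "wt q x = \<kappa> * (of_real (q powr x) - of_real (q powr (- x)))" for x
      by (simp add: wt_def qnum_def \<kappa>_def divide_inverse mult.commute)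
    have "rho q * S * \<kappa> * (G * z) = (rho q * S * G) * (\<kappa> * z)" for z by (simp only: mult_ac)
    then show "rho q * S * \<kappa> * \<alpha> = - wt q a" "rho q * S * \<kappa> * \<beta> = - wt q b"
      unfolding \<alpha>_def \<beta>_def gen G by simp_all
  qed
  have rec0: "(1 - r) * ?c 1 + (\<beta> - \<alpha> * Q ^ N) * ?c 0 = 0"
    and rec: "(1 - r ^ (m + 2)) * ?c (m + 2) + (\<beta> - \<alpha> * Q ^ N * r ^ (m + 1)) * ?c (m + 1)
       + (inverse Q ^ (N + 1) - Q ^ N * inverse Q * r ^ m) * ?c m = 0" for m
    using eigen_poly_recurrence(1)[OF q M, where a = a, folded G_def b_def] eigen_poly_recurrence(2)[OF q M, where a = a and m = m]
    by (simp_all add: \<alpha>_def \<beta>_def Q_def r_def G_def b_def)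
  show "rep q (real N / 2) (xel q a) ?v = vscale (wt q (a + real N - 2 * real M)) ?v"
    unfolding b_def[symmetric]
  proof (rule hspace_eqI[of _ N])
    show "rep q (real N / 2) (xel q a) ?v \<in> hspace (real N / 2)" "vscale (wt q b) ?v \<in> hspace (real N / 2)"
      using H by (simp_all add: rep_hspace hspace_scale)
    fix m assume m: "m \<le> N"
    let ?w = "complex_of_real (eigen_weight q N m)"
    have F: "rep q (real N / 2) gf ?v (?pt m) = \<kappa> * S * (1 - r ^ (m + 1)) * ?c (m + 1) * ?w"
    proof (cases "m = N")
      case True
      \<comment> \<open>At the highest vector f contributes nothing, which matches the coefficient
        beyond the degree.\<close>
      have "?c (N + 1) = 0" using eigen_poly_degree[OF M, of q a] by (intro coeff_eq_0) simp
      then show ?thesis using True F_coord_N[of q N ?v] by simp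
    next
      case False
      then have m': "m < N" using m by simp
      have "rep q (real N / 2) gf ?v (?pt m) = of_real (f_entry q N m * eigen_weight q N (Suc m)) * ?c (m + 1)"
        using F_coord[OF m', of q ?v] eigen_vec_coord[of "Suc m" N q a M] m' by (simp del: eigen_weight.simps)
      then show ?thesis unfolding f_entry_weight[OF q m'] of_real_mult[of _ "eigen_weight q N m"] k1 by simp
    qed
    have KE: "rep q (real N / 2) gki (rep q (real N / 2) ge ?v) (?pt m)
        = (case m of 0 \<Rightarrow> 0 | Suc m' \<Rightarrow> \<kappa> * S * (Q ^ N * inverse Q * r ^ m' - inverse Q ^ (N + 1)) * ?c m' * ?w)"
    proof (cases m)
      case 0
      then show ?thesis using Ki_coord[OF m, of q "rep q (real N / 2) ge ?v"] E_coord_0[of q N ?v] by simp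
    next
      case (Suc m')
      then have m': "m' < N" using m by simp
      have "rep q (real N / 2) gki (rep q (real N / 2) ge ?v) (?pt m)
          = of_real (q powr (- 2 * ?pt m)) * (of_real (e_entry q N m' * eigen_weight q N m') * ?c m')"
        using Ki_coord[OF m, of q "rep q (real N / 2) ge ?v"] E_coord_Suc[OF m', of q ?v] eigen_vec_coord[of m' N q a M] m' Suc
        by simp
      also have "e_entry q N m' * eigen_weight q N m' = (q powr ?pt m * qnum q (real N - real m')) * eigen_weight q N m"
        using e_entry_weight[OF q m'] Suc by (simp add: algebra_simps)
      also have "of_real (q powr (- 2 * ?pt m)) * (complex_of_real ((q powr ?pt m * qnum q (real N - real m')) * eigen_weight q N m) * ?c m')
          = complex_of_real (q powr (- ?pt m) * qnum q (real N - real m')) * ?c m' * ?w"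
      proof -
        have "q powr (- 2 * ?pt m) * q powr ?pt m = q powr (- ?pt m)"
          unfolding powr_add[symmetric] by (rule arg_cong[where f = "(powr) q"]) (simp add: field_simps)
        then have "complex_of_real (q powr (- 2 * ?pt m)) * of_real (q powr ?pt m) = of_real (q powr (- ?pt m))"
          by (metis of_real_mult)
        then show ?thesis by (simp only: of_real_mult) (simp only: mult_ac)
      qed
      finally show ?thesis unfolding Suc k2 by simp
    qed
    have Ki: "rep q (real N / 2) gki ?v (?pt m) = Q ^ N * r ^ m * ?c m * ?w"
      using Ki_coord[OF m, of q ?v] eigen_vec_coord[OF m, of q a M] unfolding k3 by simp
    define e where "e = (case m of 0 \<Rightarrow> 0 | Suc m' \<Rightarrow> (Q ^ N * inverse Q * r ^ m' - inverse Q ^ (N + 1)) * ?c m')"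
    have KE': "rep q (real N / 2) gki (rep q (real N / 2) ge ?v) (?pt m) = \<kappa> * S * e * ?w"
      unfolding KE e_def by (simp split: nat.split)
    have rec': "(1 - r ^ (m + 1)) * ?c (m + 1) - e = - (\<beta> - \<alpha> * Q ^ N * r ^ m) * ?c m"
    proof (cases m)
      case 0
      then show ?thesis using rec0 by (simp add: e_def algebra_simps)
    next
      case (Suc m')
      then have e: "e = - ((inverse Q ^ (N + 1) - Q ^ N * inverse Q * r ^ m') * ?c m')"
        by (simp add: e_def algebra_simps)
      have gen: "x - - z = - y * c" if "x + y * c + z = 0" for x y z c :: complex
        using that by (simp add: eq_neg_iff_add_eq_0 add_ac)
      have m2: "m + 1 = m' + 2" "m = m' + 1" using Suc by simp_all
      show ?thesis unfolding e m2(1) unfolding m2(2) by (rule gen[OF rec])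
    qed
    have "rep q (real N / 2) (xel q a) ?v (?pt m)
        = rho q * (\<kappa> * S * (1 - r ^ (m + 1)) * ?c (m + 1) * ?w - \<kappa> * S * e * ?w) + wt q a * (Q ^ N * r ^ m * ?c m * ?w)"
      unfolding xel_def rep_add_left rep_mult rep_scal rep_diff plus_fun_apply vscale_apply minus_apply F KE' Ki ..
    also have "\<dots> = rho q * S * \<kappa> * ((1 - r ^ (m + 1)) * ?c (m + 1) - e) * ?w + wt q a * (Q ^ N * r ^ m * ?c m * ?w)"
      by (simp only: right_diff_distrib left_diff_distrib mult_ac)
    also have "\<dots> = (- (rho q * S * \<kappa> * \<beta>) + (rho q * S * \<kappa> * \<alpha>) * (Q ^ N * r ^ m) + wt q a * (Q ^ N * r ^ m)) * ?c m * ?w"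
    proof -
      have gen: "k * (- (\<beta> - \<alpha> * X * Y) * c) * w + t * (X * Y * c * w)
          = (- (k * \<beta>) + (k * \<alpha>) * (X * Y) + t * (X * Y)) * c * w" for k X Y c w t
        by (simp add: algebra_simps)
      show ?thesis unfolding rec' by (rule gen)
    qed
    also have "\<dots> = vscale (wt q b) ?v (?pt m)"
      unfolding wt eigen_vec_coord[OF m] vscale_apply by (simp add: mult_ac)
    finally show "rep q (real N / 2) (xel q a) ?v (?pt m) = vscale (wt q b) ?v (?pt m)" .
  qed
qed

section \<open>The Podles sphere\<close>

lemma half_nats_iff: "s \<in> half_nats \<longleftrightarrow> (\<exists>N. s = real N / 2)"
  by (auto simp: half_nats_def)

lemma Oq_induct [consumes 1, case_names zero add scale mcoef]:
  assumes "x \<in> Oq q" and "P 0" and "\<And>x y. P x \<Longrightarrow> P y \<Longrightarrow> P (x + y)" and "\<And>c x. P x \<Longrightarrow> P (vscale c x)"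
    and "\<And>N \<xi> \<zeta>. \<xi> \<in> hspace (real N / 2) \<Longrightarrow> \<zeta> \<in> hspace (real N / 2) \<Longrightarrow> P (mcoef q (real N / 2) \<xi> \<zeta>)"
  shows "P x"
proof -
  interpret vs: vector_space "vscale :: complex \<Rightarrow> func \<Rightarrow> func" by (rule vector_space_vscale)
  have "x \<in> vs.span {mcoef q s \<xi> \<eta> | s \<xi> \<eta>. s \<in> half_nats \<and> \<xi> \<in> hspace s \<and> \<eta> \<in> hspace s}"
    using assms(1) by (simp add: Oq_def ascale_eq_vscale)
  then show ?thesis
  proof (induction rule: vs.span_induct_alt)
    case (step c x y)
    then obtain s \<xi> \<zeta> N where "x = mcoef q s \<xi> \<zeta>" "s = real N / 2" "\<xi> \<in> hspace s" "\<zeta> \<in> hspace s"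
      unfolding half_nats_iff by blast
    then have "P x" using assms(5) by blast
    then show ?case using step assms(3,4) by blast
  qed (rule assms(2))
qed

lemma Oq_mcoef: "\<xi> \<in> hspace (real N / 2) \<Longrightarrow> \<zeta> \<in> hspace (real N / 2) \<Longrightarrow> mcoef q (real N / 2) \<xi> \<zeta> \<in> Oq q"
  and Oq_add: "x \<in> Oq q \<Longrightarrow> y \<in> Oq q \<Longrightarrow> x + y \<in> Oq q"
  and Oq_scale: "x \<in> Oq q \<Longrightarrow> vscale c x \<in> Oq q"
  and Oq_zero: "0 \<in> Oq q"
proof -
  interpret vs: vector_space "vscale :: complex \<Rightarrow> func \<Rightarrow> func" by (rule vector_space_vscale)
  show "\<xi> \<in> hspace (real N / 2) \<Longrightarrow> \<zeta> \<in> hspace (real N / 2) \<Longrightarrow> mcoef q (real N / 2) \<xi> \<zeta> \<in> Oq q"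
    unfolding Oq_def ascale_eq_vscale half_nats_iff by (rule vs.span_base) blast
  show "x \<in> Oq q \<Longrightarrow> y \<in> Oq q \<Longrightarrow> x + y \<in> Oq q" "x \<in> Oq q \<Longrightarrow> vscale c x \<in> Oq q" "0 \<in> Oq q"
    unfolding Oq_def ascale_eq_vscale by (rule vs.span_add vs.span_scale vs.span_zero; assumption?)+
qed

lemma uq_functional_zero: "uq_functional q 0"
  by (simp add: uq_functional_def func_linear_def zero_fun_apply)

lemma Oq_uq_functional:
  assumes "0 < q" "q < 1" "x \<in> Oq q"
  shows "uq_functional q x"
  using assms(3)
proof (induction rule: Oq_induct)
  case (scale c x)
  then show ?case using uq_functional_ascale[of q x c] by (simp add: ascale_eq_vscale)
qed (simp_all add: uq_functional_zero uq_functional_add uq_functional_mcoef[OF assms(1,2)])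

lemma counit_Bt: "counit (Bt q a) = - \<i> * wt q a"
proof -
  have "counit (Bt q a) = - (\<i> * of_real (inverse (q - inverse q) * tpar q a))"
    by (simp add: Bt_def counit_mult func_linearD(5)[OF counit_linear])
  also have "inverse (q - inverse q) * tpar q a = qnum q a"
    by (simp add: qnum_def tpar_def divide_inverse mult.commute)
  finally show ?thesis by (simp add: wt_def)
qed

text \<open>A functional on U cannot distinguish \<open>xel\<close> from i R(B_t), and the counit of
  B_t is -i[a].\<close>

lemma podles_iff:
  assumes q: "0 < q" "q < 1"
  shows "x \<in> podles q a \<longleftrightarrow> x \<in> Oq q \<and> (\<forall>g. x (g * xel q a) = wt q a * x g)"
proof -
  have "lact (RBt q a) x = ascale (counit (Bt q a)) x \<longleftrightarrow> (\<forall>g. x (g * xel q a) = wt q a * x g)"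
    if x: "uq_functional q x"
  proof -
    have xl: "func_linear x" using x by (simp add: uq_functional_def)
    have "x (g * xel q a) = \<i> * x (g * RBt q a)" for g
    proof -
      have "x (g * xel q a) = x (g * (scal \<i> * RBt q a))"
        using uq_functional_cong2[OF x uq_eq_xel[OF q(1), of a], of g 1] by simp
      also have "\<dots> = x (scal \<i> * (g * RBt q a))" by (simp add: scal_commute[of g] flip: mult.assoc)
      finally show ?thesis by (simp add: func_linearD(2)[OF xl])
    qed
    moreover have "x (g * RBt q a) = - \<i> * wt q a * x g \<longleftrightarrow> \<i> * x (g * RBt q a) = wt q a * x g" for g
    proof
      assume "\<i> * x (g * RBt q a) = wt q a * x g"
      then have "- \<i> * (\<i> * x (g * RBt q a)) = - \<i> * (wt q a * x g)" by simp
      then show "x (g * RBt q a) = - \<i> * wt q a * x g" by (simp flip: mult.assoc)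
    qed (simp flip: mult.assoc)
    ultimately show ?thesis by (simp only: lact_def ascale_def fun_eq_iff counit_Bt)
  qed
  then show ?thesis using Oq_uq_functional[OF q] by (auto simp: podles_def)
qed

lemma podles_add: "0 < q \<Longrightarrow> q < 1 \<Longrightarrow> x \<in> podles q a \<Longrightarrow> y \<in> podles q a \<Longrightarrow> x + y \<in> podles q a"
  and podles_scale: "0 < q \<Longrightarrow> q < 1 \<Longrightarrow> x \<in> podles q a \<Longrightarrow> vscale c x \<in> podles q a"
  and podles_zero: "0 < q \<Longrightarrow> q < 1 \<Longrightarrow> 0 \<in> podles q a"
  by (simp_all add: podles_iff Oq_add Oq_scale Oq_zero plus_fun_apply vscale_apply zero_fun_apply distrib_left)

subsection \<open>The spherical basis\<close>

lemma half_even: "real (2 * n) / 2 = real n"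
  by simp

context
  fixes q a :: real and \<eta> :: "nat \<Rightarrow> int \<Rightarrow> hvec"
  assumes q: "0 < q" "q < 1" and \<eta>: "eigenvector_family q a \<eta>"
begin

lemma eta:
  assumes "\<bar>j\<bar> \<le> int n"
  shows "\<eta> n j \<in> hspace (real n)" "hinner (real n) (\<eta> n j) (\<eta> n j) = 1"
    "rep q (real n) (xel q a) (\<eta> n j) = vscale (wt q (a + 2 * of_int j)) (\<eta> n j)"
proof -
  show h: "\<eta> n j \<in> hspace (real n)" "hinner (real n) (\<eta> n j) (\<eta> n j) = 1"
    using \<eta> assms by (auto simp: eigenvector_family_def)
  have "rep q (real n) (xel q a) (\<eta> n j) = rep q (real n) (scal \<i> * RBt q a) (\<eta> n j)"
    using rep_cong[OF q, of "\<eta> n j" "2 * n"] h uq_eq_xel[OF q(1), of a] unfolding half_even by (metis uq_eq_sym)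
  also have "\<dots> = vscale (wt q (a + 2 * of_int j)) (\<eta> n j)"
    using \<eta> assms by (simp add: eigenvector_family_def vscale_def wt_def)
  finally show "rep q (real n) (xel q a) (\<eta> n j) = vscale (wt q (a + 2 * of_int j)) (\<eta> n j)" .
qed

lemma eta_nonzero: "\<bar>j\<bar> \<le> int n \<Longrightarrow> \<eta> n j \<noteq> 0"
  using eta(2)[of j n] by (auto simp: hinner_zero)

lemma eta_zero [simp]: "\<eta> n 0 \<in> hspace (real n)" "hinner (real n) (\<eta> n 0) (\<eta> n 0) = 1"
    "rep q (real n) (xel q a) (\<eta> n 0) = vscale (wt q a) (\<eta> n 0)"
  using eta[of 0 n] by simp_all

lemma hspace_rep_n: "v \<in> hspace (real n) \<Longrightarrow> rep q (real n) h v \<in> hspace (real n)"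
  using rep_hspace[of v "2 * n" q h] unfolding half_even .

lemma hinner_xel_n: "v \<in> hspace (real n) \<Longrightarrow> w \<in> hspace (real n) \<Longrightarrow>
   hinner (real n) v (rep q (real n) (xel q a) w) = hinner (real n) (rep q (real n) (xel q a) v) w"
  using hinner_xel[OF q, of v "2 * n" w a] unfolding half_even .

lemma cnj_wt: "cnj (wt q x) = wt q x"
  by (simp add: wt_def)

lemma sph_left:
  assumes "\<bar>j\<bar> \<le> int n"
  shows "sph q \<eta> n j (xel q a * g) = wt q (a + 2 * of_int j) * sph q \<eta> n j g"
  using eta[OF assms] hinner_xel_n[of "\<eta> n j" n "rep q (real n) g (\<eta> n 0)"] hspace_rep_n[of "\<eta> n 0" n g]
  by (simp add: sph_def mcoef_def rep_mult hinner_scale_left cnj_wt)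

lemma sph_right: "sph q \<eta> n j (g * xel q a) = wt q a * sph q \<eta> n j g"
  by (simp add: sph_def mcoef_def rep_mult rep_scale hinner_scale)

lemma sph_podles: "\<bar>j\<bar> \<le> int n \<Longrightarrow> sph q \<eta> n j \<in> podles q a"
  using Oq_mcoef[of "\<eta> n j" "2 * n" "\<eta> n 0" q] eta(1)[of j n]
  by (simp add: podles_iff[OF q] sph_right) (simp add: sph_def)

text \<open>At 1 left and right multiplication by X agree, so the value is the same after scaling by
  [a + 2j] and by [a].\<close>

lemma sph_1: "\<bar>j\<bar> \<le> int n \<Longrightarrow> sph q \<eta> n j 1 = (if j = 0 then 1 else 0)"
proof -
  assume j: "\<bar>j\<bar> \<le> int n"
  have "wt q (a + 2 * of_int j) * sph q \<eta> n j 1 = wt q a * sph q \<eta> n j 1"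
    using sph_left[OF j, of 1] sph_right[of n j 1] by simp
  moreover have "wt q (a + 2 * of_int j) \<noteq> wt q a" if "j \<noteq> 0"
    using wt_inj[OF q, of "a + 2 * of_int j" a] that by auto
  ultimately have "j \<noteq> 0 \<Longrightarrow> sph q \<eta> n j 1 = 0" by auto
  then show ?thesis by (auto simp: sph_def mcoef_def rep_1)
qed

text \<open>A splitting into eigenfunctionals of \<open>lact (xel q a)\<close>; odd r come from
  half-integral spins. Only the component at r = 0 is tied to spherical elements, because for
  elements of the sphere it is the whole functional (\<open>podles_span\<close>).\<close>

definition decomposable :: "func \<Rightarrow> bool" where
  "decomposable x \<longleftrightarrow> (\<exists>R y. finite R \<and> (\<forall>r. r \<notin> R \<longrightarrow> y r = 0) \<and> x = (\<Sum>r\<in>R. y r) \<and>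
     (\<forall>r::int. lact (xel q a) (y r) = vscale (wt q (a + of_int r)) (y r)) \<and>
     y 0 \<in> module.span vscale {sph q \<eta> n j |n j. \<bar>j\<bar> \<le> int n})"

lemma decomposableE:
  assumes "decomposable x"
  obtains R y where "finite R" "\<And>r. r \<notin> R \<Longrightarrow> y r = 0" "x = (\<Sum>r\<in>R. y r)"
     "\<And>r::int. lact (xel q a) (y r) = vscale (wt q (a + of_int r)) (y r)"
     "y 0 \<in> module.span vscale {sph q \<eta> n j |n j. \<bar>j\<bar> \<le> int n}"
proof -
  obtain R and y :: "int \<Rightarrow> func" where *: "finite R \<and> (\<forall>r. r \<notin> R \<longrightarrow> y r = 0) \<and> x = (\<Sum>r\<in>R. y r) \<and>
     (\<forall>r::int. lact (xel q a) (y r) = vscale (wt q (a + of_int r)) (y r)) \<and>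
     y 0 \<in> module.span vscale {sph q \<eta> n j |n j. \<bar>j\<bar> \<le> int n}"
    using assms unfolding decomposable_def by (elim exE)
  show ?thesis by (rule that[of R y]) (use * in auto)
qed

lemma lact_add: "lact h (x + y) = lact h x + lact h y" and lact_scale: "lact h (vscale c x) = vscale c (lact h x)"
  and lact_zero: "lact h 0 = 0"
  by (simp_all add: lact_def fun_simps vscale_apply)

lemma decomposable_single:
  assumes "lact (xel q a) x = vscale (wt q (a + of_int r)) x"
    and "r = 0 \<Longrightarrow> x \<in> module.span vscale {sph q \<eta> n j |n j. \<bar>j\<bar> \<le> int n}"
  shows "decomposable x"
proof -
  interpret vs: vector_space "vscale :: complex \<Rightarrow> func \<Rightarrow> func" by (rule vector_space_vscale)
  show ?thesis unfolding decomposable_def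
    by (rule exI[of _ "{r}"], rule exI[of _ "\<lambda>r'. if r' = r then x else 0"])
       (use assms in \<open>auto simp: lact_zero vscale_simps vs.span_zero\<close>)
qed

lemma decomposable_add:
  assumes "decomposable x" and "decomposable x'"
  shows "decomposable (x + x')"
proof -
  interpret vs: vector_space "vscale :: complex \<Rightarrow> func \<Rightarrow> func" by (rule vector_space_vscale)
  obtain R y where y: "finite R" "\<And>r. r \<notin> R \<Longrightarrow> y r = 0" "x = (\<Sum>r\<in>R. y r)"
     "\<And>r::int. lact (xel q a) (y r) = vscale (wt q (a + of_int r)) (y r)"
     "y 0 \<in> module.span vscale {sph q \<eta> n j |n j. \<bar>j\<bar> \<le> int n}" by (rule decomposableE[OF assms(1)], rule that)
  obtain R' y' where y': "finite R'" "\<And>r. r \<notin> R' \<Longrightarrow> y' r = 0" "x' = (\<Sum>r\<in>R'. y' r)"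
     "\<And>r::int. lact (xel q a) (y' r) = vscale (wt q (a + of_int r)) (y' r)"
     "y' 0 \<in> module.span vscale {sph q \<eta> n j |n j. \<bar>j\<bar> \<le> int n}" by (rule decomposableE[OF assms(2)], rule that)
  have "x = (\<Sum>r\<in>R \<union> R'. y r)" unfolding y(3) by (rule sum.mono_neutral_left) (use y y' in auto)
  moreover have "x' = (\<Sum>r\<in>R \<union> R'. y' r)" unfolding y'(3) by (rule sum.mono_neutral_left) (use y y' in auto)
  ultimately have s: "x + x' = (\<Sum>r\<in>R \<union> R'. y r + y' r)" by (simp add: sum.distrib)
  show ?thesis unfolding decomposable_def
    by (rule exI[of _ "R \<union> R'"], rule exI[of _ "\<lambda>r. y r + y' r"])
       (use y(1,2,4,5) y'(1,2,4,5) s in \<open>auto simp: lact_add vscale_simps vs.span_add\<close>)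
qed

lemma decomposable_scale:
  assumes "decomposable x"
  shows "decomposable (vscale c x)"
proof -
  interpret vs: vector_space "vscale :: complex \<Rightarrow> func \<Rightarrow> func" by (rule vector_space_vscale)
  obtain R y where y: "finite R" "\<And>r. r \<notin> R \<Longrightarrow> y r = 0" "x = (\<Sum>r\<in>R. y r)"
     "\<And>r::int. lact (xel q a) (y r) = vscale (wt q (a + of_int r)) (y r)"
     "y 0 \<in> module.span vscale {sph q \<eta> n j |n j. \<bar>j\<bar> \<le> int n}" by (rule decomposableE[OF assms(1)], rule that)
  show ?thesis unfolding decomposable_def
    by (rule exI[of _ "R"], rule exI[of _ "\<lambda>r. vscale c (y r)"])
       (use y(1,2,4,5) in \<open>auto simp: y(3) vscale_sum lact_scale vscale_simps mult.commute vs.span_scale\<close>)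
qed

lemma decomposable_zero: "decomposable 0"
  using decomposable_single[of 0 1] by (simp add: lact_zero vscale_simps)

lemma decomposable_sum: "(\<And>i. i \<in> I \<Longrightarrow> decomposable (f i)) \<Longrightarrow> decomposable (\<Sum>i\<in>I. f i)"
  by (induction I rule: infinite_finite_induct) (simp_all add: decomposable_zero decomposable_add)

lemma mcoef_expand_right: "mcoef q s \<xi> (\<Sum>k\<in>K. vscale (c k) (e k)) = (\<Sum>k\<in>K. vscale (c k) (mcoef q s \<xi> (e k)))"
  by (simp add: fun_eq_iff fun_sum_apply vscale_apply mcoef_def rep_sum rep_scale hinner_sum hinner_scale)

lemma mcoef_expand_left: "mcoef q s (\<Sum>k\<in>K. vscale (c k) (e k)) \<zeta> = (\<Sum>k\<in>K. vscale (cnj (c k)) (mcoef q s (e k) \<zeta>))"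
proof -
  have "hinner s (\<Sum>k\<in>K. vscale (c k) (e k)) w = (\<Sum>k\<in>K. cnj (c k) * hinner s (e k) w)" for w
  proof -
    have "cnj (hinner s w (\<Sum>k\<in>K. vscale (c k) (e k))) = (\<Sum>k\<in>K. cnj (c k) * hinner s (e k) w)"
      unfolding hinner_sum hinner_scale by (simp add: hinner_cnj)
    then show ?thesis by (simp add: hinner_cnj)
  qed
  then show ?thesis by (simp add: fun_eq_iff fun_sum_apply vscale_apply mcoef_def)
qed

lemma wt_family_inj: "inj_on (\<lambda>k::nat. wt q (a + real N - 2 * real k)) K"
  by (rule inj_onI) (drule wt_inj[OF q], simp)

lemma eta_spans:
  assumes "v \<in> hspace (real n)"
  shows "\<exists>c. v = (\<Sum>k\<le>2 * n. vscale (c k) (\<eta> n (int n - int k)))"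
proof (rule eigenbasis_spans[OF q, of "2 * n", unfolded half_even])
  fix k assume "k \<le> 2 * n"
  then have k: "\<bar>int n - int k\<bar> \<le> int n" by simp
  show "\<eta> n (int n - int k) \<in> hspace (real n)" "\<eta> n (int n - int k) \<noteq> 0"
    using eta(1)[OF k] eta_nonzero[OF k] by auto
  show "rep q (real n) (xel q a) (\<eta> n (int n - int k)) = vscale (wt q (a + real (2 * n) - 2 * real k)) (\<eta> n (int n - int k))"
    using eta(3)[OF k] by (simp add: algebra_simps)
qed (use assms wt_family_inj[of "2 * n"] in auto)

text \<open>Expanding \<zeta> in eigenvectors of X gives the components. For even N the one of
  weight [a] becomes spherical after expanding \<xi> as well; for odd N parity excludes the weight
  [a].\<close>

lemma decomposable_mcoef:
  assumes "\<xi> \<in> hspace (real N / 2)" and "\<zeta> \<in> hspace (real N / 2)"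
  shows "decomposable (mcoef q (real N / 2) \<xi> \<zeta>)"
proof -
  interpret vs: vector_space "vscale :: complex \<Rightarrow> func \<Rightarrow> func" by (rule vector_space_vscale)
  have eigen: "lact (xel q a) (mcoef q s \<xi> v) = vscale (wt q (a + of_int r)) (mcoef q s \<xi> v)"
    if "rep q s (xel q a) v = vscale (wt q (a + of_int r)) v" for s v r
    by (rule ext) (simp only: lact_def mcoef_def rep_mult that rep_scale hinner_scale vscale_apply)
  show ?thesis
  proof (cases "even N")
    case True
    then obtain n where N: "N = 2 * n" by (elim evenE)
    have \<zeta>: "\<zeta> \<in> hspace (real n)" and \<xi>: "\<xi> \<in> hspace (real n)" using assms unfolding N half_even by auto
    obtain c where c: "\<zeta> = (\<Sum>k\<le>2 * n. vscale (c k) (\<eta> n (int n - int k)))" using eta_spans[OF \<zeta>] by blast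
    obtain d where d: "\<xi> = (\<Sum>k\<le>2 * n. vscale (d k) (\<eta> n (int n - int k)))" using eta_spans[OF \<xi>] by blast
    have "decomposable (mcoef q (real n) \<xi> (\<eta> n (int n - int k)))" if "k \<le> 2 * n" for k
    proof (rule decomposable_single)
      have k: "\<bar>int n - int k\<bar> \<le> int n" using that by simp
      show "lact (xel q a) (mcoef q (real n) \<xi> (\<eta> n (int n - int k)))
          = vscale (wt q (a + of_int (2 * (int n - int k)))) (mcoef q (real n) \<xi> (\<eta> n (int n - int k)))"
        using eta(3)[OF k] by (intro eigen) simp
      assume "2 * (int n - int k) = 0"
      then have "int n - int k = 0" by simp
      then have "mcoef q (real n) \<xi> (\<eta> n (int n - int k)) = (\<Sum>i\<le>2 * n. vscale (cnj (d i)) (sph q \<eta> n (int n - int i)))"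
        unfolding d mcoef_expand_left by (simp add: sph_def)
      also have "\<dots> \<in> vs.span {sph q \<eta> n j |n j. \<bar>j\<bar> \<le> int n}"
      proof (intro vs.span_sum vs.span_scale vs.span_base)
        fix i assume "i \<in> {..2 * n}"
        then have "\<bar>int n - int i\<bar> \<le> int n" by simp
        then show "sph q \<eta> n (int n - int i) \<in> {sph q \<eta> n j |n j. \<bar>j\<bar> \<le> int n}" by blast
      qed
      finally show "mcoef q (real n) \<xi> (\<eta> n (int n - int k)) \<in> vs.span {sph q \<eta> n j |n j. \<bar>j\<bar> \<le> int n}" .
    qed
    then show ?thesis unfolding N half_even c mcoef_expand_right
      by (intro decomposable_sum decomposable_scale) simp
  next
    case False
    have "\<exists>c. \<zeta> = (\<Sum>k\<le>N. vscale (c k) (eigen_vec q a N k))"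
      by (rule eigenbasis_spans[OF q, where \<mu> = "\<lambda>k. wt q (a + real N - 2 * real k)"])
         (use eigen_vec_eigen[OF q] assms(2) wt_family_inj in auto)
    then obtain c where c: "\<zeta> = (\<Sum>k\<le>N. vscale (c k) (eigen_vec q a N k))" by blast
    have "decomposable (mcoef q (real N / 2) \<xi> (eigen_vec q a N k))" if "k \<le> N" for k
    proof (rule decomposable_single)
      show "lact (xel q a) (mcoef q (real N / 2) \<xi> (eigen_vec q a N k))
          = vscale (wt q (a + of_int (int N - 2 * int k))) (mcoef q (real N / 2) \<xi> (eigen_vec q a N k))"
        using eigen_vec_eigen(3)[OF q that, of a] by (intro eigen) (simp add: algebra_simps)
      assume "int N - 2 * int k = 0"
      then have "N = 2 * k" by simp
      then show "mcoef q (real N / 2) \<xi> (eigen_vec q a N k) \<in> vs.span {sph q \<eta> n j |n j. \<bar>j\<bar> \<le> int n}"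
        using False by simp
    qed
    then show ?thesis unfolding c mcoef_expand_right
      by (intro decomposable_sum decomposable_scale) simp
  qed
qed

lemma podles_span:
  assumes "x \<in> podles q a"
  shows "x \<in> module.span vscale {sph q \<eta> n j |n j. \<bar>j\<bar> \<le> int n}"
proof -
  have xO: "x \<in> Oq q" and xr: "lact (xel q a) x = vscale (wt q a) x"
    using assms by (auto simp: podles_iff[OF q] lact_def fun_eq_iff vscale_apply)
  have dec: "decomposable x" using xO
    by (induction rule: Oq_induct) (simp_all add: decomposable_zero decomposable_add decomposable_scale decomposable_mcoef)
  obtain R y where y: "finite R" "\<And>r. r \<notin> R \<Longrightarrow> y r = 0" "x = (\<Sum>r\<in>R. y r)"
     "\<And>r::int. lact (xel q a) (y r) = vscale (wt q (a + of_int r)) (y r)"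
     "y 0 \<in> module.span vscale {sph q \<eta> n j |n j. \<bar>j\<bar> \<le> int n}" by (rule decomposableE[OF dec], rule that)
  \<comment> \<open>Subtracting x from the component at 0 gives eigenvectors of distinct weights
    whose sum is zero.\<close>
  define z where "z r = y r + (if r = 0 then vscale (- 1) x else 0)" for r
  have "z 0 = 0"
  proof (rule eigenvectors_independent[of "lact (xel q a)" "insert 0 R" "\<lambda>r. wt q (a + of_int r)" z])
    show "inj_on (\<lambda>r::int. wt q (a + of_int r)) (insert 0 R)"
      by (rule inj_onI) (drule wt_inj[OF q], simp)
    show "lact (xel q a) (z r) = vscale (wt q (a + of_int r)) (z r)" for r
      using y(4)[of r] xr by (simp add: z_def lact_add lact_scale lact_zero vscale_simps)
    have "(\<Sum>r\<in>insert 0 R. z r) = (\<Sum>r\<in>insert 0 R. y r) + (\<Sum>r\<in>insert 0 R. if r = 0 then vscale (- 1) x else 0)"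
      by (simp add: z_def sum.distrib)
    also have "(\<Sum>r\<in>insert 0 R. y r) = x" unfolding y(3) by (rule sum.mono_neutral_right) (use y in auto)
    also have "(\<Sum>r\<in>insert 0 R. if r = 0 then vscale (- 1) x else 0) = vscale (- 1) x"
      using y(1) by (simp add: sum.delta)
    finally show "(\<Sum>r\<in>insert 0 R. z r) = 0" by (simp add: fun_simps vscale_apply)
  qed (use y(1) lact_add lact_scale in auto)
  then have "y 0 = x" by (simp add: z_def fun_simps vscale_apply eq_neg_iff_add_eq_0[symmetric])
  then show ?thesis using y(5) by simp
qed

end

subsection \<open>Closure under the involution\<close>

lemma anti_ext_mult:
  assumes "\<iota> 0 = 0" and "\<And>c d. \<iota> (c + d) = \<iota> c + \<iota> d"
    and "\<And>c d. \<iota> (c * d) = \<iota> c * \<iota> d" and "\<And>c x. x * \<iota> c = \<iota> c * x"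
  shows "anti_ext \<iota> G (g * h) = anti_ext \<iota> G h * anti_ext \<iota> G g"
proof (induction g rule: falg_induct)
  case (add g g')
  then show ?case by (simp add: anti_ext_add[OF assms(1,2)] distrib_right distrib_left)
next
  case (single v c)
  show ?case
  proof (induction h rule: falg_induct)
    case (add g g')
    then show ?case by (simp add: anti_ext_add[OF assms(1,2)] distrib_left distrib_right)
  next
    case (single w d)
    let ?v = "prod_list (map G (rev v))" and ?w = "prod_list (map G (rev w))"
    have "\<iota> c * \<iota> d * (?w * ?v) = \<iota> d * ?w * (\<iota> c * ?v)"
      using assms(4)[of "\<iota> d * ?w" c] assms(4)[of "\<iota> c" d] by (metis mult.assoc)
    then show ?case
      by (simp add: mult_single anti_ext_single assms(1,3) plus_list_def)
  qed
qed

lemma ustar_add: "ustar (g + h) = ustar g + ustar h"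
  unfolding ustar_def by (rule anti_ext_add) (simp_all add: scal_add)

lemma ustar_mult: "ustar (g * h) = ustar h * ustar g"
  unfolding ustar_def by (rule anti_ext_mult) (simp, simp add: scal_add, simp add: scal_mult, rule scal_commute)

lemma antipode_add: "antipode (g + h) = antipode g + antipode h"
  unfolding antipode_def by (rule anti_ext_add) (simp_all add: scal_add)

lemma antipode_mult: "antipode (g * h) = antipode h * antipode g"
  unfolding antipode_def by (rule anti_ext_mult) (simp, rule scal_add, rule scal_mult, rule scal_commute)

lemma ustar_gens [simp]:
  "ustar gk = gk" "ustar gki = gki" "ustar ge = gf * gk" "ustar gf = gki * ge" "ustar (scal c) = scal (cnj c)" "ustar 1 = 1"
  by (simp_all add: ustar_def gk_def gki_def ge_def gf_def scal_def anti_ext_single flip: word_Nil)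
     (simp_all flip: scal_def)

lemma ustar_uminus: "ustar (- g) = - ustar g"
proof -
  have "ustar (- g) = ustar (scal (- 1) * g)" by (simp add: scal_uminus)
  also have "\<dots> = ustar g * scal (cnj (- 1))" by (simp only: ustar_mult ustar_gens)
  finally show ?thesis by (simp add: scal_uminus)
qed

lemma ustar_diff: "ustar (g - h) = ustar g - ustar h"
  using ustar_add[of g "- h"] by (simp add: ustar_uminus)

lemma antipode_gens [simp]:
  "antipode gk = gki" "antipode gki = gk" "antipode ge = - (gki * ge)" "antipode gf = - (gf * gk)"
  "antipode (scal c) = scal c" "antipode 1 = 1"
  by (simp_all add: antipode_def gk_def gki_def ge_def gf_def scal_def anti_ext_single flip: word_Nil)
     (simp_all flip: scal_def)

text \<open>Both maps reverse products and one of them is antilinear, so this is an antilinear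
  homomorphism. Modulo the relations it exchanges k with k^-1 and sends e to -f and f to -e.\<close>

definition theta :: "falg \<Rightarrow> falg" where
  "theta h = ustar (antipode h)"

lemma theta_add: "theta (g + h) = theta g + theta h"
  and theta_mult: "theta (g * h) = theta g * theta h"
  by (simp_all add: theta_def antipode_add antipode_mult ustar_add ustar_mult)

lemma theta_gens:
  "theta gk = gki" "theta gki = gk" "theta ge = - (gf * gk * gki)" "theta gf = - (gk * (gki * ge))"
  "theta (scal c) = scal (cnj c)" "theta 1 = 1"
  by (simp_all add: theta_def ustar_uminus ustar_mult)

lemma theta_diff: "theta (g - h) = theta g - theta h"
proof -
  have "theta (g - h) + theta h = theta g" using theta_add[of "g - h" h] by simp
  then show ?thesis by (simp add: eq_diff_eq)
qed

text \<open>
  With the weights \<open>c m = (- q)\<^sup>m\<close> the following antilinear map intertwines a representation \<open>H\<^sub>s\<close> with its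
  composition with \<open>h \<mapsto> S(h)\<^sup>*\<close>.
\<close>

definition flip_vec :: "nat \<Rightarrow> (nat \<Rightarrow> real) \<Rightarrow> hvec \<Rightarrow> hvec" where
  "flip_vec N c v i = (if i \<in> spins (real N / 2) then of_real (c (nat \<lfloor>i + real N / 2\<rfloor>)) * cnj (v (- i)) else 0)"

lemma flip_vec_hspace: "flip_vec N c v \<in> hspace (real N / 2)"
  by (rule hspaceI) (simp add: flip_vec_def)

lemma flip_vec_coord:
  assumes "m \<le> N"
  shows "flip_vec N c v (real m - real N / 2) = of_real (c m) * cnj (v (real (N - m) - real N / 2))"
proof -
  have "- (real m - real N / 2) = real (N - m) - real N / 2" using assms by (simp add: of_nat_diff)
  moreover have "nat \<lfloor>real m - real N / 2 + real N / 2\<rfloor> = m" by simp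
  ultimately show ?thesis using spt_in[OF assms] by (simp only: flip_vec_def if_True)
qed

text \<open>The factor q between reflected entries, together with the sign in e \<mapsto> -f, is
  what makes -q the ratio of consecutive weights of the intertwiner.\<close>

lemma e_entry_flip:
  assumes "0 < q" "m < N"
  shows "e_entry q N (N - Suc m) = q * f_entry q N m"
proof -
  have r: "real (N - Suc m) = real N - real m - 1" using assms(2) by (simp add: of_nat_diff)
  have "q powr (real (N - Suc m) - real N / 2 + 1) = q powr (1 + - (real m - real N / 2 + 1))"
    unfolding r by (simp add: field_simps)
  also have "\<dots> = q * q powr (- (real m - real N / 2 + 1))"
    unfolding powr_add using assms by simp
  finally show ?thesis unfolding e_entry_def f_entry_def by (simp add: r mult_ac)
qed

lemma rep_theta_flip:
  assumes q: "0 < q" "q < 1" and v: "v \<in> hspace (real N / 2)"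
  defines "J \<equiv> flip_vec N (\<lambda>m. (- q) ^ m)"
  shows "rep q (real N / 2) (theta h) (J v) = J (rep q (real N / 2) h v)"
proof -
  let ?r = "rep q (real N / 2)" and ?pt = "\<lambda>m::nat. real m - real N / 2"
  have JH: "J u \<in> hspace (real N / 2)" for u unfolding J_def by (rule flip_vec_hspace)
  have Jc: "J u (?pt m) = of_real ((- q) ^ m) * cnj (u (?pt (N - m)))" if "m \<le> N" for u m
    unfolding J_def by (rule flip_vec_coord[OF that])
  have pts: "?pt (N - m) = - ?pt m" if "m \<le> N" for m using that by (simp add: of_nat_diff)
  have K: "?r gki (J u) = J (?r gk u)" for u
  proof (rule hspace_eqI[of _ N])
    fix m assume m: "m \<le> N"
    have p: "- 2 * ?pt m = 2 * ?pt (N - m)" unfolding pts[OF m] by simp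
    show "?r gki (J u) (?pt m) = J (?r gk u) (?pt m)"
      by (simp only: Ki_coord[OF m] Jc[OF m] K_coord[OF diff_le_self] p complex_cnj_mult complex_cnj_complex_of_real mult_ac)
  qed (simp_all add: JH rep_hspace)
  have Ki: "?r gk (J u) = J (?r gki u)" for u
  proof (rule hspace_eqI[of _ N])
    fix m assume m: "m \<le> N"
    have p: "2 * ?pt m = - 2 * ?pt (N - m)" unfolding pts[OF m] by simp
    show "?r gk (J u) (?pt m) = J (?r gki u) (?pt m)"
      by (simp only: K_coord[OF m] Jc[OF m] Ki_coord[OF diff_le_self] p complex_cnj_mult complex_cnj_complex_of_real mult_ac)
  qed (simp_all add: JH rep_hspace)
  have neg: "w \<in> hspace (real N / 2) \<Longrightarrow> - w \<in> hspace (real N / 2)" for w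
    by (simp add: hspace_def uminus_apply)
  have E: "- ?r gf (J u) = J (?r ge u)" for u
  proof (rule hspace_eqI[of _ N])
    fix m assume m: "m \<le> N"
    show "(- ?r gf (J u)) (?pt m) = J (?r ge u) (?pt m)"
    proof (cases "m = N")
      case True
      then show ?thesis using F_coord_N[of q N "J u"] E_coord_0[of q N u] Jc[OF m, of "?r ge u"] by (simp add: uminus_apply)
    next
      case False
      then have m': "m < N" "N - Suc m < N" "Suc (N - Suc m) = N - m" using m by auto
      have "J (?r ge u) (?pt m) = of_real ((- q) ^ m) * (of_real (q * f_entry q N m) * cnj (u (?pt (N - Suc m))))"
        unfolding Jc[OF m] using E_coord_Suc[OF m'(2), of q u] e_entry_flip[OF q(1) m'(1)] unfolding m'(3) by simp
      moreover have "?r gf (J u) (?pt m) = of_real (f_entry q N m) * (of_real ((- q) ^ Suc m) * cnj (u (?pt (N - Suc m))))"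
        using F_coord[OF m'(1), of q "J u"] Jc[of "Suc m" u] m' by simp
      ultimately show ?thesis by (simp add: uminus_apply)
    qed
  qed (simp_all add: JH rep_hspace neg)
  have F: "- ?r ge (J u) = J (?r gf u)" for u
  proof (rule hspace_eqI[of _ N])
    fix m assume m: "m \<le> N"
    show "(- ?r ge (J u)) (?pt m) = J (?r gf u) (?pt m)"
    proof (cases m)
      case 0
      then show ?thesis using E_coord_0[of q N "J u"] F_coord_N[of q N u] Jc[OF m, of "?r gf u"] by (simp add: uminus_apply)
    next
      case (Suc k)
      then have k: "k < N" "N - m < N" "Suc (N - m) = N - k" "N - Suc (N - m) = k" using m by auto
      have "J (?r gf u) (?pt m) = of_real ((- q) ^ m) * (of_real (f_entry q N (N - m)) * cnj (u (?pt (N - k))))"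
        unfolding Jc[OF m] using F_coord[OF k(2), of q u] unfolding k(3) by simp
      moreover have "?r ge (J u) (?pt m) = of_real (q * f_entry q N (N - m)) * (of_real ((- q) ^ k) * cnj (u (?pt (N - k))))"
        using E_coord_Suc[OF k(1), of q "J u"] Jc[of k u] k(1) e_entry_flip[OF q(1) k(2)] unfolding k(4) Suc by simp
      ultimately show ?thesis by (simp add: uminus_apply Suc)
    qed
  qed (simp_all add: JH rep_hspace neg)
  have gen: "?r (theta (word [l])) (J u) = J (?r (word [l]) u)" if "u \<in> hspace (real N / 2)" for l u
  proof (cases l)
    case GK then show ?thesis using K by (simp add: word_simps theta_gens)
  next
    case GKi then show ?thesis using Ki by (simp add: word_simps theta_gens)
  next
    case GE then show ?thesis
      using E by (simp add: word_simps theta_gens rep_uminus rep_mult rep_K_Ki[OF q JH])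
  next
    case GF then show ?thesis
      using F by (simp add: word_simps theta_gens rep_uminus rep_mult rep_K_Ki[OF q] rep_hspace JH)
  qed
  show ?thesis
  proof (induction h rule: falg_induct)
    case (add g h)
    have "J (u + w) = J u + J w" for u w
      by (simp add: J_def flip_vec_def fun_simps distrib_left)
    then show ?case using add by (simp add: theta_add rep_add_left)
  next
    case (single w c)
    have w: "?r (theta (word w)) (J v) = J (?r (word w) v)"
    proof (induction w)
      case Nil
      then show ?case by (simp add: theta_gens rep_1)
    next
      case (Cons l w)
      have "?r (word w) v \<in> hspace (real N / 2)" using v by (rule rep_hspace)
      then show ?case
        using gen Cons by (simp add: word_Cons[of l w] theta_mult rep_mult)
    qed
    have "J (vscale c u) = vscale (cnj c) (J u)" for u
      by (simp add: J_def flip_vec_def fun_simps vscale_apply)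
    then show ?case unfolding single_eq_scal_word[of w c] theta_mult rep_mult theta_gens rep_scal w by simp
  qed
qed

lemma hinner_flip:
  "cnj (hinner (real N / 2) \<xi> (flip_vec N c w)) = hinner (real N / 2) (flip_vec N (\<lambda>m. c (N - m)) \<xi>) w"
proof -
  let ?pt = "\<lambda>m::nat. real m - real N / 2"
  have "cnj (hinner (real N / 2) \<xi> (flip_vec N c w)) = (\<Sum>m\<le>N. \<xi> (?pt m) * (of_real (c m) * w (?pt (N - m))))"
    unfolding hinner_def sum_spins by (simp add: flip_vec_coord)
  also have "\<dots> = (\<Sum>m\<le>N. \<xi> (?pt (N - m)) * (of_real (c (N - m)) * w (?pt m)))"
    by (rule sum.reindex_bij_witness[of _ "\<lambda>m. N - m" "\<lambda>m. N - m"]) auto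
  also have "\<dots> = hinner (real N / 2) (flip_vec N (\<lambda>m. c (N - m)) \<xi>) w"
    unfolding hinner_def sum_spins by (intro sum.cong refl) (simp add: flip_vec_coord mult_ac)
  finally show ?thesis .
qed

text \<open>The intertwiner turns S(h)^* into h, and moving it to the other argument of the inner
  product reflects its weights (\<open>hinner_flip\<close>). So the star of a matrix coefficient is
  again a matrix coefficient.\<close>

lemma astar_mcoef:
  assumes q: "0 < q" "q < 1" and "\<zeta> \<in> hspace (real N / 2)"
  shows "astar (mcoef q (real N / 2) \<xi> \<zeta>) \<in> Oq q"
proof -
  define \<xi>' where "\<xi>' = flip_vec N (\<lambda>m. (- q) ^ (N - m)) \<xi>"
  \<comment> \<open>The preimage of \<zeta> under the flip with weights \<open>(- q) ^ m\<close>;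
    the flip reflects the index, hence the exponent \<open>N - m\<close>.\<close>
  define \<zeta>' where "\<zeta>' = flip_vec N (\<lambda>m. inverse ((- q) ^ (N - m))) \<zeta>"
  have \<zeta>: "flip_vec N (\<lambda>m. (- q) ^ m) \<zeta>' = \<zeta>"
  proof (rule hspace_eqI[of _ N])
    fix m assume m: "m \<le> N"
    show "flip_vec N (\<lambda>m. (- q) ^ m) \<zeta>' (real m - real N / 2) = \<zeta> (real m - real N / 2)"
      unfolding \<zeta>'_def flip_vec_coord[OF m] flip_vec_coord[OF diff_le_self] using q m by simp
  qed (use assms in \<open>simp_all add: flip_vec_hspace\<close>)
  have "astar (mcoef q (real N / 2) \<xi> \<zeta>) = mcoef q (real N / 2) \<xi>' \<zeta>'"
  proof
    fix h
    have "\<zeta>' \<in> hspace (real N / 2)" by (simp add: \<zeta>'_def flip_vec_hspace)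
    from rep_theta_flip[OF q this, of h]
    show "astar (mcoef q (real N / 2) \<xi> \<zeta>) h = mcoef q (real N / 2) \<xi>' \<zeta>' h"
      using hinner_flip[of N \<xi> "\<lambda>m. (- q) ^ m" "rep q (real N / 2) h \<zeta>'"]
      by (simp add: astar_def mcoef_def theta_def \<zeta> \<xi>'_def)
  qed
  then show ?thesis by (simp add: Oq_mcoef \<xi>'_def \<zeta>'_def flip_vec_hspace)
qed

lemma astar_Oq:
  assumes q: "0 < q" "q < 1" and "x \<in> Oq q"
  shows "astar x \<in> Oq q"
  using assms(3)
proof (induction rule: Oq_induct)
  case zero
  have "astar 0 = 0" by (simp add: astar_def fun_simps)
  then show ?case by (simp add: Oq_zero)
next
  case (add x y)
  have "astar (x + y) = astar x + astar y" by (simp add: astar_def fun_simps)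
  then show ?case using add by (simp add: Oq_add)
next
  case (scale c x)
  have "astar (vscale c x) = vscale (cnj c) (astar x)" by (simp add: astar_def fun_simps vscale_apply)
  then show ?case using scale by (simp add: Oq_scale)
qed (rule astar_mcoef[OF q])

lemma cnj_rho: "cnj (rho q) = - rho q"
  by (simp add: rho_def)

text \<open>\<open>S(X)\<^sup>* - [a] = - k (X - [a])\<close> for \<open>X = i R(B\<^sub>t)\<close>, so the involution preserves right invariance.\<close>

lemma astar_podles:
  assumes q: "0 < q" "q < 1" and x: "x \<in> podles q a"
  shows "astar x \<in> podles q a"
proof -
  have xO: "x \<in> Oq q" and xr: "\<And>g. x (g * xel q a) = wt q a * x g"
    using x by (auto simp: podles_iff[OF q])
  have xu: "uq_functional q x" by (rule Oq_uq_functional[OF q xO])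
  have xl: "func_linear x" using xu by (simp add: uq_functional_def)
  note lin = func_linearD[OF xl]
  have scal: "x (g * (scal c * h)) = c * x (g * h)" for g c h
    using lin(2)[of c "g * h"] by (simp add: scal_commute[of g] flip: mult.assoc)
  have "astar x (g * xel q a) = wt q a * astar x g" for g
  proof -
    let ?g = "theta g"
    have KKi: "x (u * gk * gki * v) = x (u * v)" for u v
      using uq_functional_rules(1)[OF xu, of u v] by (simp add: mult.assoc)
    have gk_scal: "gk * (scal c * h) = scal c * (gk * h)" for c h
      by (simp add: scal_commute[of gk] flip: mult.assoc)
    have "theta (xel q a) = scal (- rho q) * (- (gk * (gki * ge)) + gk * (gf * gk * gki)) + scal (wt q a) * gk"
      by (simp add: xel_def theta_add theta_mult theta_diff theta_gens cnj_rho wt_def)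
    then have "x (?g * theta (xel q a)) = - rho q * (- x (?g * ge) + x (?g * gk * gf)) + wt q a * x (?g * gk)"
      using KKi[of ?g ge] KKi[of "?g * gk * gf" 1]
      by (simp add: distrib_left right_diff_distrib scal lin mult.assoc)
    moreover have "x (?g * gk * xel q a) = rho q * (x (?g * gk * gf) - x (?g * ge)) + wt q a * x ?g"
      using KKi[of ?g ge] KKi[of ?g 1] gk_scal
      by (simp add: xel_def distrib_left right_diff_distrib scal lin mult.assoc)
    ultimately have "x (?g * theta (xel q a)) = wt q a * x ?g"
      using xr[of "?g * gk"] by (simp add: algebra_simps)
    then show ?thesis by (simp add: astar_def theta_mult[unfolded theta_def] theta_def wt_def)
  qed
  then show ?thesis using astar_Oq[OF q xO] by (simp add: podles_iff[OF q])
qed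

section \<open>Spherical elements as polynomials\<close>

lemma amult_grouplike:
  assumes "func_linear x" "func_linear y"
  shows "amult x y (gk ^ m) = x (gk ^ m) * y (gk ^ m)"
  by (simp add: amult_eq comult_power tens_power tensor_eval_tens[OF assms])

lemma biinvariant_linear: "biinvariant q a x \<Longrightarrow> func_linear x"
  by (simp add: biinvariant_def uq_functional_def)

lemma biinvariant_zero: "biinvariant q a 0"
  using biinvariant_ascale[OF biinvariant_counit[of q a], of 0]
  by (simp add: ascale_eq_vscale vscale_simps)

lemma biinvariant_sum: "(\<And>i. i \<in> I \<Longrightarrow> biinvariant q a (f i)) \<Longrightarrow> biinvariant q a (\<Sum>i\<in>I. f i)"
  by (induction I rule: infinite_finite_induct) (simp_all add: biinvariant_zero biinvariant_add)

context
  fixes q a :: real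
  assumes q: "0 < q" "q < 1"
begin

lemma biinvariant_apow: "biinvariant q a x \<Longrightarrow> biinvariant q a (apow x k)"
  by (induction k) (simp_all add: biinvariant_counit biinvariant_amult q)

lemma biinvariant_apoly: "biinvariant q a x \<Longrightarrow> biinvariant q a (apoly P x)"
  unfolding apoly_def by (intro biinvariant_sum biinvariant_ascale biinvariant_apow)

lemma apow_grouplike: "biinvariant q a x \<Longrightarrow> apow x k (gk ^ m) = x (gk ^ m) ^ k"
proof (induction k)
  case (Suc k)
  then show ?case
    using amult_grouplike[OF biinvariant_linear[of q a x] biinvariant_linear[OF biinvariant_apow[of x k]]] by simp
qed (simp add: counit_power)

lemma apoly_grouplike: "biinvariant q a x \<Longrightarrow> apoly P x (gk ^ m) = poly P (x (gk ^ m))"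
  by (simp add: apoly_def fun_sum_apply ascale_def apow_grouplike poly_altdef)

lemma biinvariant_eqI:
  assumes "biinvariant q a x" "biinvariant q a y" "\<And>m. x (gk ^ m) = y (gk ^ m)"
  shows "x = y"
proof
  fix h
  have "(x + ascale (- 1) y) h = 0"
    by (rule biinvariant_eq_0[OF q biinvariant_add[OF assms(1) biinvariant_ascale[OF assms(2)]]])
       (simp add: plus_fun_apply ascale_def assms(3))
  then show "x h = y h" by (simp add: plus_fun_apply ascale_def)
qed

interpretation aw: aw_params q a
  by unfold_locales (use q in auto)

context
  fixes \<eta> :: "nat \<Rightarrow> int \<Rightarrow> hvec"
  assumes \<eta>: "eigenvector_family q a \<eta>"
begin

lemma biinvariant_sph: "biinvariant q a (sph q \<eta> n 0)"
  unfolding biinvariant_def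
proof (intro conjI allI)
  have h: "\<eta> n 0 \<in> hspace (real (2 * n) / 2)" using eta_zero(1)[OF q \<eta>, of n] unfolding half_even .
  show "uq_functional q (sph q \<eta> n 0)" "kregular q (sph q \<eta> n 0)"
    using uq_functional_mcoef[OF q h, of "\<eta> n 0"] kregular_mcoef[OF q h, of "\<eta> n 0"]
    unfolding sph_def half_even by auto
  show "sph q \<eta> n 0 (g * xel q a) = wt q a * sph q \<eta> n 0 g" for g by (rule sph_right[OF q \<eta>])
  show "sph q \<eta> n 0 (xel q a * g) = wt q a * sph q \<eta> n 0 g" for g using sph_left[OF q \<eta>, of 0 n g] by simp
qed

lemma sph_aw_equation: "aw_equation aw.Q aw.T (aw_eigenvalue aw.Q n) (\<lambda>m. sph q \<eta> n 0 (gk ^ m))"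
  unfolding aw.Q_def aw.T_def
proof (rule radial_part[OF q biinvariant_sph])
  fix g
  have "rep q (real n) g (\<eta> n 0) \<in> hspace (real (2 * n) / 2)"
    unfolding half_even by (rule hspace_rep_n[OF q \<eta>]) (rule eta_zero[OF q \<eta>])
  from rep_casimir[OF q this] show "sph q \<eta> n 0 (casimir q * g) = casimir_value q (2 * n) * sph q \<eta> n 0 g"
    unfolding half_even by (simp add: sph_def mcoef_def rep_mult hinner_scale)
qed

lemma sph_at_1: "sph q \<eta> n 0 (gk ^ 0) = 1"
  using sph_1[OF q \<eta>, of 0 n] by simp

text \<open>Both sides solve the equation for n = 1 and have the value 1 at m = 0.\<close>

lemma sph_1_0_chi: "sph q \<eta> 1 0 (gk ^ m) = aw.chi m"
  using aw.aw_equation_unique[OF sph_aw_equation[of 1] aw.chi_equation, of m] sph_at_1[of 1] aw.chi_0 by simp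

text \<open>Evaluation at k^m is multiplicative on biinvariant functionals, and u takes infinitely
  many values there.\<close>

lemma apoly_sph_inj:
  assumes "apoly P (sph q \<eta> 1 0) = apoly P' (sph q \<eta> 1 0)"
  shows "P = P'"
proof -
  have "poly (P - P') (aw.chi m) = 0" for m
    using fun_cong[OF assms, of "gk ^ m"] apoly_grouplike[OF biinvariant_sph[of 1]]
    unfolding sph_1_0_chi by simp
  then have "P - P' = 0" by (rule aw.poly_chi_zero)
  then show ?thesis by simp
qed

lemma sph_eq_apoly:
  obtains P where "degree P = n" "normalized_askey_wilson q a n P" "poly P 1 = 1"
    "sph q \<eta> n 0 = apoly P (sph q \<eta> 1 0)"
proof -
  obtain P where P: "degree P = n" "normalized_askey_wilson q a n P" "poly P 1 = 1"
    "aw_equation aw.Q aw.T (aw_eigenvalue aw.Q n) (\<lambda>m. poly P (aw.chi m))"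
    using aw.aw_poly_normalized .
  have "sph q \<eta> n 0 = apoly P (sph q \<eta> 1 0)"
  proof (rule biinvariant_eqI)
    fix m
    show "sph q \<eta> n 0 (gk ^ m) = apoly P (sph q \<eta> 1 0) (gk ^ m)"
      using aw.aw_equation_unique[OF sph_aw_equation[of n] P(4), of m] sph_at_1[of n] P(3)
        apoly_grouplike[OF biinvariant_sph[of 1]]
      unfolding sph_1_0_chi aw.chi_0 by simp
  qed (intro biinvariant_sph biinvariant_apoly)+
  with P show ?thesis using that by blast
qed

lemma podles_sum: "(\<And>i. i \<in> I \<Longrightarrow> f i \<in> podles q a) \<Longrightarrow> (\<Sum>i\<in>I. f i) \<in> podles q a"
  by (induction I rule: infinite_finite_induct) (simp_all add: podles_zero podles_add q)

text \<open>Strong induction inverts the triangular expansion: up to the nonzero leading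
  coefficient, the k-th power is the spherical element of degree k minus lower powers.\<close>

lemma apow_podles: "apow (sph q \<eta> 1 0) k \<in> podles q a"
proof (induction k rule: less_induct)
  case (less k)
  obtain P where P: "degree P = k" "poly P 1 = 1" "sph q \<eta> k 0 = apoly P (sph q \<eta> 1 0)"
    using sph_eq_apoly[of k] by metis
  define c where "c = coeff P k"
  have "P \<noteq> 0" using P(2) by auto
  then have c: "c \<noteq> 0" using P(1) unfolding c_def by (metis leading_coeff_neq_0)
  define r where "r = (\<Sum>i<k. vscale (coeff P i) (apow (sph q \<eta> 1 0) i))"
  have "sph q \<eta> k 0 = r + vscale c (apow (sph q \<eta> 1 0) k)"
    unfolding P(3) apoly_def P(1) r_def c_def ascale_eq_vscale by (simp flip: lessThan_Suc_atMost)
  then have "apow (sph q \<eta> 1 0) k = vscale (inverse c) (sph q \<eta> k 0 + vscale (- 1) r)"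
    using c by (simp add: fun_simps vscale_apply)
  moreover have "r \<in> podles q a" unfolding r_def using less by (intro podles_sum podles_scale q) auto
  moreover have "sph q \<eta> k 0 \<in> podles q a" using sph_podles[OF q \<eta>, of 0 k] by simp
  ultimately show ?case by (simp only: podles_add[OF q] podles_scale[OF q])
qed

end

end

section \<open>Vector states of admissible representations\<close>

lemma tens_scal: "tens (scal c * g) h = scal2 c * tens g h" "tens g (scal c * h) = scal2 c * tens g h"
  using tens_mult[of "scal c" 1 g h] tens_mult[of 1 "scal c" g h] by (simp_all flip: scal2_eq_tens)

text \<open>After expansion the two sides differ only by tensors that contain k^-1 k - 1 in one
  leg.\<close>

lemma uq_eq2_RBt:
  assumes q: "0 < q"
  shows "uq_eq2 q (comult (scal \<i> * RBt q a))
    (tens 1 (scal \<i> * RBt q a) + tens (scal \<i> * RBt q a - scal (wt q a)) gki)"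
proof -
  obtain c where X: "scal \<i> * RBt q a = - (scal (rho q) * (gki * ge)) + scal c * (gki * gf * gk) + scal (wt q a) * gki"
    using RBt_expansion[OF q] .
  let ?I = "two_sided_ideal ((\<lambda>h. tens h 1) ` uq_ideal q \<union> (\<lambda>h. tens 1 h) ` uq_ideal q)"
  have left: "tens r h \<in> ?I" if "r \<in> uq_ideal q" for r h
    using two_sided_ideal_mult_right[OF two_sided_ideal_base, of "tens r 1" _ "tens 1 h"] that by (simp add: tens_mult)
  have right: "tens h r \<in> ?I" if "r \<in> uq_ideal q" for r h
    using two_sided_ideal_mult_left[OF two_sided_ideal_base, of "tens 1 r" _ "tens h 1"] that by (simp add: tens_mult)
  have K: "gki * gk - 1 \<in> uq_ideal q" using uq_eq_Ki_K[of q] by (simp add: uq_eq_def)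
  have K': "gki * (gki * gk - 1) \<in> uq_ideal q"
    using K unfolding uq_ideal_def by (rule two_sided_ideal_mult_left)
  have "comult (scal \<i> * RBt q a) - (tens 1 (scal \<i> * RBt q a) + tens (scal \<i> * RBt q a - scal (wt q a)) gki)
    = - (scal2 (rho q) * tens (gki * gk - 1) (gki * ge))
      + (scal2 c * tens (gki * gk - 1) (gki * gf * gk) + scal2 c * tens (gki * gf * gk) (gki * (gki * gk - 1)))"
  proof -
    have t: "tens (scal (wt q a)) gki = scal2 (wt q a) * tens 1 gki" using tens_scal(1)[of "wt q a" 1 gki] by simp
    show ?thesis
      unfolding X
      by (simp add: comult_add comult_diff comult_uminus comult_mult tens_add_left tens_add_right tens_diff tens_uminus tens_scal t
          tens_mult right_diff_distrib distrib_left distrib_right mult.assoc algebra_simps)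
  qed
  also have "\<dots> \<in> ?I"
    by (intro two_sided_ideal.add two_sided_ideal_uminus two_sided_ideal_mult_left left right K K')
  finally show ?thesis by (simp add: uq_eq2_def)
qed

text \<open>The involution exchanges the e-term and the f-term, with matching signs because
  \<open>rho q\<close> and c are purely imaginary; both elements are congruent to
  \<open>xel\<close>.\<close>

lemma uq_eq_ustar_RBt:
  assumes q: "0 < q"
  shows "uq_eq q (ustar (scal \<i> * RBt q a)) (scal \<i> * RBt q a)"
proof -
  obtain c where c: "c * of_real (q^2) = rho q" "cnj c = - c"
    and X: "scal \<i> * RBt q a = - (scal (rho q) * (gki * ge)) + scal c * (gki * gf * gk) + scal (wt q a) * gki"
    using RBt_expansion[OF q] .
  have "ustar (scal \<i> * RBt q a) = scal (rho q) * (gf * (gk * gki)) - scal c * (gk * (gki * (ge * gki))) + scal (wt q a) * gki"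
  proof -
    have "cnj (wt q a) = wt q a" by (simp add: wt_def)
    then show ?thesis
      unfolding X by (simp add: ustar_add ustar_diff ustar_uminus ustar_mult c(2) cnj_rho scal_uminus scal_commute[of "_ :: falg"] mult.assoc)
  qed
  also have "uq_eq q \<dots> (scal (rho q) * (gf * 1) - scal c * (scal (of_real (q^2)) * gki * ge) + scal (wt q a) * gki)"
  proof (intro uq_eq_add uq_eq_diff uq_eq_mult_left uq_eq_refl uq_eq_K_Ki)
    have "uq_eq q (gk * (gki * (ge * gki))) (1 * (ge * gki))"
      unfolding mult.assoc[symmetric, of gk gki] by (intro uq_eq_mult_right uq_eq_K_Ki)
    also have "\<dots> = scal (of_real (q^2)) * (scal (inverse (of_real (q^2))) * ge * gki)"
      using q scal_mult[of "of_real (q^2)" "inverse (of_real (q^2))"] by (simp flip: mult.assoc)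
    also have "uq_eq q \<dots> (scal (of_real (q^2)) * (gki * ge))"
      by (intro uq_eq_mult_left, rule uq_eq_sym, rule uq_eq_Ki_swap[OF uq_eq_K_E]) (use q in simp)
    finally show "uq_eq q (gk * (gki * (ge * gki))) (scal (of_real (q^2)) * gki * ge)" by (simp add: mult.assoc)
  qed
  also have "\<dots> = xel q a"
  proof -
    have "scal c * (scal (of_real (q^2)) * gki * ge) = scal (rho q) * (gki * ge)"
      by (simp only: c(1)[symmetric] scal_mult mult.assoc)
    then show ?thesis by (simp add: xel_def right_diff_distrib)
  qed
  also have "uq_eq q (xel q a) (scal \<i> * RBt q a)" by (rule uq_eq_sym[OF uq_eq_xel[OF q]])
  finally show ?thesis .
qed

lemma coideal_cong: "h \<in> coideal q a \<Longrightarrow> uq_eq q h' h \<Longrightarrow> h' \<in> coideal q a"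
  unfolding coideal_def by (blast intro: uq_eq_trans)

lemma coideal_linear: "scal c * RBt q a + scal d \<in> coideal q a"
proof -
  have *: "scal c * RBt q a + scal d = (\<Sum>i\<le>degree [:d, c:]. scal (coeff [:d, c:] i) * RBt q a ^ i)"
    by (cases "c = 0") (simp_all add: add.commute)
  show ?thesis unfolding coideal_def mem_Collect_eq
    by (rule exI[of _ "[:d, c:]"]) (simp only: * uq_eq_refl)
qed

lemma coideal_elements:
  "scal \<i> * RBt q a \<in> coideal q a" "1 \<in> coideal q a" "scal d \<in> coideal q a"
  "scal \<i> * RBt q a - scal d \<in> coideal q a"
  using coideal_linear[of \<i> q a 0] coideal_linear[of 0 q a 1] coideal_linear[of 0 q a d] coideal_linear[of \<i> q a "- d"]
  by (simp_all add: scal_uminus)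

section \<open>The vector state of a realization of the representation with parameter
  \<open>lam\<close>\<close>

context
  fixes q a :: real and \<eta> :: "nat \<Rightarrow> int \<Rightarrow> hvec" and lam :: real and V :: "'v::ab_group_add qrep" and e :: 'v
  assumes q: "0 < q" "q < 1" and \<eta>: "eigenvector_family q a \<eta>" and L: "is_Lplus q a \<eta> lam V e"
begin

lemma adm: "pre_hilbert (smul V) (ip V)" "star_rep_B q a V" "star_rep_I q a V" "exchange_relation q a V"
  using L by (simp_all add: is_Lplus_def admissible_def)

lemma ip_simps:
  "ip V u (v + w) = ip V u v + ip V u w" "ip V u (smul V c v) = c * ip V u v" "cnj (ip V u v) = ip V v u"
  "ip V e e = 1"
proof -
  interpret pre_hilbert "smul V" "ip V" by (rule adm)
  show "ip V u (v + w) = ip V u v + ip V u w" "ip V u (smul V c v) = c * ip V u v" "cnj (ip V u v) = ip V v u"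
    by (rule ip_add, rule ip_smul, rule ip_cnj[symmetric])
  show "ip V e e = 1" using L by (simp add: is_Lplus_def)
qed

lemma ip_zero: "ip V u 0 = 0"
  using ip_simps(1)[of u 0 0] by simp

lemma ip_self_nonneg: "Im (ip V w w) = 0 \<and> Re (ip V w w) \<ge> 0"
proof (cases "w = 0")
  case False
  interpret pre_hilbert "smul V" "ip V" by (rule adm)
  show ?thesis using ip_pos[OF False] by (auto simp: complex_is_Real_iff)
qed (simp add: ip_zero)

lemma actB_simps:
  "b \<in> podles q a \<Longrightarrow> b' \<in> podles q a \<Longrightarrow> actB V (b + b') v = actB V b v + actB V b' v"
  "b \<in> podles q a \<Longrightarrow> actB V (ascale c b) v = smul V c (actB V b v)"
  "b \<in> podles q a \<Longrightarrow> b' \<in> podles q a \<Longrightarrow> actB V (amult b b') v = actB V b (actB V b' v)"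
  "actB V counit v = v"
  "b \<in> podles q a \<Longrightarrow> ip V (actB V b v) w = ip V v (actB V (astar b) w)"
  using adm(2) by (auto simp: star_rep_B_def)

lemma actB_smul: "b \<in> podles q a \<Longrightarrow> actB V b (smul V c v) = smul V c (actB V b v)"
proof -
  assume "b \<in> podles q a"
  then have "Vector_Spaces.linear (smul V) (smul V) (actB V b)" using adm(2) by (auto simp: star_rep_B_def)
  then show ?thesis by (simp add: Vector_Spaces.linear_iff)
qed

lemma e_weight: "actI V (scal \<i> * RBt q a) e = smul V (wt q a) e"
  using L by (simp add: is_Lplus_def weight_space_def wt_def)

lemma shifted_actI_e: "actI V (scal \<i> * RBt q a - scal (wt q a)) e = 0"
proof -
  interpret vs: vector_space "smul V" using adm(1) by (simp add: pre_hilbert_def)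
  have "actI V (scal \<i> * RBt q a + scal (- wt q a)) e = actI V (scal \<i> * RBt q a) e + actI V (scal (- wt q a)) e"
    using adm(3) coideal_elements(1,3) unfolding star_rep_I_def by blast
  also have "actI V (scal (- wt q a)) e = smul V (- wt q a) e"
  proof -
    have "actI V (scal (- wt q a) * 1) e = smul V (- wt q a) (actI V 1 e)"
      using adm(3) coideal_elements(2) unfolding star_rep_I_def by blast
    also have "actI V 1 e = e" using adm(3) unfolding star_rep_I_def by blast
    finally show ?thesis by simp
  qed
  finally show ?thesis by (simp add: e_weight scal_uminus flip: vs.scale_left_distrib)
qed

text \<open>X - [a] is self-adjoint modulo the relations and annihilates e, so its range is
  orthogonal to e.\<close>

lemma ip_shifted_actI: "ip V e (actI V (scal \<i> * RBt q a - scal (wt q a)) w) = 0"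
proof -
  let ?Y = "scal \<i> * RBt q a - scal (wt q a)"
  have "ustar ?Y = ustar (scal \<i> * RBt q a) - scal (wt q a)"
    by (simp add: ustar_diff wt_def del: ustar_gens(5)) (simp add: ustar_gens(5))
  then have eq: "uq_eq q (ustar ?Y) ?Y"
    using uq_eq_diff[OF uq_eq_ustar_RBt[OF q(1), of a] uq_eq_refl] by simp
  have "ip V e (actI V ?Y w) = cnj (ip V (actI V ?Y w) e)" by (simp add: ip_simps)
  also have "ip V (actI V ?Y w) e = ip V w (actI V (ustar ?Y) e)"
    using adm(3) coideal_elements(4) unfolding star_rep_I_def by blast
  also have "actI V (ustar ?Y) = actI V ?Y"
    using adm(3) coideal_cong[OF coideal_elements(4) eq] coideal_elements(4) eq unfolding star_rep_I_def by blast
  finally show ?thesis by (simp add: shifted_actI_e ip_zero)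
qed

text \<open>The exchange relation for X reads b X = (b \<lhd> X) + (X - [a]) (b \<lhd> k^-1).
  Applied to e and paired with e, the last term drops out, which leaves [a] \<omega>(b) = c
  \<omega>(b).\<close>

lemma omega_weight_zero:
  assumes b: "b \<in> podles q a" and eig: "\<And>g. b (xel q a * g) = c * b g" and c: "c \<noteq> wt q a"
  shows "omega V e b = 0"
proof -
  let ?X = "scal \<i> * RBt q a"
  have bu: "uq_functional q b" using b Oq_uq_functional[OF q] by (simp add: podles_iff[OF q])
  have r: "ract b ?X = ascale c b"
  proof
    fix g
    show "ract b ?X g = ascale c b g"
      using uq_functional_cong2[OF bu uq_eq_xel[OF q(1), of a], of 1 g] eig by (simp add: ract_def ascale_def)
  qed
  have "actB V b (actI V ?X e) = (\<Sum>(h1, h2)\<leftarrow>[(1, ?X), (?X - scal (wt q a), gki)]. actI V h1 (actB V (ract b h2) e))"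
  proof -
    have "(\<forall>(h1, h2)\<in>set [(1, ?X), (?X - scal (wt q a), gki)]. h1 \<in> coideal q a) \<and>
        uq_eq2 q (comult ?X) (\<Sum>(h1, h2)\<leftarrow>[(1, ?X), (?X - scal (wt q a), gki)]. tens h1 h2)"
      using uq_eq2_RBt[OF q(1), of a] coideal_elements by simp
    then show ?thesis using adm(4) b coideal_elements(1) unfolding exchange_relation_def by blast
  qed
  then have "actB V b (smul V (wt q a) e) = actI V 1 (actB V (ascale c b) e) + actI V (?X - scal (wt q a)) (actB V (ract b gki) e)"
    by (simp add: e_weight r)
  also have "actI V 1 (actB V (ascale c b) e) = smul V c (actB V b e)"
    using adm(3) actB_simps(2)[OF b] unfolding star_rep_I_def by metis
  finally have "smul V (wt q a) (actB V b e) = smul V c (actB V b e) + actI V (?X - scal (wt q a)) (actB V (ract b gki) e)"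
    unfolding actB_smul[OF b] .
  then have "ip V e (smul V (wt q a) (actB V b e)) = ip V e (smul V c (actB V b e) + actI V (?X - scal (wt q a)) (actB V (ract b gki) e))"
    by (rule arg_cong)
  then show ?thesis using c by (simp add: ip_simps ip_shifted_actI omega_def)
qed

lemma omega_sph_zero: "\<bar>j\<bar> \<le> int n \<Longrightarrow> j \<noteq> 0 \<Longrightarrow> omega V e (sph q \<eta> n j) = 0"
  using omega_weight_zero[OF sph_podles[OF q \<eta>] sph_left[OF q \<eta>], of j n] wt_inj[OF q, of "a + 2 * of_int j" a] by force

lemma omega_add: "b \<in> podles q a \<Longrightarrow> b' \<in> podles q a \<Longrightarrow> omega V e (b + b') = omega V e b + omega V e b'"
  and omega_scale: "b \<in> podles q a \<Longrightarrow> omega V e (ascale c b) = c * omega V e b"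
  and omega_counit: "omega V e counit = 1"
  by (simp_all add: omega_def actB_simps ip_simps)

lemma omega_zero: "omega V e 0 = 0"
  using omega_add[of 0 0] podles_zero[OF q] by simp

lemma omega_sum: "(\<And>i. i \<in> I \<Longrightarrow> f i \<in> podles q a) \<Longrightarrow> omega V e (\<Sum>i\<in>I. f i) = (\<Sum>i\<in>I. omega V e (f i))"
  by (induction I rule: infinite_finite_induct) (simp_all add: omega_zero omega_add podles_sum[OF q \<eta>])

lemma omega_astar: "b \<in> podles q a \<Longrightarrow> omega V e (astar b) = cnj (omega V e b)"
  using actB_simps(5)[of b e e] by (simp add: omega_def ip_simps)

lemma omega_square_nonneg:
  assumes "b \<in> podles q a"
  shows "Im (omega V e (amult (astar b) b)) = 0 \<and> Re (omega V e (amult (astar b) b)) \<ge> 0"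
proof -
  have "omega V e (amult (astar b) b) = ip V (actB V b e) (actB V b e)"
    using actB_simps(5)[OF assms, of e "actB V b e"] actB_simps(3)[OF astar_podles[OF q assms] assms]
    by (simp add: omega_def)
  then show ?thesis using ip_self_nonneg by simp
qed

definition chival :: complex where
  "chival = of_real ((lam + inverse (q + inverse q) * (tpar q a)^2)
                        / (q + inverse q + inverse (q + inverse q) * (tpar q a)^2))"

lemma actB_apow: "actB V (apow (sph q \<eta> 1 0) k) e = smul V (chival ^ k) e"
proof (induction k)
  interpret vs: vector_space "smul V" using adm(1) by (simp add: pre_hilbert_def)
  case 0
  show ?case by (simp add: actB_simps)
  case (Suc k)
  have u: "sph q \<eta> 1 0 \<in> podles q a" using sph_podles[OF q \<eta>, of 0 1] by simp
  have "actB V (sph q \<eta> 1 0) e = smul V chival e" using L by (simp add: is_Lplus_def chival_def)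
  then show ?case
    using actB_simps(3)[OF u apow_podles[OF q \<eta>]] Suc by (simp add: actB_smul[OF u] mult.commute del: One_nat_def)
qed

lemma omega_apoly: "omega V e (apoly P (sph q \<eta> 1 0)) = poly P chival"
proof -
  have "omega V e (apoly P (sph q \<eta> 1 0)) = (\<Sum>i\<le>degree P. coeff P i * omega V e (apow (sph q \<eta> 1 0) i))"
    unfolding apoly_def
    by (subst omega_sum)
       (use apow_podles[OF q \<eta>] podles_scale[OF q] in \<open>auto simp: omega_scale ascale_eq_vscale[symmetric]\<close>)
  then show ?thesis by (simp add: omega_def actB_apow ip_simps poly_altdef del: One_nat_def)
qed

end

text \<open>With P(z) - P(1) = (z - 1) R(z) and z - 1 = -(\<Lambda> - l)/D, the quotient equals
  -R(z)/D for l < \<Lambda>, and R(1) = P'(1).\<close>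

lemma poly_difference_quotient_tendsto:
  fixes P :: "complex poly" and D \<Lambda> d :: real
  assumes "D \<noteq> 0" and "\<Lambda> + d = D"
  shows "((\<lambda>l. (poly P (of_real ((l + d) / D)) - poly P 1) / of_real (\<Lambda> - l)) \<longlongrightarrow> - (1 / of_real D) * poly (pderiv P) 1) (at_left \<Lambda>)"
proof -
  have "[:- 1, 1:] dvd (P - [:poly P 1:])" using poly_eq_0_iff_dvd[of "P - [:poly P 1:]" 1] by simp
  then obtain R where R: "P - [:poly P 1:] = [:- 1, 1:] * R" by (elim dvdE)
  have Pz: "poly P z - poly P 1 = (z - 1) * poly R z" for z
    using arg_cong[OF R, of "\<lambda>p. poly p z"] by (simp add: algebra_simps)
  have "pderiv (P - [:poly P 1:]) = [:- 1, 1:] * pderiv R + R * pderiv [:- 1, 1:]"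
    unfolding R by (rule pderiv_mult)
  then have R1: "poly (pderiv P) 1 = poly R 1" by (simp add: pderiv_diff pderiv_pCons)
  have "((\<lambda>l. - (1 / of_real D) * poly R (of_real ((l + d) / D))) \<longlongrightarrow> - (1 / of_real D) * poly R (of_real ((\<Lambda> + d) / D))) (at_left \<Lambda>)"
    using assms(1) by (intro tendsto_intros)
  moreover have "complex_of_real ((\<Lambda> + d) / D) = 1" using assms by simp
  ultimately have lim: "((\<lambda>l. - (1 / of_real D) * poly R (of_real ((l + d) / D))) \<longlongrightarrow> - (1 / of_real D) * poly (pderiv P) 1) (at_left \<Lambda>)"
    by (simp only: R1)
  show ?thesis
  proof (rule Lim_transform_eventually[OF lim])
    show "\<forall>\<^sub>F l in at_left \<Lambda>. - (1 / of_real D) * poly R (of_real ((l + d) / D))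
        = (poly P (of_real ((l + d) / D)) - poly P 1) / of_real (\<Lambda> - l)"
    proof (rule eventually_at_leftI[of "\<Lambda> - 1"])
      fix l assume "l \<in> {\<Lambda> - 1<..<\<Lambda>}"
      then have "\<Lambda> - l \<noteq> 0" by simp
      moreover have "(l + d) / D - 1 = - (1 / D) * (\<Lambda> - l)"
      proof -
        have "l + d = D - (\<Lambda> - l)" using assms(2) by simp
        moreover have "(D - x) / D - 1 = - (1 / D) * x" for x using assms(1) by (simp add: diff_divide_distrib)
        ultimately show ?thesis by (simp only:)
      qed
      then have "complex_of_real ((l + d) / D) - 1 = - (1 / of_real D) * of_real (\<Lambda> - l)"
        by (metis of_real_1 of_real_diff of_real_divide of_real_minus of_real_mult)
      ultimately show "- (1 / of_real D) * poly R (of_real ((l + d) / D))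
        = (poly P (of_real ((l + d) / D)) - poly P 1) / of_real (\<Lambda> - l)"
        unfolding Pz by (simp del: of_real_diff of_real_divide of_real_add)
    qed simp
  qed
qed

text \<open>The constant is quantified before the eigenvectors and the realizations, so it does not
  vary with their choice.\<close>

theorem theorem5p4:
  fixes q a :: real
  assumes "0 < q" and "q < 1"
  shows "\<exists>c::complex.
    \<forall>(\<eta> :: nat \<Rightarrow> int \<Rightarrow> hvec) (V :: real \<Rightarrow> 'v::ab_group_add qrep) (e :: real \<Rightarrow> 'v).
      eigenvector_family q a \<eta> \<longrightarrow>
      (\<forall>l. 0 < l \<and> l < q + inverse q \<longrightarrow> is_Lplus q a \<eta> l (V l) (e l)) \<longrightarrow>
      (\<exists>L :: func \<Rightarrow> complex.
         (\<forall>b\<in>podles q a.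
            ((\<lambda>l. (omega (V l) (e l) b - acounit b) / of_real (q + inverse q - l))
               \<longlongrightarrow> L b) (at_left (q + inverse q))) \<and>
         generating_functional q a L \<and>
         (\<forall>n. (\<exists>!P. sph q \<eta> n 0 = apoly P (sph q \<eta> 1 0)) \<and>
              (\<forall>P. sph q \<eta> n 0 = apoly P (sph q \<eta> 1 0) \<longrightarrow>
                 degree P = n \<and> normalized_askey_wilson q a n P \<and>
                 L (sph q \<eta> n 0) = c * poly (pderiv P) 1)))"
proof -
  note q = assms
  define \<Lambda> where "\<Lambda> = q + inverse q"
  define d where "d = inverse (q + inverse q) * (tpar q a)^2"
  define D where "D = q + inverse q + inverse (q + inverse q) * (tpar q a)^2"
  have \<Lambda>: "\<Lambda> > 0" using q by (simp add: \<Lambda>_def add_pos_pos)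
  have D: "D \<noteq> 0" using \<Lambda> unfolding D_def \<Lambda>_def by (smt (verit) inverse_positive_iff_positive mult_nonneg_nonneg zero_le_power2)
  have \<Lambda>d: "\<Lambda> + d = D" by (simp add: \<Lambda>_def d_def D_def)
  show ?thesis
  \<comment> \<open>The evaluation point (l + d)/D has slope 1/D in l, while the denominator
    \<Lambda> - l has slope -1; their ratio is the constant.\<close>
  proof (intro exI[of _ "- (1 / complex_of_real D)"] allI impI)
    fix \<eta> :: "nat \<Rightarrow> int \<Rightarrow> hvec" and V :: "real \<Rightarrow> 'v qrep" and e :: "real \<Rightarrow> 'v"
    assume \<eta>: "eigenvector_family q a \<eta>"
      and hyp: "\<forall>l. 0 < l \<and> l < q + inverse q \<longrightarrow> is_Lplus q a \<eta> l (V l) (e l)"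
    let ?at = "at_left \<Lambda>"
    define F where "F b l = (omega (V l) (e l) b - acounit b) / complex_of_real (\<Lambda> - l)" for b l
    have ev: "\<forall>\<^sub>F l in ?at. is_Lplus q a \<eta> l (V l) (e l) \<and> l < \<Lambda>"
      by (rule eventually_at_leftI[of 0]) (use hyp \<Lambda> in \<open>auto simp: \<Lambda>_def\<close>)
    have nt: "?at \<noteq> bot" by simp
    \<comment> \<open>The value 0 where no limit exists keeps the positivity condition true also for
      products whose convergence is not established.\<close>
    define L where "L b = (if \<exists>c. (F b \<longlongrightarrow> c) ?at then Lim ?at (F b) else 0)" for b
    have L_eq: "L b = c" if "(F b \<longlongrightarrow> c) ?at" for b c
      using that tendsto_Lim[OF nt that] by (auto simp: L_def)
    have F_add: "(F (b + b') \<longlongrightarrow> c + c') ?at"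
      if "b \<in> podles q a" "b' \<in> podles q a" "(F b \<longlongrightarrow> c) ?at" "(F b' \<longlongrightarrow> c') ?at" for b b' c c'
    proof (rule Lim_transform_eventually[OF tendsto_add[OF that(3,4)]])
      show "\<forall>\<^sub>F l in ?at. F b l + F b' l = F (b + b') l"
        using ev
      proof (rule eventually_mono)
        fix l assume l: "is_Lplus q a \<eta> l (V l) (e l) \<and> l < \<Lambda>"
        show "F b l + F b' l = F (b + b') l"
          using omega_add[OF q \<eta> conjunct1[OF l] that(1,2)]
          by (simp add: F_def acounit_def plus_fun_apply add_divide_distrib diff_divide_distrib)
      qed
    qed
    have F_scale: "(F (ascale k b) \<longlongrightarrow> k * c) ?at" if "b \<in> podles q a" "(F b \<longlongrightarrow> c) ?at" for k b c
    proof (rule Lim_transform_eventually[OF tendsto_mult_left[OF that(2)]])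
      show "\<forall>\<^sub>F l in ?at. k * F b l = F (ascale k b) l"
        using ev
      proof (rule eventually_mono)
        fix l assume l: "is_Lplus q a \<eta> l (V l) (e l) \<and> l < \<Lambda>"
        show "k * F b l = F (ascale k b) l"
          using omega_scale[OF q \<eta> conjunct1[OF l] that(1)]
          by (simp add: F_def acounit_def ascale_def right_diff_distrib diff_divide_distrib)
      qed
    qed
    have F_sph: "(F (sph q \<eta> n 0) \<longlongrightarrow> - (1 / complex_of_real D) * poly (pderiv P) 1) ?at"
      if P: "sph q \<eta> n 0 = apoly P (sph q \<eta> 1 0)" "poly P 1 = 1" for n P
    proof (rule Lim_transform_eventually[OF poly_difference_quotient_tendsto[OF D \<Lambda>d, of P]])
      show "\<forall>\<^sub>F l in ?at. (poly P (of_real ((l + d) / D)) - poly P 1) / complex_of_real (\<Lambda> - l) = F (sph q \<eta> n 0) l"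
        using ev
      proof (rule eventually_mono)
        fix l assume l: "is_Lplus q a \<eta> l (V l) (e l) \<and> l < \<Lambda>"
        have "acounit (sph q \<eta> n 0) = 1" using sph_1[OF q \<eta>, of 0 n] by (simp add: acounit_def)
        then show "(poly P (of_real ((l + d) / D)) - poly P 1) / complex_of_real (\<Lambda> - l) = F (sph q \<eta> n 0) l"
          using omega_apoly[OF q \<eta> conjunct1[OF l], of P]
          by (simp add: F_def chival_def[OF q \<eta> conjunct1[OF l]] P(2) d_def D_def del: One_nat_def flip: P(1))
      qed
    qed
    have F_sph_0: "(F (sph q \<eta> n j) \<longlongrightarrow> 0) ?at" if "\<bar>j\<bar> \<le> int n" "j \<noteq> 0" for n j
    proof (rule Lim_transform_eventually[OF tendsto_const])
      show "\<forall>\<^sub>F l in ?at. 0 = F (sph q \<eta> n j) l"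
        using ev
      proof (rule eventually_mono)
        fix l assume l: "is_Lplus q a \<eta> l (V l) (e l) \<and> l < \<Lambda>"
        show "0 = F (sph q \<eta> n j) l"
          using omega_sph_zero[OF q \<eta> conjunct1[OF l] that] sph_1[OF q \<eta> that(1)] that(2)
          by (simp add: F_def acounit_def)
      qed
    qed
    have conv: "\<exists>c. (F b \<longlongrightarrow> c) ?at" if "b \<in> podles q a" for b
    proof -
      interpret vs: vector_space "vscale :: complex \<Rightarrow> func \<Rightarrow> func" by (rule vector_space_vscale)
      have "b \<in> vs.span {sph q \<eta> n j |n j. \<bar>j\<bar> \<le> int n}" by (rule podles_span[OF q \<eta> that])
      then have "b \<in> podles q a \<and> (\<exists>c. (F b \<longlongrightarrow> c) ?at)"
      proof (induction rule: vs.span_induct_alt)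
        case base
        have "(F 0 \<longlongrightarrow> 0) ?at"
        proof (rule Lim_transform_eventually[OF tendsto_const])
          show "\<forall>\<^sub>F l in ?at. 0 = F 0 l"
            using ev
          proof (rule eventually_mono)
            fix l assume l: "is_Lplus q a \<eta> l (V l) (e l) \<and> l < \<Lambda>"
            show "0 = F 0 l" using omega_zero[OF q \<eta> conjunct1[OF l]] by (simp add: F_def acounit_def zero_fun_apply)
          qed
        qed
        then show ?case using podles_zero[OF q] by blast
      next
        case (step k x y)
        then obtain n j where x: "x = sph q \<eta> n j" "\<bar>j\<bar> \<le> int n" by blast
        have xp: "x \<in> podles q a" unfolding x(1) by (rule sph_podles[OF q \<eta> x(2)])
        have "\<exists>c. (F x \<longlongrightarrow> c) ?at"
        proof (cases "j = 0")
          case True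
          obtain P where "poly P 1 = 1" "sph q \<eta> n 0 = apoly P (sph q \<eta> 1 0)" using sph_eq_apoly[OF q \<eta>, of n] by metis
          then show ?thesis using F_sph x True by blast
        next
          case False
          then show ?thesis using F_sph_0 x by blast
        qed
        then obtain c c' where "(F x \<longlongrightarrow> c) ?at" "(F y \<longlongrightarrow> c') ?at" using step by blast
        then have "(F (vscale k x + y) \<longlongrightarrow> k * c + c') ?at"
          using F_add[OF podles_scale[OF q xp, of k], of y "k * c" c'] F_scale[OF xp, of c k] step
          by (simp add: ascale_eq_vscale)
        then show ?case using podles_add[OF q podles_scale[OF q xp]] step by blast
      qed
      then show ?thesis by blast
    qed
    have lim: "(F b \<longlongrightarrow> L b) ?at" if "b \<in> podles q a" for b
      using conv[OF that] L_eq by metis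
    show "\<exists>L :: func \<Rightarrow> complex.
         (\<forall>b\<in>podles q a.
            ((\<lambda>l. (omega (V l) (e l) b - acounit b) / of_real (q + inverse q - l))
               \<longlongrightarrow> L b) (at_left (q + inverse q))) \<and>
         generating_functional q a L \<and>
         (\<forall>n. (\<exists>!P. sph q \<eta> n 0 = apoly P (sph q \<eta> 1 0)) \<and>
              (\<forall>P. sph q \<eta> n 0 = apoly P (sph q \<eta> 1 0) \<longrightarrow>
                 degree P = n \<and> normalized_askey_wilson q a n P \<and>
                 L (sph q \<eta> n 0) = - (1 / complex_of_real D) * poly (pderiv P) 1))"
    proof (intro exI[of _ L] conjI allI)
      show "\<forall>b\<in>podles q a. ((\<lambda>l. (omega (V l) (e l) b - acounit b) / of_real (q + inverse q - l))
               \<longlongrightarrow> L b) (at_left (q + inverse q))"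
        using lim unfolding F_def \<Lambda>_def by blast
      show "generating_functional q a L"
        unfolding generating_functional_def
      proof (intro conjI ballI allI impI)
        fix x y assume "x \<in> podles q a" "y \<in> podles q a"
        then show "L (x + y) = L x + L y" by (intro L_eq F_add lim)
      next
        fix c x assume "x \<in> podles q a"
        then show "L (ascale c x) = c * L x" by (intro L_eq F_scale lim)
      next
        fix x assume x: "x \<in> podles q a"
        show "L (astar x) = cnj (L x)"
        proof (rule L_eq, rule Lim_transform_eventually[OF tendsto_cnj[OF lim[OF x]]])
          show "\<forall>\<^sub>F l in ?at. cnj (F x l) = F (astar x) l"
            using ev
          proof (rule eventually_mono)
            fix l assume l: "is_Lplus q a \<eta> l (V l) (e l) \<and> l < \<Lambda>"
            have "acounit (astar x) = cnj (acounit x)" by (simp add: acounit_def astar_def)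
            then show "cnj (F x l) = F (astar x) l"
              using omega_astar[OF q \<eta> conjunct1[OF l] x] by (simp add: F_def)
          qed
        qed
        assume 0: "acounit x = 0"
        have xl: "func_linear x" "func_linear (astar x)"
          using x astar_podles[OF q x] Oq_uq_functional[OF q] by (auto simp: podles_iff[OF q] uq_functional_def)
        have pos: "L (amult (astar x) x) \<in> \<real> \<and> 0 \<le> Re (L (amult (astar x) x))"
        \<comment> \<open>The counit of x^* x vanishes, so an existing limit is one of nonnegative
          reals; otherwise L is 0 by its definition.\<close>
        proof (cases "\<exists>c. (F (amult (astar x) x) \<longlongrightarrow> c) ?at")
          case True
          then obtain c where c: "(F (amult (astar x) x) \<longlongrightarrow> c) ?at" by blast
          have evF: "\<forall>\<^sub>F l in ?at. Im (F (amult (astar x) x) l) = 0 \<and> Re (F (amult (astar x) x) l) \<ge> 0"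
            using ev
          proof (rule eventually_mono)
            fix l assume l: "is_Lplus q a \<eta> l (V l) (e l) \<and> l < \<Lambda>"
            have "acounit (amult (astar x) x) = 0"
              using 0 amult_1[OF xl(2,1)] by (simp add: acounit_def)
            then show "Im (F (amult (astar x) x) l) = 0 \<and> Re (F (amult (astar x) x) l) \<ge> 0"
              using omega_square_nonneg[OF q \<eta> conjunct1[OF l] x] l
              by (simp add: F_def Im_divide_of_real Re_divide_of_real del: of_real_diff)
          qed
          have "0 \<le> Re c"
            by (rule tendsto_lowerbound[OF tendsto_Re[OF c] _ nt]) (rule eventually_mono[OF evF], simp)
          moreover have "((\<lambda>l. Im (F (amult (astar x) x) l)) \<longlongrightarrow> 0) ?at"
            by (rule Lim_transform_eventually[OF tendsto_const]) (rule eventually_mono[OF evF], simp)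
          then have "Im c = 0" using tendsto_unique[OF nt tendsto_Im[OF c]] by blast
          ultimately show ?thesis by (simp add: L_eq[OF c] complex_is_Real_iff)
        next
          case False
          then show ?thesis by (simp add: L_def)
        qed
        then show "L (amult (astar x) x) \<in> \<real>" "0 \<le> Re (L (amult (astar x) x))" by auto
      next
        show "L counit = 0"
        proof (rule L_eq, rule Lim_transform_eventually[OF tendsto_const])
          show "\<forall>\<^sub>F l in ?at. 0 = F counit l"
            using ev
          proof (rule eventually_mono)
            fix l assume l: "is_Lplus q a \<eta> l (V l) (e l) \<and> l < \<Lambda>"
            show "0 = F counit l" using omega_counit[OF q \<eta> conjunct1[OF l]] by (simp add: F_def acounit_def)
          qed
        qed
      qed
    next
      fix n
      obtain P where P: "degree P = n" "normalized_askey_wilson q a n P" "poly P 1 = 1"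
        "sph q \<eta> n 0 = apoly P (sph q \<eta> 1 0)"
        using sph_eq_apoly[OF q \<eta>] .
      have uniq: "P' = P" if "sph q \<eta> n 0 = apoly P' (sph q \<eta> 1 0)" for P'
        using apoly_sph_inj[OF q \<eta>, of P' P] that P(4) by simp
      show "\<exists>!P. sph q \<eta> n 0 = apoly P (sph q \<eta> 1 0)" using P(4) uniq by blast
      show "sph q \<eta> n 0 = apoly P' (sph q \<eta> 1 0) \<longrightarrow>
                 degree P' = n \<and> normalized_askey_wilson q a n P' \<and>
                 L (sph q \<eta> n 0) = - (1 / complex_of_real D) * poly (pderiv P') 1" for P'
        using uniq[of P'] P L_eq[OF F_sph[OF P(4,3)]] by blast
    qed
  qed
qed

end
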